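(* Let $\ell$ be a positive integer and let $q=p^r$ be a prime power ($p$ prime, $r\ge1$). The function $$f_{q,\ell}(n)=\frac{\psi_q(n,\underbrace{0,\ldots,0}_{\ell})-q^{n-\ell}}{q^{n/2}},\qquad n\in\mathbb{N}_{>0},$$ is periodic in $n$ if and only if one of the following conditions holds: (1) $\ell=1$, in which case the period is $1$; (2) $\ell=2$, in which case the period divides $4p$; (3) $\ell=3$ and $p\in\{2,5\}$, in which case the period divides $12p$.
   Context: $\mathbb{F}_q$ is the finite field with $q$ elements; $\mathcal{M}_{n,q}$ is the set of monic polynomials of degree $n$ in $\mathbb{F}_q[T]$. The $j$-th next-to-leading coefficient of a monic polynomial $f$ of degree $n$ is the coefficient of $T^{n-j}$ in $f$ ($j\ge1$), with the convention that it is $0$ if $j>n$. The von Mangoldt function is $\Lambda_q(f)=\deg P$ if $f=P^k$ with $P$ monic irreducible and $k\ge1$, and $\Lambda_q(f)=0$ otherwise. For $n\ge1$ and $t_1,\dots,t_\ell\in\mathbb{F}_q$, $\psi_q(n,t_1,\dots,t_\ell)=\sum \Lambda_q(f)$, the sum being over all $f\in\mathcal{M}_{n,q}$ whose first $\ell$ next-to-leading coefficients are $t_1,\dots,t_\ell$ (this is defined also when $\ell>n$, using the convention). A function $f$ on $\mathbb{N}_{>0}$ is periodic if there is an integer $N\ge1$ with $f(n+N)=f(n)$ for all $n\ge1$; "the period" is the least such $N$. *)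

theory Defs
  imports "HOL-Library.Cardinality" "HOL-Computational_Algebra.Computational_Algebra"
begin

text \<open>A finite field with \<open>q\<close> elements is a type \<open>'a\<close> of class \<open>{finite, field}\<close> with
  \<open>CARD('a) = q\<close>.\<close>

definition monic_polys :: "nat \<Rightarrow> 'a::{finite,field} poly set" where
  "monic_polys n = {f. degree f = n \<and> lead_coeff f = 1}"

lemma finite_monic_polys: "finite (monic_polys n :: 'a::{finite,field} poly set)"
proof (rule finite_subset)
  show "monic_polys n \<subseteq> Poly ` {xs :: 'a list. set xs \<subseteq> UNIV \<and> length xs = Suc n}"
  proof
    fix f :: "'a poly" assume "f \<in> monic_polys n"
    then have "degree f = n" "f \<noteq> 0" by (auto simp: monic_polys_def)
    then have "length (coeffs f) = Suc n" by (simp add: length_coeffs_degree)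
    then have "coeffs f \<in> {xs. set xs \<subseteq> UNIV \<and> length xs = Suc n}" by simp
    moreover have "f = Poly (coeffs f)" by simp
    ultimately show "f \<in> Poly ` {xs. set xs \<subseteq> UNIV \<and> length xs = Suc n}" by blast
  qed
  show "finite (Poly ` {xs :: 'a list. set xs \<subseteq> UNIV \<and> length xs = Suc n})"
    by (intro finite_imageI finite_lists_length_eq) simp
qed

text \<open>The coefficient of \<open>T ^ (n - j)\<close> for \<open>n = degree f\<close>. The case distinction is needed
  because of the truncated subtraction on \<^typ>\<open>nat\<close>.\<close>

definition next_to_leading_coeff :: "'a::{finite,field} poly \<Rightarrow> nat \<Rightarrow> 'a" where
  "next_to_leading_coeff f j = (if j \<le> degree f then coeff f (degree f - j) else 0)"

definition poly_mangoldt :: "'a::{finite,field} poly \<Rightarrow> nat" where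
  "poly_mangoldt f =
     (if \<exists>P k. lead_coeff P = 1 \<and> irreducible P \<and> k \<ge> 1 \<and> f = P ^ k
      then degree (THE P. lead_coeff P = 1 \<and> irreducible P \<and> (\<exists>k\<ge>1. f = P ^ k))
      else 0)"

text \<open>The base \<open>P\<close> is unique, so the definite description above is well defined:\<close>

lemma monic_irreducible_power_unique:
  fixes P Q :: "'a::{finite,field} poly"
  assumes P: "lead_coeff P = 1" "irreducible P" "k \<ge> 1"
    and Q: "lead_coeff Q = 1" "irreducible Q"
    and eq: "P ^ k = Q ^ m"
  shows "P = Q"
proof -
  have "prime_elem P" using P(2) by (rule field_poly_irreducible_imp_prime)
  moreover have "P dvd Q ^ m" using P(3) by (subst eq [symmetric]) (simp add: dvd_power)
  ultimately have "P dvd Q" by (rule prime_elem_dvd_power)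
  then obtain c where c: "Q = P * c" by blast
  moreover have "\<not> is_unit P" using P(2) by (simp add: irreducible_not_unit)
  ultimately have "is_unit c" using Q(2) by (auto dest: irreducibleD)
  then obtain a where a: "c = [:a:]" by (auto simp: is_unit_poly_iff)
  have "lead_coeff Q = lead_coeff P * a" unfolding c a by (simp only: lead_coeff_mult) simp
  then have "a = 1" using P(1) Q(1) by simp
  then show ?thesis using c a by (simp add: one_pCons [symmetric])
qed

lemma poly_mangoldt_power:
  fixes P :: "'a::{finite,field} poly"
  assumes "lead_coeff P = 1" "irreducible P" "k \<ge> 1"
  shows "poly_mangoldt (P ^ k) = degree P"
proof -
  have "(THE Q. lead_coeff Q = 1 \<and> irreducible Q \<and> (\<exists>m\<ge>1. P ^ k = Q ^ m)) = P"
    using assms monic_irreducible_power_unique [OF assms] by (intro the_equality) metis+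
  then show ?thesis using assms unfolding poly_mangoldt_def by auto
qed

text \<open>\<open>psi n [t\<^sub>1, \<dots>, t\<^sub>l]\<close>; lists are indexed from \<open>0\<close>, the coefficients from \<open>1\<close>.\<close>

definition psi :: "nat \<Rightarrow> 'a::{finite,field} list \<Rightarrow> nat" where
  "psi n ts =
     (\<Sum>f \<in> {f \<in> monic_polys n. \<forall>j\<in>{1..length ts}. next_to_leading_coeff f j = ts ! (j - 1)}.
        poly_mangoldt f)"

text \<open>The exponent \<open>n - l\<close> may be negative, hence the integer power.\<close>

definition normalized_error :: "'a::{finite,field} itself \<Rightarrow> nat \<Rightarrow> nat \<Rightarrow> real" where
  "normalized_error A l n =
     (real (psi n (replicate l (0 :: 'a))) - real CARD('a) powi (int n - int l))
       / real CARD('a) powr (real n / 2)"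

text \<open>Periodicity of functions on the positive integers; the value at \<open>0\<close> is irrelevant.\<close>

definition is_period :: "(nat \<Rightarrow> 'b) \<Rightarrow> nat \<Rightarrow> bool" where
  "is_period f N \<longleftrightarrow> N \<ge> 1 \<and> (\<forall>n\<ge>1. f (n + N) = f n)"

definition periodic :: "(nat \<Rightarrow> 'b) \<Rightarrow> bool" where
  "periodic f \<longleftrightarrow> (\<exists>N. is_period f N)"

definition least_period :: "(nat \<Rightarrow> 'b) \<Rightarrow> nat" where
  "least_period f = (LEAST N. is_period f N)"

end

theory Submission
  imports "HOL-Algebra.Algebraic_Closure_Type" "HOL-Number_Theory.Cong" Defs
begin

text \<open>By orthogonality of the characters \<open>\<chi>\<close> modulo \<open>T ^ (l + 1)\<close> of the polynomials with constant
  coefficient 1, the error term is an average of \<open>- \<Sum> g ^ n\<close> over the reciprocal roots \<open>g\<close> of the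
  L-functions of the nonprincipal \<open>\<chi>\<close>. All roots enter with the same sign, so nothing cancels, and the
  error term is periodic if and only if every \<open>g / \<surd>q\<close> is a root of unity of bounded order.

  The L-functions have degree at most \<open>l - 1\<close>. For \<open>l = 2\<close> and odd \<open>p\<close> the only root is a quadratic Gauss
  sum, up to a root of unity. In the remaining periodic cases it suffices to find the few possible
  values of the linear coefficient: for \<open>p = 2\<close> its square is an integral multiple of \<open>q\<close> times a root
  of unity, and for \<open>l = 3\<close> and \<open>p = 5\<close> it is a cubic exponential sum. Splitting the latter over squares
  and nonsquares turns it into sums over quadratic forms, because \<open>x ^ 6 = x \<cdot> x ^ 5\<close> is a quadratic
  form over the prime field.

  In all other cases the norm reduces the claim to the prime field. There a character is exhibited
  whose linear coefficient \<open>- \<Sum> g\<close> has small valuation at the prime \<open>\<zeta> - 1\<close> above \<open>p\<close>. If all \<open>g / \<surd>p\<close>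
  were roots of unity, then \<open>p\<close> would divide \<open>(\<Sum> g)\<^sup>2\<close>, which contradicts this.\<close>

subsection \<open>The von Mangoldt function\<close>

text \<open>Reversal makes the next-to-leading coefficients the low ones, so vanishing of the first
  l of them reads "congruent to 1 modulo T ^ (l + 1)". The bound on l comes from one inequality.
  Over the prime field the linear coefficient is a sum of powers \<zeta> ^ e a, and its valuation at
  \<zeta> - 1 is the least k for which p does not divide the sum of the binomial coefficients
  \<open>e a choose k\<close>. Supersingular roots force at least half the ramification index
  \<phi>, so a contradiction needs 2k < \<phi>. For e a = a ^ 3 + a, k is about p / 3 and \<phi> = p
  - 1: the inequality holds from p = 7 on, and p = 5 gives equality, in accordance with the periodic
  case l = 3. For smaller p other exponents serve: characters of order 8 (\<phi> = 4) and 9 (\<phi>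
  = 6) for p = 2 and p = 3, and e a = a ^ 4 for p = 5. A witness of level 3 or 4 is also a character
  of every higher level. In odd characteristic the period 4p combines G ^ 4 = q ^ 2 for a Gauss sum
  G with the order p of additive character values; at level 3 quadratic L-functions contribute third
  and sixth roots of unity, hence the factor 3.\<close>

lemma monic_polys_mult:
  "f \<in> monic_polys m \<Longrightarrow> g \<in> monic_polys n \<Longrightarrow> f * g \<in> monic_polys (m + n)"
  by (auto simp: monic_polys_def degree_mult_eq lead_coeff_mult simp flip: leading_coeff_0_iff)

lemma exists_monic_irreducible_factor:
  fixes f :: "'a::field poly"
  assumes "degree f > 0"
  shows "\<exists>P. lead_coeff P = 1 \<and> irreducible P \<and> P dvd f"
proof -
  obtain d where d: "d dvd f" "degree d > 0"
    and min: "\<And>e. e dvd f \<Longrightarrow> degree e > 0 \<Longrightarrow> degree d \<le> degree e"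
    using ex_has_least_nat[of "\<lambda>d. d dvd f \<and> degree d > 0" f degree] assms by auto
  have d0: "d \<noteq> 0" using d by auto
  have "irreducible d"
  proof (rule irreducibleI)
    show "d \<noteq> 0" by fact
    show "\<not> is_unit d" using d d0 by (auto simp: is_unit_iff_degree)
    fix a b assume ab: "d = a * b"
    then have nz: "a \<noteq> 0" "b \<noteq> 0" using d0 by auto
    have deg: "degree d = degree a + degree b" using ab nz by (simp add: degree_mult_eq)
    show "is_unit a \<or> is_unit b"
    proof (rule ccontr)
      assume "\<not> ?thesis"
      then have "degree a > 0" "degree b > 0" using nz by (auto simp: is_unit_iff_degree)
      moreover have "a dvd f" using d(1) ab by (auto dest: dvd_mult_left)
      ultimately show False using min[of a] deg by simp
    qed
  qed
  define P where "P = [:inverse (lead_coeff d):] * d"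
  have lc: "lead_coeff d \<noteq> 0" using d0 by simp
  have "lead_coeff P = 1" using lc by (simp add: P_def)
  moreover have "irreducible P"
    unfolding P_def using \<open>irreducible d\<close> lc
    by (subst irreducible_mult_unit_left) (auto simp: is_unit_const_poly_iff dvd_field_iff)
  moreover have "P dvd f"
    using d(1) lc by (auto simp: P_def smult_dvd_iff)
  ultimately show ?thesis by blast
qed

lemma monic_dvd_monic_irreducible:
  fixes P Q :: "'a::field poly"
  assumes "lead_coeff P = 1" "irreducible P" "lead_coeff Q = 1" "irreducible Q" "P dvd Q"
  shows "P = Q"
proof -
  obtain c where c: "Q = P * c" using assms by blast
  moreover have "\<not> is_unit P" using assms by (simp add: irreducible_not_unit)
  ultimately have "is_unit c" using assms by (auto dest: irreducibleD)
  then obtain a where a: "c = [:a:]" by (auto simp: is_unit_poly_iff)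
  have "lead_coeff Q = lead_coeff P * a" unfolding c a by (simp only: lead_coeff_mult) simp
  then have "a = 1" using assms by simp
  then show ?thesis using c a by (simp add: one_pCons [symmetric])
qed

definition prime_power_divisors :: "'a::field poly \<Rightarrow> ('a poly \<times> nat) set" where
  "prime_power_divisors f =
     {(P, k). lead_coeff P = 1 \<and> irreducible P \<and> k \<ge> 1 \<and> P ^ k dvd f}"

text \<open>Splitting off the exact power \<open>P ^ k\<close> of one irreducible factor removes the
  pairs (P, 1), ..., (P, k), which account for k deg P; the remaining pairs belong to the cofactor.
  Finiteness is carried along because sums over infinite sets are 0.\<close>

lemma sum_degree_prime_power_divisors:
  fixes f :: "'a::field poly"
  assumes "lead_coeff f = 1"
  shows "finite (prime_power_divisors f) \<and>
    (\<Sum>(P, k) \<in> prime_power_divisors f. degree P) = degree f"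
  using assms
proof (induction "degree f" arbitrary: f rule: less_induct)
  case less
  show ?case
  proof (cases "degree f = 0")
    case True
    then have "f = 1" using less.prems
      by (metis degree_eq_zeroE lead_coeff_pCons(2) one_pCons)
    then have "prime_power_divisors f = {}"
      by (auto simp: prime_power_divisors_def irreducible_not_unit is_unit_power_iff)
    then show ?thesis using True by simp
  next
    case False
    then obtain P where P: "lead_coeff P = 1" "irreducible P" "P dvd f"
      using exists_monic_irreducible_factor[of f] by auto
    have prP: "prime_elem P" using P by (intro field_poly_irreducible_imp_prime)
    have f0: "f \<noteq> 0" using less.prems by auto
    have degP: "degree P > 0"
      using P(2) by (metis bot_nat_0.not_eq_extremum irreducible_def is_unit_iff_degree)
    have nuP: "\<not> is_unit P" using P(2) by (simp add: irreducible_not_unit)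
    have fin: "degree P * n \<le> degree f" if "P ^ n dvd f" for n
      using dvd_imp_degree_le[OF that f0] by (simp add: degree_power_eq P(1) mult.commute
          flip: leading_coeff_0_iff)
    have bd: "\<forall>n. P ^ n dvd f \<longrightarrow> n \<le> degree f"
    proof (intro allI impI)
      fix n assume "P ^ n dvd f"
      have "n \<le> degree P * n" using degP by simp
      also have "\<dots> \<le> degree f" by (rule fin) fact
      finally show "n \<le> degree f" .
    qed
    define k where "k = (GREATEST n. P ^ n dvd f)"
    have "P ^ k dvd f" unfolding k_def by (rule GreatestI_nat[of _ 0 "degree f"]) (use bd in auto)
    then obtain h where h: "f = P ^ k * h" by blast
    have "\<not> P ^ Suc k dvd f"
      using Greatest_le_nat[of "\<lambda>n. P ^ n dvd f" "Suc k" "degree f"] bd unfolding k_def by force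
    then have kh: "f = P ^ k * h" "\<not> P dvd h" using h by (auto simp: mult.commute mult_dvd_mono)
    have k1: "k \<ge> 1" using kh P(3) by (cases k) auto
    have h0: "h \<noteq> 0" using kh f0 by auto
    have P0: "P \<noteq> 0" using P by auto
    have hm: "lead_coeff h = 1"
      using less.prems kh(1) P(1) by (simp add: lead_coeff_mult lead_coeff_power)
    have degf: "degree f = k * degree P + degree h"
      using kh(1) h0 P0 by (simp add: degree_mult_eq degree_power_eq)
    then have "degree h < degree f" using k1 degP by auto
    from less.hyps[OF this hm] have IH: "finite (prime_power_divisors h)"
      "(\<Sum>(P, k) \<in> prime_power_divisors h. degree P) = degree h" by auto
    have eq: "prime_power_divisors f = {P} \<times> {1..k} \<union> prime_power_divisors h"
    proof (intro Set.set_eqI iffI)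
      fix x assume "x \<in> prime_power_divisors f"
      then obtain Q j where x: "x = (Q, j)" "lead_coeff Q = 1" "irreducible Q" "j \<ge> 1"
        "Q ^ j dvd P ^ k * h" by (auto simp: prime_power_divisors_def kh)
      have prQ: "prime_elem Q" using x by (intro field_poly_irreducible_imp_prime)
      obtain a b where ab: "a + b = j" "Q ^ a dvd P ^ k" "Q ^ b dvd h"
        using prime_elem_power_dvd_prod[OF x(5) prQ] by auto
      show "x \<in> {P} \<times> {1..k} \<union> prime_power_divisors h"
      proof (cases "Q = P")
        case True
        then have "b = 0" using ab(3) kh(2) by (metis dvd_power dvd_trans neq0_conv)
        then have "j \<le> k" using ab True P0 nuP by (simp add: dvd_power_iff)
        then show ?thesis using x True by auto
      next
        case False
        have "a = 0"
        proof (rule ccontr)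
          assume "a \<noteq> 0"
          then have "Q dvd P ^ k" using ab(2) by (meson dvd_power dvd_trans neq0_conv)
          then have "Q dvd P" using prQ by (rule prime_elem_dvd_power[rotated])
          then show False using monic_dvd_monic_irreducible x P False by metis
        qed
        then show ?thesis using x ab by (auto simp: prime_power_divisors_def)
      qed
    next
      fix x assume "x \<in> {P} \<times> {1..k} \<union> prime_power_divisors h"
      then show "x \<in> prime_power_divisors f" using P
        by (auto simp: prime_power_divisors_def kh intro: dvd_mult2[OF le_imp_power_dvd])
    qed
    have disj: "({P} \<times> {1..k}) \<inter> prime_power_divisors h = {}"
      using kh(2) dvd_trans[OF dvd_power] by (fastforce simp: prime_power_divisors_def)
    show ?thesis unfolding eq
    proof
      show "finite ({P} \<times> {1..k} \<union> prime_power_divisors h)" using IH by simp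
      have "(\<Sum>(P, k) \<in> {P} \<times> {1..k}. degree P) = k * degree P"
        by (simp flip: sum.cartesian_product)
      then show "(\<Sum>(P, k)\<in>{P} \<times> {1..k} \<union> prime_power_divisors h. degree P) = degree f"
        using IH disj degf by (simp add: sum.union_disjoint)
    qed
  qed
qed

lemma finite_monic_divisors:
  fixes f :: "'a::{finite,field} poly"
  assumes "f \<noteq> 0"
  shows "finite {d. lead_coeff d = 1 \<and> d dvd f}"
proof (rule finite_subset)
  show "{d. lead_coeff d = 1 \<and> d dvd f} \<subseteq> (\<Union>n\<le>degree f. monic_polys n)"
    using assms by (auto simp: monic_polys_def dvd_imp_degree_le)
qed (auto simp: finite_monic_polys)

lemma poly_mangoldt_eq_0:
  assumes "\<not> (\<exists>P k. lead_coeff P = 1 \<and> irreducible P \<and> k \<ge> 1 \<and> f = P ^ k)"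
  shows "poly_mangoldt f = 0"
  using assms unfolding poly_mangoldt_def by auto

text \<open>The analogue of "\<Lambda> convolved with 1 is log", with the degree as logarithm: only
  prime power divisors contribute, and each of them comes from exactly one pair (P, k).\<close>

lemma sum_poly_mangoldt_divisors:
  fixes f :: "'a::{finite,field} poly"
  assumes "lead_coeff f = 1"
  shows "(\<Sum>d | lead_coeff d = 1 \<and> d dvd f. poly_mangoldt d) = degree f"
proof -
  let ?g = "\<lambda>(P::'a poly, k::nat). P ^ k"
  have f0: "f \<noteq> 0" using assms by auto
  have inj: "inj_on ?g (prime_power_divisors f)"
  proof (rule inj_onI, clarify)
    fix P Q :: "'a poly" and j k
    assume *: "(P, j) \<in> prime_power_divisors f" "(Q, k) \<in> prime_power_divisors f" "P ^ j = Q ^ k"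
    then have "P = Q"
      using monic_irreducible_power_unique[of P j Q k] by (auto simp: prime_power_divisors_def)
    moreover have "P \<noteq> 0" "\<not> is_unit P"
      using * by (auto simp: prime_power_divisors_def irreducible_not_unit)
    ultimately have "j = k" using *(3) by (metis dvd_power_iff order_antisym order_refl)
    with \<open>P = Q\<close> show "P = Q \<and> j = k" by simp
  qed
  have "(\<Sum>d | lead_coeff d = 1 \<and> d dvd f. poly_mangoldt d) =
        (\<Sum>d \<in> ?g ` prime_power_divisors f. poly_mangoldt d)"
  proof (rule sum.mono_neutral_right)
    show "finite {d. lead_coeff d = 1 \<and> d dvd f}" using finite_monic_divisors[OF f0] .
    show "?g ` prime_power_divisors f \<subseteq> {d. lead_coeff d = 1 \<and> d dvd f}"
      by (auto simp: prime_power_divisors_def lead_coeff_power)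
    show "\<forall>i\<in>{d. lead_coeff d = 1 \<and> d dvd f} - ?g ` prime_power_divisors f. poly_mangoldt i = 0"
      by (auto simp: prime_power_divisors_def image_iff intro!: poly_mangoldt_eq_0)
  qed
  also have "\<dots> = (\<Sum>(P, k) \<in> prime_power_divisors f. poly_mangoldt (P ^ k))"
    by (subst sum.reindex[OF inj]) (auto simp: case_prod_unfold)
  also have "\<dots> = (\<Sum>(P, k) \<in> prime_power_divisors f. degree P)"
    by (rule sum.cong) (auto simp: prime_power_divisors_def poly_mangoldt_power)
  also have "\<dots> = degree f" using sum_degree_prime_power_divisors[OF assms] by simp
  finally show ?thesis .
qed

section \<open>Completely multiplicative functions on monic polynomials\<close>

definition monic_multiplicative :: "('a::{finite,field} poly \<Rightarrow> complex) \<Rightarrow> bool" where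
  "monic_multiplicative h \<longleftrightarrow>
     (\<forall>f g. lead_coeff f = 1 \<longrightarrow> lead_coeff g = 1 \<longrightarrow> h (f * g) = h f * h g)"

definition monic_sum :: "('a::{finite,field} poly \<Rightarrow> complex) \<Rightarrow> nat \<Rightarrow> complex" where
  "monic_sum h n = (\<Sum>f\<in>monic_polys n. h f)"

definition mangoldt_sum :: "('a::{finite,field} poly \<Rightarrow> complex) \<Rightarrow> nat \<Rightarrow> complex" where
  "mangoldt_sum h n = (\<Sum>f\<in>monic_polys n. of_nat (poly_mangoldt f) * h f)"

lemma poly_mangoldt_0: "f \<in> monic_polys 0 \<Longrightarrow> poly_mangoldt f = 0"
  by (auto simp: monic_polys_def intro!: poly_mangoldt_eq_0)
     (metis irreducible_def is_unit_iff_degree is_unit_power_iff less_eq_Suc_le One_nat_def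
       nat_less_le power_0 degree_power_eq mult_is_0 not_one_le_zero)

text \<open>The identity \<open>n a\<^sub>n = \<Sum> s\<^sub>k a\<^sub>n\<^sub>-\<^sub>k\<close> is the coefficientwise form of
  \<open>u L'(u) = L(u) \<cdot> \<Sum> s\<^sub>k u\<^sup>k\<close>.\<close>

lemma monic_sum_recurrence:
  fixes h :: "'a::{finite,field} poly \<Rightarrow> complex"
  assumes "monic_multiplicative h"
  shows "of_nat n * monic_sum h n = (\<Sum>k=1..n. mangoldt_sum h k * monic_sum h (n - k))"
proof -
  let ?M = "monic_polys :: nat \<Rightarrow> 'a poly set"
  let ?D = "\<lambda>f. {d::'a poly. lead_coeff d = 1 \<and> d dvd f}"
  have "of_nat n * monic_sum h n = (\<Sum>f\<in>?M n. of_nat (degree f) * h f)"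
    by (simp add: monic_sum_def sum_distrib_left) (rule sum.cong, auto simp: monic_polys_def)
  also have "\<dots> = (\<Sum>f\<in>?M n. \<Sum>d\<in>?D f. of_nat (poly_mangoldt d) * h f)"
    by (intro sum.cong refl, subst sum_poly_mangoldt_divisors [symmetric])
       (auto simp: monic_polys_def sum_distrib_right)
  also have "\<dots> = (\<Sum>(f, d)\<in>Sigma (?M n) ?D. of_nat (poly_mangoldt d) * h f)"
    by (subst sum.Sigma)
       (auto simp: finite_monic_polys intro!: finite_monic_divisors, auto simp: monic_polys_def)
  also have "\<dots> = (\<Sum>(k, d, e)\<in>Sigma {..n} (\<lambda>k. ?M k \<times> ?M (n - k)).
      of_nat (poly_mangoldt d) * h (d * e))"
  proof (rule sum.reindex_bij_witness[where i = "\<lambda>(k, d, e). (d * e, d)"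
        and j = "\<lambda>(f, d). (degree d, d, f div d)"], goal_cases)
    case (2 x)
    then obtain f d where x: "x = (f, d)" "f \<in> ?M n" "lead_coeff d = 1" "d dvd f" by auto
    then obtain e where e: "f = d * e" by auto
    have nz: "d \<noteq> 0" "e \<noteq> 0" using x e by (auto simp: monic_polys_def)
    have "lead_coeff e = 1" using x e by (auto simp: monic_polys_def lead_coeff_mult)
    moreover have "degree f = degree d + degree e" using e nz by (simp add: degree_mult_eq)
    ultimately show ?case using x e nz by (auto simp: monic_polys_def)
  next
    case (4 y)
    then obtain k d e where y: "y = (k, d, e)" "k \<le> n" "d \<in> ?M k" "e \<in> ?M (n - k)" by auto
    then show ?case using monic_polys_mult[of d k e "n - k"] by (auto simp: monic_polys_def)
  qed (auto simp: monic_polys_def)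
  also have "\<dots> = (\<Sum>k\<le>n. \<Sum>(d, e)\<in>?M k \<times> ?M (n - k). of_nat (poly_mangoldt d) * h (d * e))"
    by (subst sum.Sigma) (auto simp: finite_monic_polys)
  also have "\<dots> = (\<Sum>k\<le>n. mangoldt_sum h k * monic_sum h (n - k))"
  proof (rule sum.cong[OF refl])
    fix k
    have "(\<Sum>(d, e)\<in>?M k \<times> ?M (n - k). of_nat (poly_mangoldt d) * h (d * e)) =
          (\<Sum>(d, e)\<in>?M k \<times> ?M (n - k). (of_nat (poly_mangoldt d) * h d) * h e)"
      using assms by (intro sum.cong) (auto simp: monic_multiplicative_def monic_polys_def)
    then show "(\<Sum>(d, e)\<in>?M k \<times> ?M (n - k). of_nat (poly_mangoldt d) * h (d * e)) =
          mangoldt_sum h k * monic_sum h (n - k)"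
      by (simp add: mangoldt_sum_def monic_sum_def sum_product sum.cartesian_product)
  qed
  also have "\<dots> = (\<Sum>k=1..n. mangoldt_sum h k * monic_sum h (n - k))"
    by (rule sum.mono_neutral_right) (auto simp: mangoldt_sum_def poly_mangoldt_0 not_le)
  finally show ?thesis .
qed

subsection \<open>Power sums\<close>

text \<open>The coefficients of a linear combination of exponentials vanish if the combination does:
  apply it to the polynomial \<open>X \<Prod> (X - c)\<close>, the product over the other bases \<open>c\<close>.\<close>

lemma exponentials_independent:
  fixes c :: "'a::idom \<Rightarrow> 'a"
  assumes "finite S" "0 \<notin> S" "\<And>n. n \<ge> 1 \<Longrightarrow> (\<Sum>g\<in>S. c g * g ^ n) = 0" "x \<in> S"
  shows "c x = 0"
proof -
  have *: "(\<Sum>g\<in>S. c g * (g * poly p g)) = 0" for p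
  proof -
    have "(\<Sum>g\<in>S. c g * (g * poly p g)) =
        (\<Sum>g\<in>S. \<Sum>i\<le>degree p. coeff p i * (c g * g ^ Suc i))"
      by (simp add: poly_altdef sum_distrib_left mult_ac)
    also have "\<dots> = (\<Sum>i\<le>degree p. coeff p i * (\<Sum>g\<in>S. c g * g ^ Suc i))"
      by (subst sum.swap) (simp add: sum_distrib_left)
    also have "\<dots> = 0" using assms(3) by (simp del: power_Suc)
    finally show ?thesis .
  qed
  define p where "p = (\<Prod>y\<in>S - {x}. [:-y, 1:])"
  have "0 = (\<Sum>g\<in>S. c g * (g * poly p g))" by (rule *[symmetric])
  also have "\<dots> = (\<Sum>g\<in>{x}. c g * (g * poly p g))"
    by (rule sum.mono_neutral_right) (use assms in \<open>auto simp: p_def poly_prod\<close>)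
  finally have "c x * (x * poly p x) = 0" by simp
  moreover have "poly p x \<noteq> 0" using assms(1) by (auto simp: p_def poly_prod)
  ultimately show ?thesis using assms(2,4) by auto
qed

lemma sum_image_mset_conv_sum:
  fixes f :: "'a \<Rightarrow> 'b::semiring_1"
  shows "(\<Sum>x\<in>#A. f x) = (\<Sum>x\<in>set_mset A. of_nat (count A x) * f x)"
proof (induction A)
  case (add y A)
  have "(\<Sum>x\<in>set_mset (add_mset y A). of_nat (count (add_mset y A) x) * f x) =
     (\<Sum>x\<in>insert y (set_mset A). of_nat (count A x) * f x + (if x = y then f x else 0))"
    by (intro sum.cong) (auto simp: algebra_simps)
  also have "\<dots> = (\<Sum>x\<in>insert y (set_mset A). of_nat (count A x) * f x) + f y"
    by (simp add: sum.distrib)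
  also have "(\<Sum>x\<in>insert y (set_mset A). of_nat (count A x) * f x) =
     (\<Sum>x\<in>set_mset A. of_nat (count A x) * f x)"
    by (rule sum.mono_neutral_right) (auto simp: not_in_iff)
  finally show ?case using add by (simp add: add.commute)
qed simp

text \<open>The difference of both sides is a combination of exponentials in which g has the
  coefficient g ^ M - C times its multiplicity. Multiplicities are positive, hence nonzero in
  characteristic 0.\<close>

lemma power_sum_periodic_imp:
  fixes A :: "'a::{idom,ring_char_0} multiset"
  assumes "0 \<notin># A" "\<And>n. n \<ge> 1 \<Longrightarrow> (\<Sum>g\<in>#A. g ^ (n + M)) = C * (\<Sum>g\<in>#A. g ^ n)" "x \<in># A"
  shows "x ^ M = C"
proof -
  have "of_nat (count A x) * (x ^ M - C) = 0"
  proof (rule exponentials_independent[where S = "set_mset A"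
        and c = "\<lambda>g. of_nat (count A g) * (g ^ M - C)"])
    fix n :: nat assume n: "n \<ge> 1"
    have "(\<Sum>g\<in>set_mset A. of_nat (count A g) * (g ^ M - C) * g ^ n) =
          (\<Sum>g\<in>#A. g ^ (n + M)) - C * (\<Sum>g\<in>#A. g ^ n)"
      by (simp add: sum_image_mset_conv_sum sum_distrib_left algebra_simps power_add
          flip: sum_subtractf)
    then show "(\<Sum>g\<in>set_mset A. of_nat (count A g) * (g ^ M - C) * g ^ n) = 0"
      using assms(2)[OF n] by simp
  qed (use assms(1,3) in auto)
  moreover have "count A x > 0" using assms(3) by simp
  ultimately show ?thesis by simp
qed

text \<open>The logarithmic derivative of the product of all 1 - g u: each factor contributes minus
  the sum of g ^ k u ^ k. The induction adds one factor by the product rule.\<close>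

lemma newton_identity_reciprocal:
  fixes A :: "'a::comm_ring_1 multiset"
  defines "L \<equiv> (\<Prod>g\<in>#A. [:1, -g:])"
  shows "of_nat n * coeff L n = (\<Sum>k=1..n. - (\<Sum>g\<in>#A. g ^ k) * coeff L (n - k))"
  unfolding L_def
proof (induction A arbitrary: n)
  case empty
  show ?case by (cases n) auto
next
  case (add x A)
  define Q where "Q = (\<Prod>g\<in>#A. [:1, -g:])"
  define s where "s = (\<lambda>k. - (\<Sum>g\<in>#A. g ^ k))"
  have IH: "of_nat n * coeff Q n = (\<Sum>k=1..n. s k * coeff Q (n - k))" for n
    using add[of n] by (simp add: Q_def s_def)
  have c: "coeff ([:1, -x:] * Q) n = coeff Q n - (if n = 0 then 0 else x * coeff Q (n - 1))" for n
    by (cases n) auto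
  \<comment> \<open>As 1 - x u times the sum of x ^ k u ^ k over k \<ge> 1 is x u, the left side is
    the coefficient of u ^ n in x u Q.\<close>
  have tele: "(\<Sum>k=1..n. x ^ k * coeff ([:1, -x:] * Q) (n - k)) = (if n = 0 then 0 else x * coeff Q (n - 1))" for n
  proof (induction n)
    case (Suc n)
    have "(\<Sum>k=1..Suc n. x ^ k * coeff ([:1, -x:] * Q) (Suc n - k)) =
        x * (coeff ([:1, -x:] * Q) n + (\<Sum>k=1..n. x ^ k * coeff ([:1, -x:] * Q) (n - k)))"
      by (subst sum.atLeast_Suc_atMost, simp, subst sum.shift_bounds_cl_Suc_ivl)
         (simp add: sum_distrib_left algebra_simps)
    also have "\<dots> = x * coeff Q n" unfolding Suc.IH unfolding c by simp
    finally show ?case by (simp only: nat.distinct if_False diff_Suc_1)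
  qed simp
  \<comment> \<open>By the induction hypothesis this is the coefficient of u ^ n in (1 - x u) u
    Q'.\<close>
  have s1: "(\<Sum>k=1..n. s k * coeff ([:1, -x:] * Q) (n - k)) =
     of_nat n * coeff Q n - (if n = 0 then 0 else x * (of_nat (n - 1) * coeff Q (n - 1)))"
  proof -
    have "(\<Sum>k=1..n. s k * coeff ([:1, -x:] * Q) (n - k)) =
       (\<Sum>k=1..n. s k * coeff Q (n - k)) -
       (\<Sum>k=1..n. if n - k = 0 then 0 else x * (s k * coeff Q (n - 1 - k)))"
      unfolding sum_subtractf[symmetric]
      by (rule sum.cong) (auto simp only: c, auto simp: algebra_simps)
    also have "(\<Sum>k=1..n. if n - k = 0 then 0 else x * (s k * coeff Q (n - 1 - k))) =
       (\<Sum>k=1..n-1. x * (s k * coeff Q (n - 1 - k)))"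
      by (rule sum.mono_neutral_cong_right) auto
    also have "\<dots> = x * (of_nat (n - 1) * coeff Q (n - 1))"
      by (subst IH) (simp add: sum_distrib_left)
    finally show ?thesis unfolding IH[symmetric] by auto
  qed
  have "(\<Sum>k=1..n. - (\<Sum>g\<in>#add_mset x A. g ^ k) * coeff (\<Prod>g\<in>#add_mset x A. [:1, -g:]) (n - k))
     = (\<Sum>k=1..n. s k * coeff ([:1, -x:] * Q) (n - k))
       - (\<Sum>k=1..n. x ^ k * coeff ([:1, -x:] * Q) (n - k))"
    unfolding sum_subtractf[symmetric]
    by (rule sum.cong) (auto simp: Q_def s_def algebra_simps)
  also have "\<dots> = of_nat n * coeff ([:1, -x:] * Q) n"
    unfolding s1 tele by (cases n) (auto simp: algebra_simps)
  finally show ?case by (simp add: Q_def)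
qed

lemma newton_recurrence_unique:
  fixes a s t :: "nat \<Rightarrow> 'a::comm_ring_1"
  assumes "a 0 = 1"
    and "\<And>n. of_nat n * a n = (\<Sum>k=1..n. s k * a (n - k))"
    and "\<And>n. of_nat n * a n = (\<Sum>k=1..n. t k * a (n - k))"
    and "n \<ge> 1"
  shows "s n = t n"
  using assms(4)
proof (induction n rule: less_induct)
  case (less n)
  then obtain m where n: "n = Suc m" by (cases n) auto
  have "(\<Sum>k=1..m. s k * a (n - k)) + s n = (\<Sum>k=1..m. t k * a (n - k)) + t n"
    using assms(2)[of n] assms(3)[of n] assms(1) by (simp add: n)
  moreover have "(\<Sum>k=1..m. s k * a (n - k)) = (\<Sum>k=1..m. t k * a (n - k))"
    using less.IH by (intro sum.cong) (auto simp: n)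
  ultimately show ?case by simp
qed

lemma reciprocal_root_factorization:
  fixes L :: "'a::alg_closed_field poly"
  assumes "coeff L 0 = 1"
  shows "\<exists>A. 0 \<notin># A \<and> L = (\<Prod>g\<in>#A. [:1, -g:])"
proof -
  have L0: "L \<noteq> 0" using assms by auto
  obtain A c0 where A: "L = smult c0 (\<Prod>x\<in>#A. [:-x, 1:])"
    using alg_closed_imp_factorization[OF L0] by blast
  have nz: "0 \<notin># A"
  proof
    assume "0 \<in># A"
    then have "poly L 0 = 0"
      by (subst A) (auto simp: poly_prod_mset prod_mset_zero_iff image_iff intro!: bexI[of _ 0])
    then show False using assms by (simp add: poly_0_coeff_0)
  qed
  have "(\<Prod>x\<in>#A. [:-x, 1:]) = smult (\<Prod>x\<in>#A. -x) (\<Prod>g\<in>#image_mset inverse A. [:1, -g:])"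
    using nz
  proof (induction A)
    case (add x A)
    then have x: "x \<noteq> 0" by auto
    define R S where "R = (\<Prod>g\<in>#image_mset inverse A. [:1, -g:])" and "S = (\<Prod>x\<in>#A. -x)"
    have "[:-x, 1:] * smult S R = smult (-x * S) ([:1, - inverse x:] * R)"
      using x by (simp add: algebra_simps smult_add_right smult_diff_right)
    then show ?case using add by (simp add: R_def S_def del: mult_pCons_left mult_pCons_right)
  qed simp
  then have "L = smult (c0 * (\<Prod>x\<in>#A. -x)) (\<Prod>g\<in>#image_mset inverse A. [:1, -g:])"
    by (simp only: A smult_smult)
  then obtain c where c: "L = smult c (\<Prod>g\<in>#image_mset inverse A. [:1, -g:])" ..
  have "coeff (\<Prod>g\<in>#B. [:1, -g:]) 0 = (1::'a)" for B
    by (simp add: poly_prod_mset flip: poly_0_coeff_0)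
  from this[of "image_mset inverse A"] have "c = 1"
    using assms unfolding c coeff_smult by simp
  then show ?thesis using c nz by (intro exI[of _ "image_mset inverse A"]) auto
qed

text \<open>The reciprocal roots of the polynomial L with coefficients \<open>a\<close> satisfy the
  same recurrence, which determines \<open>s\<close>. As \<open>d\<close> only bounds the degree of
  L, the last equation, L reversed, may have the spurious root 0.\<close>

lemma power_sum_of_recurrence:
  fixes a s :: "nat \<Rightarrow> complex"
  assumes a0: "a 0 = 1" and vanish: "\<And>n. n > d \<Longrightarrow> a n = 0"
    and rec: "\<And>n. of_nat n * a n = (\<Sum>k=1..n. s k * a (n - k))"
  obtains A where "0 \<notin># A" "\<And>n. n \<ge> 1 \<Longrightarrow> s n = - (\<Sum>g\<in>#A. g ^ n)"
    "\<And>g. g \<in># A \<Longrightarrow> (\<Sum>j\<le>d. a j * g ^ (d - j)) = 0"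
proof -
  define L where "L = (\<Sum>j\<le>d. monom (a j) j)"
  have cL: "coeff L n = a n" for n
    using vanish[of n] by (auto simp: L_def coeff_sum not_le)
  obtain A where A: "0 \<notin># A" "L = (\<Prod>g\<in>#A. [:1, -g:])"
    using reciprocal_root_factorization[of L] cL a0 by auto
  show ?thesis
  proof
    show "0 \<notin># A" by fact
    show "s n = - (\<Sum>g\<in>#A. g ^ n)" if "n \<ge> 1" for n
    proof (rule newton_recurrence_unique[of a, OF a0 rec _ that])
      fix n
      show "of_nat n * a n = (\<Sum>k=1..n. - (\<Sum>g\<in>#A. g ^ k) * a (n - k))"
        using newton_identity_reciprocal[of n A] by (simp add: cL flip: A(2))
    qed
    fix g assume g: "g \<in># A"
    then have g0: "g \<noteq> 0" using A by auto
    obtain B where B: "A = add_mset g B" using g by (metis insert_DiffM)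
    have "poly L (inverse g) = 0"
      unfolding A(2) B using g0 by (simp del: mult_pCons_left mult_pCons_right)
    then have "0 = g ^ d * (\<Sum>j\<le>d. a j * inverse g ^ j)"
      by (simp add: L_def poly_sum poly_monom)
    also have "\<dots> = (\<Sum>j\<le>d. a j * g ^ (d - j))"
      unfolding sum_distrib_left
      by (rule sum.cong) (use g0 in \<open>auto simp: power_diff field_simps power_inverse\<close>)
    finally show "(\<Sum>j\<le>d. a j * g ^ (d - j)) = 0" ..
  qed
qed

subsection \<open>Characters modulo a power of \<open>T\<close>\<close>

definition tcong :: "nat \<Rightarrow> 'a::comm_ring_1 poly \<Rightarrow> 'a poly \<Rightarrow> bool" where
  "tcong l f g \<longleftrightarrow> monom 1 (Suc l) dvd f - g"

lemma tcong_iff: "tcong l f g \<longleftrightarrow> (\<forall>j\<le>l. coeff f j = coeff g j)"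
  by (simp add: tcong_def monom_1_dvd_iff' less_Suc_eq_le)

lemma tcong_refl [simp]: "tcong l f f" by (simp add: tcong_iff)
lemma tcong_sym: "tcong l f g \<Longrightarrow> tcong l g f" by (simp add: tcong_iff)
lemma tcong_trans: "tcong l f g \<Longrightarrow> tcong l g h \<Longrightarrow> tcong l f h" by (simp add: tcong_iff)

lemma tcong_mult: "tcong l f f' \<Longrightarrow> tcong l g g' \<Longrightarrow> tcong l (f * g) (f' * g')"
proof -
  have "f * g - f' * g' = f * (g - g') + (f - f') * g'" by (simp add: algebra_simps)
  then show "tcong l f f' \<Longrightarrow> tcong l g g' \<Longrightarrow> tcong l (f * g) (f' * g')"
    unfolding tcong_def by (simp add: dvd_add dvd_mult dvd_mult2)
qed

lemma tcong_prod: "(\<And>x. x \<in> S \<Longrightarrow> tcong l (f x) (g x)) \<Longrightarrow> tcong l (prod f S) (prod g S)"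
  by (induction S rule: infinite_finite_induct) (auto intro: tcong_mult)

lemma tcong_cutoff [simp]: "tcong l (poly_cutoff (Suc l) f) f"
  by (simp add: tcong_iff coeff_poly_cutoff)

lemma tcong_mult_cancel:
  fixes f g h :: "'a::idom poly"
  assumes "coeff h 0 \<noteq> 0" "tcong l (h * f) (h * g)"
  shows "tcong l f g"
proof -
  have "coeff (f - g) j = 0" if "j \<le> l" for j
    using that
  proof (induction j rule: less_induct)
    case (less j)
    have "0 = coeff (h * (f - g)) j"
      using assms(2) less.prems by (simp add: tcong_iff algebra_simps)
    also have "\<dots> = (\<Sum>i\<le>j. coeff h i * coeff (f - g) (j - i))" by (simp add: coeff_mult)
    also have "\<dots> = (\<Sum>i\<in>{0}. coeff h i * coeff (f - g) (j - i))"
      by (rule sum.mono_neutral_right) (use less in auto)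
    finally show ?case using assms(1) by simp
  qed
  then show ?thesis by (simp add: tcong_iff)
qed

lemma coeff_0_prod: "coeff (prod f S) 0 = (\<Prod>x\<in>S. (coeff (f x) 0 :: 'a::comm_semiring_1))"
  by (induction S rule: infinite_finite_induct) (auto simp: coeff_mult_0)

text \<open>Representatives of the group of units with constant coefficient 1 modulo T ^ (l + 1).
  The same set is the image of the monic polynomials of degree l under reversal, so it also indexes
  the terms of the L-functions.\<close>

definition unit_residues :: "nat \<Rightarrow> 'a::{finite,field} poly set" where
  "unit_residues l = {f. coeff f 0 = 1 \<and> degree f \<le> l}"

text \<open>Phrased by vanishing coefficients rather than by degree, so that \<open>n = 0\<close>
  leaves only the zero polynomial.\<close>

lemma card_polys_below:
  "finite {f :: 'a::{finite,zero} poly. \<forall>i\<ge>n. coeff f i = 0} \<and>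
   card {f :: 'a poly. \<forall>i\<ge>n. coeff f i = 0} = CARD('a) ^ n"
proof (induction n)
  case 0
  have "{f :: 'a poly. \<forall>i\<ge>0. coeff f i = 0} = {0}" by (auto simp: poly_eq_iff)
  then show ?case by simp
next
  case (Suc n)
  let ?D = "\<lambda>n. {f :: 'a poly. \<forall>i\<ge>n. coeff f i = 0}"
  have "?D (Suc n) = (\<lambda>(a, f). pCons a f) ` (UNIV \<times> ?D n)"
  proof (intro Set.set_eqI iffI)
    fix f :: "'a poly" assume f: "f \<in> ?D (Suc n)"
    obtain a g where "f = pCons a g" by (cases f) auto
    moreover from this have "coeff g i = 0" if "i \<ge> n" for i
      using f that by (auto dest!: spec[of _ "Suc i"])
    ultimately show "f \<in> (\<lambda>(a, f). pCons a f) ` (UNIV \<times> ?D n)" by auto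
  qed (auto simp: coeff_pCons split: nat.splits)
  moreover have "inj_on (\<lambda>(a, f). pCons a f) (UNIV \<times> ?D n)" by (auto intro!: inj_onI)
  ultimately show ?case using Suc by (auto simp: card_image card_cartesian_product)
qed

lemma unit_residues_eq: "unit_residues l = pCons 1 ` {f. \<forall>i\<ge>l. coeff f i = 0}"
proof (intro Set.set_eqI iffI)
  fix f :: "'a poly" assume f: "f \<in> unit_residues l"
  obtain a g where g: "f = pCons a g" by (cases f) auto
  have "coeff g i = 0" if "i \<ge> l" for i
    using f that coeff_eq_0[of f "Suc i"] by (simp add: unit_residues_def g)
  then show "f \<in> pCons 1 ` {f. \<forall>i\<ge>l. coeff f i = 0}" using f g by (auto simp: unit_residues_def)
next
  fix f :: "'a poly" assume "f \<in> pCons 1 ` {f. \<forall>i\<ge>l. coeff f i = 0}"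
  then show "f \<in> unit_residues l"
    by (auto simp: unit_residues_def intro!: degree_le simp: coeff_pCons split: nat.splits)
qed

lemma finite_unit_residues [simp]: "finite (unit_residues l :: 'a::{finite,field} poly set)"
  and card_unit_residues: "card (unit_residues l :: 'a::{finite,field} poly set) = CARD('a) ^ l"
  using card_polys_below[of l, where 'a = 'a]
  by (auto simp: unit_residues_eq card_image inj_on_def)

lemma one_in_unit_residues [simp]: "1 \<in> unit_residues l"
  by (simp add: unit_residues_def)

lemma tcong_unit_residues_eq:
  "f \<in> unit_residues l \<Longrightarrow> g \<in> unit_residues l \<Longrightarrow> tcong l f g \<Longrightarrow> f = g"
  by (auto simp: tcong_iff unit_residues_def poly_eq_iff) (metis coeff_eq_0 le_less_trans not_le)

lemma cutoff_in_unit_residues: "coeff f 0 = 1 \<Longrightarrow> poly_cutoff (Suc l) f \<in> unit_residues l"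
  by (auto simp: unit_residues_def coeff_poly_cutoff intro!: degree_le)

lemma bij_betw_unit_residues_mult:
  assumes "coeff h 0 = 1"
  shows "bij_betw (\<lambda>f. poly_cutoff (Suc l) (h * f)) (unit_residues l) (unit_residues l)"
proof -
  have "inj_on (\<lambda>f. poly_cutoff (Suc l) (h * f)) (unit_residues l)"
  proof (rule inj_onI)
    fix f g assume *: "f \<in> unit_residues l" "g \<in> unit_residues l"
      "poly_cutoff (Suc l) (h * f) = poly_cutoff (Suc l) (h * g)"
    then have "tcong l (h * f) (h * g)" by (metis tcong_cutoff tcong_sym tcong_trans)
    then have "tcong l f g" using assms tcong_mult_cancel[of h l f g] by simp
    then show "f = g" using * by (intro tcong_unit_residues_eq)
  qed
  moreover have "(\<lambda>f. poly_cutoff (Suc l) (h * f)) ` unit_residues l \<subseteq> unit_residues l"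
    using assms by (auto intro!: cutoff_in_unit_residues simp: coeff_mult_0)
       (simp_all add: unit_residues_def)
  ultimately show ?thesis
    by (simp add: bij_betw_def endo_inj_surj)
qed

text \<open>Lagrange's theorem by Euler's argument: multiplication by \<open>h\<close> permutes the
  group, so the product of all its elements absorbs the power of \<open>h\<close>.\<close>

lemma unit_power_card_tcong_1:
  fixes h :: "'a::{finite,field} poly"
  assumes "coeff h 0 = 1"
  shows "tcong l (h ^ (CARD('a) ^ l)) 1"
proof -
  let ?P = "\<Prod>f\<in>unit_residues l. f :: 'a poly"
  have "?P = (\<Prod>f\<in>unit_residues l. poly_cutoff (Suc l) (h * f))"
    by (rule prod.reindex_bij_betw[OF bij_betw_unit_residues_mult[OF assms], symmetric])
  moreover have "tcong l \<dots> (\<Prod>f\<in>unit_residues l. h * f)" by (intro tcong_prod tcong_cutoff)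
  ultimately have "tcong l ?P (\<Prod>f\<in>unit_residues l. h * f)" by metis
  also have "(\<Prod>f\<in>unit_residues l. h * f) = ?P * h ^ (CARD('a) ^ l)"
    by (simp add: prod.distrib card_unit_residues mult.commute)
  finally have "tcong l (?P * h ^ (CARD('a) ^ l)) (?P * 1)" using tcong_sym by auto
  moreover have "coeff ?P 0 \<noteq> 0" by (simp add: coeff_0_prod unit_residues_def)
  ultimately show ?thesis using tcong_mult_cancel by blast
qed

text \<open>The value 0 off the group makes two characters equal as functions as soon as they agree
  on the group, so that characters can be counted.\<close>

definition unit_char :: "nat \<Rightarrow> ('a::{finite,field} poly \<Rightarrow> complex) \<Rightarrow> bool" where
  "unit_char l \<chi> \<longleftrightarrow> \<chi> 1 = 1
     \<and> (\<forall>f g. coeff f 0 = 1 \<longrightarrow> coeff g 0 = 1 \<longrightarrow> \<chi> (f * g) = \<chi> f * \<chi> g)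
     \<and> (\<forall>f g. coeff f 0 = 1 \<longrightarrow> coeff g 0 = 1 \<longrightarrow> tcong l f g \<longrightarrow> \<chi> f = \<chi> g)
     \<and> (\<forall>f. coeff f 0 \<noteq> 1 \<longrightarrow> \<chi> f = 0)"

lemma
  assumes "unit_char l \<chi>"
  shows unit_char_1: "\<chi> 1 = 1"
    and unit_char_mult: "coeff f 0 = 1 \<Longrightarrow> coeff g 0 = 1 \<Longrightarrow> \<chi> (f * g) = \<chi> f * \<chi> g"
    and unit_char_cong: "coeff f 0 = 1 \<Longrightarrow> coeff g 0 = 1 \<Longrightarrow> tcong l f g \<Longrightarrow> \<chi> f = \<chi> g"
    and unit_char_0: "coeff f 0 \<noteq> 1 \<Longrightarrow> \<chi> f = 0"
  using assms unfolding unit_char_def by blast+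

lemma unit_charI:
  assumes "\<chi> 1 = 1"
    and "\<And>f g. coeff f 0 = 1 \<Longrightarrow> coeff g 0 = 1 \<Longrightarrow> \<chi> (f * g) = \<chi> f * \<chi> g"
    and "\<And>f g. coeff f 0 = 1 \<Longrightarrow> coeff g 0 = 1 \<Longrightarrow> tcong l f g \<Longrightarrow> \<chi> f = \<chi> g"
    and "\<And>f. coeff f 0 \<noteq> 1 \<Longrightarrow> \<chi> f = 0"
  shows "unit_char l \<chi>"
  using assms unfolding unit_char_def by blast

lemma unit_char_power:
  assumes "unit_char l \<chi>" "coeff f 0 = 1"
  shows "\<chi> (f ^ n) = \<chi> f ^ n"
  by (induction n)
     (auto simp: unit_char_1[OF assms(1)] unit_char_mult[OF assms(1)] assms coeff_0_power)

lemma tcong_mono: "tcong m f g \<Longrightarrow> l \<le> m \<Longrightarrow> tcong l f g"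
  by (simp add: tcong_iff)

lemma unit_char_mono:
  assumes "unit_char l \<chi>" "l \<le> m"
  shows "unit_char m \<chi>"
proof (rule unit_charI)
  fix f g :: "'a poly" assume "coeff f 0 = 1" "coeff g 0 = 1" "tcong m f g"
  then show "\<chi> f = \<chi> g" using unit_char_cong[OF assms(1)] tcong_mono assms(2) by blast
qed (fact unit_char_1[OF assms(1)] unit_char_mult[OF assms(1)] unit_char_0[OF assms(1)])+

lemma unit_char_root_of_unity:
  fixes \<chi> :: "'a::{finite,field} poly \<Rightarrow> complex"
  assumes "unit_char l \<chi>" "coeff f 0 = 1"
  shows "\<chi> f ^ (CARD('a) ^ l) = 1"
  using unit_char_cong[OF assms(1) _ _ unit_power_card_tcong_1[OF assms(2), of l]]
  by (simp add: unit_char_power[OF assms] unit_char_1[OF assms(1)] coeff_0_power assms(2))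

lemma unit_char_nonzero: "unit_char l \<chi> \<Longrightarrow> coeff f 0 = 1 \<Longrightarrow> \<chi> f \<noteq> 0"
  using unit_char_root_of_unity[of l \<chi> f]
  by (metis finite_UNIV_card_ge_0 finite power_0_left zero_less_power less_numeral_extra(3) zero_neq_one)

lemma norm_unit_char:
  fixes \<chi> :: "'a::{finite,field} poly \<Rightarrow> complex"
  assumes "unit_char l \<chi>" "coeff f 0 = 1"
  shows "norm (\<chi> f) = 1"
proof (rule power_eq_imp_eq_base)
  show "norm (\<chi> f) ^ (CARD('a) ^ l) = 1 ^ (CARD('a) ^ l)"
    using unit_char_root_of_unity[OF assms] by (simp flip: norm_power)
qed auto

text \<open>The sum may run over a level \<open>n\<close> above the level of the character. This is
  why L-functions of nonprincipal characters are polynomials.\<close>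

lemma sum_unit_char_eq_0:
  fixes \<chi> :: "'a::{finite,field} poly \<Rightarrow> complex"
  assumes "unit_char l \<chi>" "l \<le> n" "coeff g 0 = 1" "\<chi> g \<noteq> 1"
  shows "(\<Sum>f\<in>unit_residues n. \<chi> f) = 0"
proof -
  have c: "unit_char n \<chi>" using assms unit_char_mono by blast
  have "(\<Sum>f\<in>unit_residues n. \<chi> f) = (\<Sum>f\<in>unit_residues n. \<chi> (poly_cutoff (Suc n) (g * f)))"
    by (rule sum.reindex_bij_betw[OF bij_betw_unit_residues_mult[OF assms(3)], symmetric])
  also have "\<dots> = (\<Sum>f\<in>unit_residues n. \<chi> g * \<chi> f)"
  proof (rule sum.cong[OF refl])
    fix f :: "'a poly" assume f: "f \<in> unit_residues n"
    then have "coeff f 0 = 1" by (simp add: unit_residues_def)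
    then show "\<chi> (poly_cutoff (Suc n) (g * f)) = \<chi> g * \<chi> f"
      using assms(3) unit_char_cong[OF c _ _ tcong_cutoff]
      by (simp add: unit_char_mult[OF c, symmetric] coeff_mult_0 coeff_poly_cutoff)
  qed
  also have "\<dots> = \<chi> g * (\<Sum>f\<in>unit_residues n. \<chi> f)" by (simp add: sum_distrib_left)
  finally show ?thesis using assms(4) by simp
qed

lemma cis_root_of_unity_power: "N > 0 \<Longrightarrow> cis (2 * pi / real N) ^ N = 1"
  by (simp add: DeMoivre)

lemma primitive_root_sum:
  fixes N k :: nat
  assumes "k < N"
  shows "(\<Sum>j<N. (cis (2 * pi / N) ^ j) ^ k) = (if k = 0 then of_nat N else 0)"
proof (cases "k = 0")
  case False
  let ?w = "cis (2 * pi / N) ^ k"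
  have N: "N > 0" using assms by auto
  have "?w = cis (2 * pi * k / N)" by (simp add: DeMoivre mult_ac)
  moreover have "inj_on (\<lambda>k. cis (2 * pi * real k / real N)) {..<N}"
    using bij_betw_roots_unity[OF N] by (simp add: bij_betw_def)
  then have "cis (2 * pi * k / N) \<noteq> cis (2 * pi * real 0 / N)"
    using inj_onD[of _ "{..<N}" k 0] assms False N by blast
  ultimately have w1: "?w \<noteq> 1" by simp
  have "?w ^ N = (cis (2 * pi / N) ^ N) ^ k" by (simp only: power_mult [symmetric] mult.commute)
  then have "?w ^ N = 1" using N by (simp add: cis_root_of_unity_power)
  moreover have "(\<Sum>j<N. (cis (2 * pi / N) ^ j) ^ k) = (\<Sum>j<N. ?w ^ j)"
    by (simp add: mult.commute flip: power_mult)
  ultimately show ?thesis using w1 False by (simp add: geometric_sum)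
qed auto

text \<open>Characters separating points are the joint eigenvectors of the translations. An eigenvector
  of one more translation is obtained by projecting, and the projections onto the eigenspaces of
  a translation sum up to the identity, so one of them does not vanish.\<close>

definition level_function :: "nat \<Rightarrow> ('a::field poly \<Rightarrow> complex) \<Rightarrow> bool" where
  "level_function l F \<longleftrightarrow>
     (\<forall>f g. coeff f 0 = 1 \<longrightarrow> coeff g 0 = 1 \<longrightarrow> tcong l f g \<longrightarrow> F f = F g)"

lemma level_functionD:
  "level_function l F \<Longrightarrow> coeff f 0 = 1 \<Longrightarrow> coeff g 0 = 1 \<Longrightarrow> tcong l f g \<Longrightarrow> F f = F g"
  unfolding level_function_def by blast

definition eigen_projection ::
  "nat \<Rightarrow> 'a::field poly \<Rightarrow> nat \<Rightarrow> ('a poly \<Rightarrow> complex) \<Rightarrow> 'a poly \<Rightarrow> complex" where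
  "eigen_projection N x j F = (\<lambda>y. (\<Sum>k<N. (cis (2 * pi / N) ^ j) ^ k * F (x ^ k * y)) / of_nat N)"

lemma sum_eigen_projection:
  assumes "N > 0"
  shows "(\<Sum>j<N. eigen_projection N x j F y) = F y"
proof -
  have "(\<Sum>j<N. eigen_projection N x j F y) =
    (\<Sum>k<N. (\<Sum>j<N. (cis (2 * pi / N) ^ j) ^ k) * F (x ^ k * y)) / of_nat N"
    unfolding eigen_projection_def sum_divide_distrib[symmetric]
    by (subst sum.swap) (simp add: sum_distrib_right)
  also have "(\<Sum>k<N. (\<Sum>j<N. (cis (2 * pi / N) ^ j) ^ k) * F (x ^ k * y)) =
    (\<Sum>k<N. if k = 0 then of_nat N * F y else 0)"
    by (rule sum.cong) (auto simp: primitive_root_sum)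
  finally show ?thesis using assms by simp
qed

lemma level_function_eigen_projection:
  fixes F :: "'a::field poly \<Rightarrow> complex"
  assumes "level_function l F" "coeff x 0 = 1"
  shows "level_function l (eigen_projection N x j F)"
  unfolding level_function_def eigen_projection_def
proof (intro allI impI arg_cong[where f = "\<lambda>x. x / of_nat N"] sum.cong refl)
  fix f g :: "'a poly" and k assume *: "coeff f 0 = 1" "coeff g 0 = 1" "tcong l f g"
  have "F (x ^ k * f) = F (x ^ k * g)"
    by (rule level_functionD[OF assms(1)])
       (use assms(2) * in \<open>simp_all add: coeff_mult_0 coeff_0_power tcong_mult\<close>)
  then show "(cis (2 * pi / real N) ^ j) ^ k * F (x ^ k * f) =
      (cis (2 * pi / real N) ^ j) ^ k * F (x ^ k * g)" by simp
qed

lemma eigen_projection_eigen: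
  assumes "level_function l F" "coeff x 0 = 1" "tcong l (x ^ N) 1" "N > 0" "coeff y 0 = 1"
  shows "eigen_projection N x j F (x * y) =
    inverse (cis (2 * pi / N) ^ j) * eigen_projection N x j F y"
proof -
  define v where "v = cis (2 * pi / N) ^ j"
  have v0: "v \<noteq> 0" by (simp add: v_def)
  have "v ^ N = (cis (2 * pi / N) ^ N) ^ j"
    unfolding v_def by (simp only: power_mult [symmetric] mult.commute)
  then have vN: "v ^ N = 1" using assms(4) by (simp add: cis_root_of_unity_power)
  define a where "a = (\<lambda>k. v ^ k * F (x ^ k * y))"
  have "F (x ^ N * y) = F y"
    by (rule level_functionD[OF assms(1)])
       (use assms(2,5) tcong_mult[OF assms(3) tcong_refl[of l y]] in
         \<open>simp_all add: coeff_mult_0 coeff_0_power\<close>)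
  then have aN: "a N = a 0" by (simp add: a_def vN)
  have "v * (\<Sum>k<N. v ^ k * F (x ^ k * (x * y))) = (\<Sum>k<N. a (Suc k))"
    by (simp add: a_def sum_distrib_left mult_ac)
  also have "\<dots> = (\<Sum>k<N. a k)"
    using sum.lessThan_Suc_shift[of a N] aN by simp
  finally have "(\<Sum>k<N. v ^ k * F (x ^ k * (x * y))) = inverse v * (\<Sum>k<N. v ^ k * F (x ^ k * y))"
    using v0 by (simp add: a_def field_simps)
  then show ?thesis by (simp add: eigen_projection_def flip: v_def)
qed

lemma eigen_projection_preserves:
  assumes "\<And>y. coeff y 0 = 1 \<Longrightarrow> F (z * y) = c * F y" "coeff x 0 = 1" "coeff y 0 = 1"
  shows "eigen_projection N x j F (z * y) = c * eigen_projection N x j F y"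
proof -
  have "F (x ^ k * (z * y)) = c * F (x ^ k * y)" for k
    using assms(1)[of "x ^ k * y"] assms(2,3) by (simp add: coeff_mult_0 coeff_0_power mult_ac)
  then show ?thesis by (simp add: eigen_projection_def sum_distrib_left mult_ac)
qed

text \<open>The last conjunct says that eigenvalues already present survive:
  \<open>unit_char_separates\<close> first fixes a nontrivial eigenvalue for one translation, and
  the later projections must preserve it.\<close>

lemma joint_eigenfunction:
  fixes F :: "'a::{finite,field} poly \<Rightarrow> complex"
  assumes "finite B" "\<And>x. x \<in> B \<Longrightarrow> coeff x 0 = 1"
    and "level_function l F" "coeff y0 0 = 1" "F y0 \<noteq> 0"
  shows "\<exists>F'. level_function l F' \<and> (\<exists>y. coeff y 0 = 1 \<and> F' y \<noteq> 0)
    \<and> (\<forall>x\<in>B. \<exists>c. \<forall>y. coeff y 0 = 1 \<longrightarrow> F' (x * y) = c * F' y)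
    \<and> (\<forall>z c. (\<forall>y. coeff y 0 = 1 \<longrightarrow> F (z * y) = c * F y) \<longrightarrow>
            (\<forall>y. coeff y 0 = 1 \<longrightarrow> F' (z * y) = c * F' y))"
  using assms(1,2)
proof (induction B rule: finite_induct)
  case empty
  show ?case by (rule exI[of _ F]) (use assms in auto)
next
  case (insert x B)
  then obtain F' where F': "level_function l F'" "\<exists>y. coeff y 0 = 1 \<and> F' y \<noteq> 0"
    "\<forall>x\<in>B. \<exists>c. \<forall>y. coeff y 0 = 1 \<longrightarrow> F' (x * y) = c * F' y"
    "\<forall>z c. (\<forall>y. coeff y 0 = 1 \<longrightarrow> F (z * y) = c * F y) \<longrightarrow>
            (\<forall>y. coeff y 0 = 1 \<longrightarrow> F' (z * y) = c * F' y)" by auto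
  have x: "coeff x 0 = 1" using insert by auto
  define N where "N = CARD('a) ^ l"
  have N: "N > 0" by (simp add: N_def)
  have xN: "tcong l (x ^ N) 1" unfolding N_def by (rule unit_power_card_tcong_1[OF x])
  obtain y where y: "coeff y 0 = 1" "F' y \<noteq> 0" using F' by auto
  then obtain j where j: "eigen_projection N x j F' y \<noteq> 0"
    using sum_eigen_projection[OF N, of x F' y] by (metis (no_types, lifting) sum.neutral)
  let ?F = "eigen_projection N x j F'"
  have "level_function l ?F" by (rule level_function_eigen_projection[OF F'(1) x])
  moreover have "\<forall>w\<in>insert x B. \<exists>c. \<forall>y. coeff y 0 = 1 \<longrightarrow> ?F (w * y) = c * ?F y"
    using F'(3) eigen_projection_eigen[OF F'(1) x xN N] eigen_projection_preserves[of F' _ _ x] x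
    by (metis insert_iff)
  moreover have "\<forall>z c. (\<forall>y. coeff y 0 = 1 \<longrightarrow> F (z * y) = c * F y) \<longrightarrow>
            (\<forall>y. coeff y 0 = 1 \<longrightarrow> ?F (z * y) = c * ?F y)"
    using F'(4) eigen_projection_preserves[of F' _ _ x] x by metis
  ultimately show ?case using y(1) j by (intro exI[of _ ?F]) blast
qed

lemma unit_char_separates:
  fixes f :: "'a::{finite,field} poly"
  assumes "coeff f 0 = 1" "\<not> tcong l f 1"
  shows "\<exists>\<chi>. unit_char l \<chi> \<and> \<chi> f \<noteq> 1"
proof -
  \<comment> \<open>The indicator of the class of 1 is not invariant under translation by
    \<open>f\<close>, so it has a component with eigenvalue other than 1.\<close>
  define F0 :: "'a poly \<Rightarrow> complex" where "F0 = (\<lambda>g. if tcong l g 1 then 1 else 0)"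
  define N where "N = CARD('a) ^ l"
  have N: "N > 0" by (simp add: N_def)
  have lev: "level_function l F0"
    unfolding level_function_def F0_def by (metis tcong_sym tcong_trans)
  have fN: "tcong l (f ^ N) 1" unfolding N_def by (rule unit_power_card_tcong_1[OF assms(1)])
  let ?P = "\<lambda>j. eigen_projection N f j F0"
  have "\<exists>j y. inverse (cis (2 * pi / N) ^ j) \<noteq> 1 \<and> coeff y 0 = 1 \<and> ?P j y \<noteq> 0"
  proof (rule ccontr)
    assume *: "\<not> ?thesis"
    have "?P j (f * 1) = ?P j 1" for j
      using * eigen_projection_eigen[OF lev assms(1) fN N, of 1 j] assms(1)
      by (cases "inverse (cis (2 * pi / N) ^ j) = 1") auto
    then have "(\<Sum>j<N. ?P j (f * 1)) = (\<Sum>j<N. ?P j 1)" by (intro sum.cong) auto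
    then have "F0 (f * 1) = F0 1" unfolding sum_eigen_projection[OF N] .
    then show False using assms by (simp add: F0_def)
  qed
  then obtain j y where jy: "inverse (cis (2 * pi / N) ^ j) \<noteq> 1" "coeff y 0 = 1" "?P j y \<noteq> 0" by blast
  obtain F where F: "level_function l F" "\<exists>y. coeff y 0 = 1 \<and> F y \<noteq> 0"
    "\<forall>x\<in>unit_residues l. \<exists>c. \<forall>y. coeff y 0 = 1 \<longrightarrow> F (x * y) = c * F y"
    "\<forall>z c. (\<forall>y. coeff y 0 = 1 \<longrightarrow> ?P j (z * y) = c * ?P j y) \<longrightarrow>
            (\<forall>y. coeff y 0 = 1 \<longrightarrow> F (z * y) = c * F y)"
    using joint_eigenfunction[OF finite_unit_residues[of l] _
        level_function_eigen_projection[OF lev assms(1)] jy(2,3)]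
    by (auto simp: unit_residues_def)
  have eig: "\<exists>c. \<forall>y. coeff y 0 = 1 \<longrightarrow> F (x * y) = c * F y" if x: "coeff x 0 = 1" for x
  proof -
    have "F (poly_cutoff (Suc l) x * y) = F (x * y)" if "coeff y 0 = 1" for y
      by (rule level_functionD[OF F(1)])
         (use x that tcong_mult[OF tcong_cutoff[of l x] tcong_refl[of l y]] in
           \<open>simp_all add: coeff_mult_0 coeff_poly_cutoff\<close>)
    then show ?thesis using F(3) cutoff_in_unit_residues[OF x, of l] by metis
  qed
  have F1: "F 1 \<noteq> 0"
  proof -
    obtain y c where "coeff y 0 = 1" "F y \<noteq> 0"
      and c: "\<And>z. coeff z 0 = 1 \<Longrightarrow> F (y * z) = c * F z"
      using F(2) eig by blast
    then show ?thesis using c[of 1] by auto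
  qed
  \<comment> \<open>Every translation acts on F by a scalar, which is F x / F 1. Hence F / F 1 is
    multiplicative.\<close>
  have mult: "F (x * y) * F 1 = F x * F y" if "coeff x 0 = 1" "coeff y 0 = 1" for x y
  proof -
    from eig[OF that(1)] obtain c where c: "\<And>y. coeff y 0 = 1 \<Longrightarrow> F (x * y) = c * F y" by blast
    show ?thesis using c[of y] c[of 1] that by simp
  qed
  have ff: "F f = inverse (cis (2 * pi / N) ^ j) * F 1"
  proof -
    have "\<forall>y. coeff y 0 = 1 \<longrightarrow> ?P j (f * y) = inverse (cis (2 * pi / N) ^ j) * ?P j y"
      using eigen_projection_eigen[OF lev assms(1) fN N] by blast
    then have "\<forall>y. coeff y 0 = 1 \<longrightarrow> F (f * y) = inverse (cis (2 * pi / N) ^ j) * F y"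
      using F(4) by blast
    from this[rule_format, of 1] show ?thesis by simp
  qed
  define \<chi> where "\<chi> = (\<lambda>g. if coeff g 0 = 1 then F g / F 1 else 0)"
  have "unit_char l \<chi>"
  proof (rule unit_charI)
    fix f g :: "'a poly" assume fg: "coeff f 0 = 1" "coeff g 0 = 1"
    then show "\<chi> (f * g) = \<chi> f * \<chi> g"
      using F1 mult[OF fg] by (simp add: \<chi>_def coeff_mult_0 field_simps)
    show "\<chi> f = \<chi> g" if "tcong l f g"
      using level_functionD[OF F(1) fg that] fg by (simp add: \<chi>_def)
  qed (use F1 in \<open>simp_all add: \<chi>_def\<close>)
  moreover have "\<chi> f \<noteq> 1" using ff jy(1) F1 assms by (simp add: \<chi>_def)
  ultimately show ?thesis by blast
qed

section \<open>Orthogonality of characters\<close>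

definition unit_chars :: "nat \<Rightarrow> ('a::{finite,field} poly \<Rightarrow> complex) set" where
  "unit_chars l = {\<chi>. unit_char l \<chi>}"

definition principal_char :: "'a::{finite,field} poly \<Rightarrow> complex" where
  "principal_char f = (if coeff f 0 = 1 then 1 else 0)"

lemma principal_char_in: "principal_char \<in> unit_chars l"
  by (auto simp: unit_chars_def principal_char_def coeff_mult_0 intro!: unit_charI)

lemma not_principal_char:
  "unit_char l \<chi> \<Longrightarrow> \<chi> \<noteq> principal_char \<longleftrightarrow> (\<exists>f. coeff f 0 = 1 \<and> \<chi> f \<noteq> 1)"
  using unit_char_0[of l \<chi>] by (auto simp: fun_eq_iff principal_char_def)

lemma finite_unit_chars: "finite (unit_chars l :: ('a::{finite,field} poly \<Rightarrow> complex) set)"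
proof -
  let ?U = "unit_residues l :: 'a poly set"
  let ?R = "{z::complex. z ^ (CARD('a) ^ l) = 1}"
  let ?E = "\<lambda>h f. if coeff f 0 = 1 then h (poly_cutoff (Suc l) f) else 0"
  have "finite ?R" by (rule finite_roots_unity) simp
  then have fin: "finite (PiE ?U (\<lambda>_. ?R))" by (intro finite_PiE) auto
  have "unit_chars l \<subseteq> ?E ` PiE ?U (\<lambda>_. ?R)"
  proof
    fix \<chi> :: "'a poly \<Rightarrow> complex" assume "\<chi> \<in> unit_chars l"
    then have c: "unit_char l \<chi>" by (simp add: unit_chars_def)
    have "\<chi> = ?E (restrict \<chi> ?U)"
    proof
      fix f
      show "\<chi> f = ?E (restrict \<chi> ?U) f"
        using unit_char_cong[OF c _ _ tcong_cutoff, of f] unit_char_0[OF c, of f]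
        by (auto simp: cutoff_in_unit_residues coeff_poly_cutoff)
    qed
    moreover have "restrict \<chi> ?U \<in> PiE ?U (\<lambda>_. ?R)"
      using unit_char_root_of_unity[OF c] by (auto simp: unit_residues_def)
    ultimately show "\<chi> \<in> ?E ` PiE ?U (\<lambda>_. ?R)" by blast
  qed
  then show ?thesis using fin by (meson finite_imageI finite_subset)
qed

lemma sum_unit_chars_eq_0:
  fixes f :: "'a::{finite,field} poly"
  assumes "coeff f 0 = 1" "\<not> tcong l f 1"
  shows "(\<Sum>\<chi>\<in>unit_chars l. \<chi> f) = 0"
proof -
  obtain \<chi>0 where c0: "unit_char l \<chi>0" "\<chi>0 f \<noteq> 1" using unit_char_separates[OF assms] by blast
  let ?m = "\<lambda>\<chi> f. \<chi>0 f * \<chi> f"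
  have inj: "inj_on ?m (unit_chars l)"
  proof (rule inj_onI)
    fix \<chi> \<chi>' assume *: "\<chi> \<in> unit_chars l" "\<chi>' \<in> unit_chars l" "?m \<chi> = ?m \<chi>'"
    show "\<chi> = \<chi>'"
    proof
      fix g
      show "\<chi> g = \<chi>' g"
        using fun_cong[OF *(3), of g] *(1,2) unit_char_nonzero[OF c0(1), of g]
        unit_char_0[of l \<chi> g] unit_char_0[of l \<chi>' g]
        by (cases "coeff g 0 = 1") (auto simp: unit_chars_def)
    qed
  qed
  have "unit_char l (?m \<chi>)" if c: "unit_char l \<chi>" for \<chi>
  proof (rule unit_charI)
    fix f g :: "'a poly" assume fg: "coeff f 0 = 1" "coeff g 0 = 1"
    then show "?m \<chi> (f * g) = ?m \<chi> f * ?m \<chi> g"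
      by (simp add: unit_char_mult[OF c] unit_char_mult[OF c0(1)])
    show "?m \<chi> f = ?m \<chi> g" if "tcong l f g"
      using unit_char_cong[OF c fg that] unit_char_cong[OF c0(1) fg that] by simp
  qed (simp_all add: unit_char_1[OF c] unit_char_1[OF c0(1)] unit_char_0[OF c])
  then have "?m ` unit_chars l \<subseteq> unit_chars l" by (auto simp: unit_chars_def)
  with inj have "bij_betw ?m (unit_chars l) (unit_chars l)"
    unfolding bij_betw_def using endo_inj_surj[OF finite_unit_chars] by blast
  then have "(\<Sum>\<chi>\<in>unit_chars l. \<chi> f) = (\<Sum>\<chi>\<in>unit_chars l. \<chi>0 f * \<chi> f)"
    by (rule sum.reindex_bij_betw[symmetric, where g = "\<lambda>\<chi>. \<chi> f", simplified])
  also have "\<dots> = \<chi>0 f * (\<Sum>\<chi>\<in>unit_chars l. \<chi> f)" by (simp add: sum_distrib_left)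
  finally show ?thesis using c0 by simp
qed

text \<open>Both orders of summation over characters and residues are evaluated by orthogonality:
  one yields the number of characters, the other the order of the group.\<close>

lemma card_unit_chars:
  "card (unit_chars l :: ('a::{finite,field} poly \<Rightarrow> complex) set) = CARD('a) ^ l"
proof -
  let ?X = "unit_chars l :: ('a poly \<Rightarrow> complex) set" and ?U = "unit_residues l :: 'a poly set"
  have "(\<Sum>f\<in>?U. \<Sum>\<chi>\<in>?X. \<chi> f) = (\<Sum>f\<in>?U. if f = 1 then of_nat (card ?X) else 0)"
  proof (rule sum.cong[OF refl])
    fix f assume f: "f \<in> ?U"
    have "(\<Sum>\<chi>\<in>?X. \<chi> 1) = (\<Sum>\<chi>\<in>?X. 1)"
      by (rule sum.cong) (auto simp: unit_chars_def dest: unit_char_1)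
    then show "(\<Sum>\<chi>\<in>?X. \<chi> f) = (if f = 1 then of_nat (card ?X) else 0)"
      using sum_unit_chars_eq_0[of f l] f tcong_unit_residues_eq[OF f one_in_unit_residues]
      by (auto simp: unit_residues_def)
  qed
  also have "\<dots> = of_nat (card ?X)" by simp
  finally have 1: "(\<Sum>f\<in>?U. \<Sum>\<chi>\<in>?X. \<chi> f) = of_nat (card ?X)" .
  have "(\<Sum>\<chi>\<in>?X. \<Sum>f\<in>?U. \<chi> f) = (\<Sum>\<chi>\<in>?X. if \<chi> = principal_char then of_nat (card ?U) else 0)"
  proof (rule sum.cong[OF refl])
    fix \<chi> assume "\<chi> \<in> ?X"
    then have c: "unit_char l \<chi>" by (simp add: unit_chars_def)
    show "(\<Sum>f\<in>?U. \<chi> f) = (if \<chi> = principal_char then of_nat (card ?U) else 0)"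
    proof (cases "\<chi> = principal_char")
      case True
      then show ?thesis by (simp add: principal_char_def unit_residues_def)
    next
      case False
      then show ?thesis using sum_unit_char_eq_0[OF c order_refl] not_principal_char[OF c] by auto
    qed
  qed
  also have "\<dots> = of_nat (card ?U)" by (simp add: finite_unit_chars principal_char_in)
  finally have "(of_nat (card ?X) :: complex) = of_nat (card ?U)"
    using 1 by (subst (asm) sum.swap) simp
  then show ?thesis by (simp only: of_nat_eq_iff card_unit_residues)
qed

lemma sum_unit_chars:
  fixes f :: "'a::{finite,field} poly"
  assumes "coeff f 0 = 1"
  shows "(\<Sum>\<chi>\<in>unit_chars l. \<chi> f) = (if tcong l f 1 then of_nat (CARD('a) ^ l) else 0)"
proof (cases "tcong l f 1")
  case True
  then have "\<chi> f = 1" if "\<chi> \<in> unit_chars l" for \<chi>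
    using that unit_char_cong[of l \<chi> f 1] unit_char_1[of l \<chi>] assms by (auto simp: unit_chars_def)
  then have "(\<Sum>\<chi>\<in>unit_chars l. \<chi> f) = (\<Sum>\<chi>\<in>(unit_chars l :: ('a poly \<Rightarrow> complex) set). 1)"
    by (intro sum.cong) auto
  then show ?thesis using True by (simp add: card_unit_chars)
qed (use sum_unit_chars_eq_0 assms in auto)

subsection \<open>L-functions and the error term\<close>

text \<open>\<open>reflect_poly\<close> forgets the power of T dividing a polynomial. As the degree
  \<open>n\<close> is known, that power is T ^ (n - degree g), and the inverse map restores
  it.\<close>

lemma bij_betw_reflect_poly:
  "bij_betw reflect_poly (monic_polys n) (unit_residues n :: 'a::{finite,field} poly set)"
proof (rule bij_betw_byWitness[where f' = "\<lambda>g. monom 1 (n - degree g) * reflect_poly g"])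
  show "\<forall>f\<in>(monic_polys n :: 'a poly set). monom 1 (n - degree (reflect_poly f)) * reflect_poly (reflect_poly f) = f"
  proof
    fix f :: "'a poly" assume f: "f \<in> monic_polys n"
    define g where "g = reflect_poly f"
    have f0: "f \<noteq> 0" and n: "degree f = n" using f by (auto simp: monic_polys_def)
    have c: "coeff g i = (if i > n then 0 else coeff f (n - i))" for i
      by (simp add: g_def coeff_reflect_poly n)
    have dg: "degree g \<le> n" unfolding g_def using degree_reflect_poly_le[of f] n by simp
    have "monom 1 (n - degree g) * reflect_poly g = f"
    proof (rule poly_eqI)
      fix i
      show "coeff (monom 1 (n - degree g) * reflect_poly g) i = coeff f i"
      proof (cases "i > n")
        case True
        then show ?thesis using n dg
          by (simp add: coeff_monom_mult coeff_reflect_poly coeff_eq_0)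
      next
        case False
        have "coeff f i = coeff g (n - i)" using False by (simp add: c)
        then show ?thesis using False dg coeff_eq_0[of g "n - i"]
          by (auto simp: coeff_monom_mult coeff_reflect_poly not_le)
      qed
    qed
    then show "monom 1 (n - degree (reflect_poly f)) * reflect_poly (reflect_poly f) = f"
      by (simp add: g_def)
  qed
  show "\<forall>g\<in>(unit_residues n :: 'a poly set). reflect_poly (monom 1 (n - degree g) * reflect_poly g) = g"
  proof
    fix g :: "'a poly" assume "g \<in> unit_residues n"
    moreover have "reflect_poly (monom (1::'a) k) = 1" for k
      by (rule poly_eqI) (auto simp: coeff_reflect_poly degree_monom_eq)
    ultimately show "reflect_poly (monom 1 (n - degree g) * reflect_poly g) = g"
      by (simp add: unit_residues_def reflect_poly_mult)
  qed
  show "reflect_poly ` monic_polys n \<subseteq> unit_residues n"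
    by (auto simp: monic_polys_def unit_residues_def degree_reflect_poly_le)
  show "(\<lambda>g. monom 1 (n - degree g) * reflect_poly g) ` unit_residues n \<subseteq> (monic_polys n :: 'a poly set)"
  proof (rule image_subsetI)
    fix g :: "'a poly" assume g: "g \<in> unit_residues n"
    then have nz: "reflect_poly g \<noteq> 0" "coeff g 0 \<noteq> 0" "degree g \<le> n" "coeff g 0 = 1"
      by (auto simp: unit_residues_def)
    have "lead_coeff (reflect_poly g) = 1"
      using nz(2,4) by (simp add: coeff_reflect_poly)
    then have "lead_coeff (monom 1 (n - degree g) * reflect_poly g) = 1"
      by (simp add: lead_coeff_mult degree_monom_eq)
    moreover have "degree (monom 1 (n - degree g) * reflect_poly g) = n"
      using nz by (simp add: degree_mult_eq degree_monom_eq)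
    ultimately show "monom 1 (n - degree g) * reflect_poly g \<in> monic_polys n"
      by (simp add: monic_polys_def)
  qed
qed

text \<open>The coefficient of u ^ n of the L-function, which sums \<chi> over the reversals of the
  monic polynomials of degree n.\<close>

definition L_coeff :: "('a::{finite,field} poly \<Rightarrow> complex) \<Rightarrow> nat \<Rightarrow> complex" where
  "L_coeff \<chi> n = (\<Sum>g\<in>unit_residues n. \<chi> g)"

text \<open>The coefficient of u ^ n in u L'(u) / L(u).\<close>

definition prime_power_sum :: "('a::{finite,field} poly \<Rightarrow> complex) \<Rightarrow> nat \<Rightarrow> complex" where
  "prime_power_sum \<chi> n = mangoldt_sum (\<lambda>f. \<chi> (reflect_poly f)) n"

lemma monic_sum_reflect: "monic_sum (\<lambda>f. \<chi> (reflect_poly f)) n = L_coeff \<chi> n"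
  unfolding monic_sum_def L_coeff_def by (rule sum.reindex_bij_betw[OF bij_betw_reflect_poly])

lemma L_coeff_recurrence:
  assumes "unit_char l \<chi>"
  shows "of_nat n * L_coeff \<chi> n = (\<Sum>k=1..n. prime_power_sum \<chi> k * L_coeff \<chi> (n - k))"
proof -
  have "monic_multiplicative (\<lambda>f. \<chi> (reflect_poly f))"
    by (auto simp: monic_multiplicative_def reflect_poly_mult unit_char_mult[OF assms])
  from monic_sum_recurrence[OF this, of n] show ?thesis
    by (simp add: monic_sum_reflect prime_power_sum_def)
qed

lemma unit_residues_0: "unit_residues 0 = {1}"
  by (auto simp: unit_residues_def elim!: degree_eq_zeroE simp: one_pCons)

lemma L_coeff_0: "unit_char l \<chi> \<Longrightarrow> L_coeff \<chi> 0 = 1"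
  by (simp add: L_coeff_def unit_residues_0 unit_char_1)

lemma unit_residues_Suc:
  "unit_residues (Suc n) = (\<lambda>(f, a). f + monom a (Suc n)) ` (unit_residues n \<times> UNIV)"
proof (intro Set.set_eqI iffI)
  fix f :: "'a poly" assume f: "f \<in> unit_residues (Suc n)"
  let ?g = "poly_cutoff (Suc n) f"
  have "f = ?g + monom (coeff f (Suc n)) (Suc n)"
    by (rule poly_eqI)
       (use f in \<open>auto simp: coeff_poly_cutoff unit_residues_def coeff_eq_0\<close>)
  moreover have "?g \<in> unit_residues n"
    using f by (intro cutoff_in_unit_residues) (simp add: unit_residues_def)
  ultimately show "f \<in> (\<lambda>(f, a). f + monom a (Suc n)) ` (unit_residues n \<times> UNIV)"
    by (intro image_eqI[of _ _ "(?g, coeff f (Suc n))"]) auto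
next
  fix f :: "'a poly" assume "f \<in> (\<lambda>(f, a). f + monom a (Suc n)) ` (unit_residues n \<times> UNIV)"
  then obtain g a where g: "f = g + monom a (Suc n)" "g \<in> unit_residues n" by auto
  have "degree f \<le> Suc n" unfolding g(1)
    by (rule degree_add_le) (use g in \<open>auto simp: unit_residues_def degree_monom_le\<close>)
  then show "f \<in> unit_residues (Suc n)" using g by (simp add: unit_residues_def)
qed

lemma sum_unit_residues_Suc:
  "(\<Sum>f\<in>unit_residues (Suc n). h f) =
   (\<Sum>f\<in>unit_residues n. \<Sum>a\<in>UNIV. h (f + monom a (Suc n) :: 'a::{finite,field} poly))"
proof -
  have "inj_on (\<lambda>(f, a). f + monom a (Suc n)) (unit_residues n \<times> (UNIV :: 'a set))"
  proof (rule inj_onI, clarify)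
    fix f g :: "'a poly" and a b
    assume *: "f \<in> unit_residues n" "g \<in> unit_residues n" "f + monom a (Suc n) = g + monom b (Suc n)"
    have "coeff f (Suc n) = 0" "coeff g (Suc n) = 0"
      using * by (auto simp: unit_residues_def coeff_eq_0)
    then have "a = b" using arg_cong[OF *(3), of "\<lambda>f. coeff f (Suc n)"] by simp
    then show "f = g \<and> a = b" using * by simp
  qed
  then show ?thesis
    by (simp add: unit_residues_Suc sum.reindex sum.cartesian_product case_prod_unfold)
qed

lemma L_coeff_1: "L_coeff \<chi> 1 = (\<Sum>a\<in>UNIV. \<chi> [:1, a:])"
  by (simp add: L_coeff_def sum_unit_residues_Suc unit_residues_0 monom_Suc monom_0 one_pCons)

lemma L_coeff_2: "L_coeff \<chi> 2 = (\<Sum>a\<in>UNIV. \<Sum>b\<in>UNIV. \<chi> [:1, a, b:])"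
  by (simp add: L_coeff_def sum_unit_residues_Suc unit_residues_0 monom_Suc monom_0 one_pCons
      numeral_2_eq_2)

lemma L_coeff_eq_0:
  assumes "unit_char l \<chi>" "\<chi> \<noteq> principal_char" "n \<ge> l"
  shows "L_coeff \<chi> n = 0"
  using sum_unit_char_eq_0[OF assms(1,3)] assms(1,2)
  by (auto simp: L_coeff_def not_principal_char)

lemma nonprincipal_level_pos: "unit_char l \<chi> \<Longrightarrow> \<chi> \<noteq> principal_char \<Longrightarrow> l \<ge> 1"
  using L_coeff_eq_0[of l \<chi> 0] L_coeff_0[of l \<chi>] by (cases l) auto

text \<open>Here the L-function is 1 / (1 - q u). This is the source of the main term q ^ (n -
  l).\<close>

lemma prime_power_sum_principal:
  assumes "n \<ge> 1"
  shows "prime_power_sum (principal_char :: 'a::{finite,field} poly \<Rightarrow> complex) n = of_nat (CARD('a) ^ n)"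
proof (rule newton_recurrence_unique[of "\<lambda>n. of_nat (CARD('a) ^ n)" _ _ n])
  have c: "unit_char 0 (principal_char :: 'a poly \<Rightarrow> complex)"
    using principal_char_in[of 0] by (simp add: unit_chars_def)
  have L: "L_coeff (principal_char :: 'a poly \<Rightarrow> complex) n = of_nat (CARD('a) ^ n)" for n
    by (simp add: L_coeff_def principal_char_def unit_residues_def
        flip: card_unit_residues[of n, where 'a = 'a])
  show "of_nat n * of_nat (CARD('a) ^ n) =
    (\<Sum>k=1..n. prime_power_sum (principal_char :: 'a poly \<Rightarrow> complex) k * of_nat (CARD('a) ^ (n - k)))" for n
    using L_coeff_recurrence[OF c, of n] unfolding L .
  show "of_nat n * of_nat (CARD('a) ^ n) =
    (\<Sum>k=1..n. of_nat (CARD('a) ^ k) * of_nat (CARD('a) ^ (n - k)) :: complex)" for n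
    by (simp flip: power_add)
qed (use assms in auto)

lemma sum_prime_power_sum:
  "(\<Sum>\<chi>\<in>(unit_chars l :: ('a poly \<Rightarrow> complex) set). prime_power_sum \<chi> n) =
     of_nat (CARD('a::{finite,field}) ^ l * psi n (replicate l (0::'a)))"
proof -
  \<comment> \<open>For j > n the convention for next-to-leading coefficients and the coefficients
    of the reversal both give 0, so l > n needs no separate treatment.\<close>
  have iff: "tcong l (reflect_poly f) 1 \<longleftrightarrow>
      (\<forall>j\<in>{1..l}. next_to_leading_coeff f j = replicate l (0::'a) ! (j - 1))"
    if "f \<in> monic_polys n" for f :: "'a poly"
  proof -
    have c: "next_to_leading_coeff f j = coeff (reflect_poly f) j" for j
      by (simp add: next_to_leading_coeff_def coeff_reflect_poly)
    have c0: "coeff (reflect_poly f) 0 = 1" using that by (auto simp: monic_polys_def)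
    have "(\<forall>j\<le>l. coeff (reflect_poly f) j = coeff 1 j) \<longleftrightarrow> (\<forall>j\<in>{1..l}. coeff (reflect_poly f) j = 0)"
    proof
      assume R: "\<forall>j\<in>{1..l}. coeff (reflect_poly f) j = 0"
      show "\<forall>j\<le>l. coeff (reflect_poly f) j = coeff 1 j"
      proof (intro allI impI)
        fix j assume "j \<le> l"
        then show "coeff (reflect_poly f) j = coeff 1 j"
          using R c0 by (cases "j = 0") (simp_all add: coeff_eq_0)
      qed
    qed (auto simp: coeff_eq_0)
    also have "\<dots> \<longleftrightarrow> (\<forall>j\<in>{1..l}. next_to_leading_coeff f j = replicate l 0 ! (j - 1))"
      unfolding c by (intro ball_cong) auto
    finally show ?thesis unfolding tcong_iff .
  qed
  have "(\<Sum>\<chi>\<in>(unit_chars l :: ('a poly \<Rightarrow> complex) set). prime_power_sum \<chi> n) =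
    (\<Sum>f\<in>monic_polys n. of_nat (poly_mangoldt f) * (\<Sum>\<chi>\<in>unit_chars l. \<chi> (reflect_poly f :: 'a poly)))"
    unfolding prime_power_sum_def mangoldt_sum_def
    by (subst sum.swap) (simp add: sum_distrib_left)
  also have "\<dots> = (\<Sum>f\<in>monic_polys n. of_nat (poly_mangoldt f) *
     (if tcong l (reflect_poly f) (1::'a poly) then of_nat (CARD('a) ^ l) else 0))"
  proof (intro sum.cong refl arg_cong2[where f = "(*)"] sum_unit_chars)
    fix f :: "'a poly" assume "f \<in> monic_polys n"
    then show "coeff (reflect_poly f) 0 = 1" by (auto simp: monic_polys_def)
  qed
  also have "\<dots> = (\<Sum>f\<in>{f\<in>monic_polys n. tcong l (reflect_poly f) (1::'a poly)}.
      of_nat (poly_mangoldt f) * of_nat (CARD('a) ^ l))"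
    by (subst sum.inter_filter) (auto simp: finite_monic_polys intro!: sum.cong)
  also have "{f\<in>monic_polys n. tcong l (reflect_poly f) (1::'a poly)} =
     {f\<in>monic_polys n. \<forall>j\<in>{1..l}. next_to_leading_coeff f j = replicate l (0::'a) ! (j - 1)}"
    using iff by blast
  finally show ?thesis
    by (simp add: psi_def sum_distrib_left mult.commute)
qed

text \<open>\<open>A\<close> lists the reciprocal roots of the L-function of \<open>\<chi>\<close>.\<close>

definition L_roots :: "nat \<Rightarrow> ('a::{finite,field} poly \<Rightarrow> complex) \<Rightarrow> complex multiset \<Rightarrow> bool" where
  "L_roots l \<chi> A \<longleftrightarrow> 0 \<notin># A \<and> (\<forall>n\<ge>1. prime_power_sum \<chi> n = - (\<Sum>g\<in>#A. g ^ n))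
     \<and> (\<forall>g\<in>#A. (\<Sum>j<l. L_coeff \<chi> j * g ^ (l - 1 - j)) = 0)"

lemma L_roots_exist:
  assumes "unit_char l \<chi>" "\<chi> \<noteq> principal_char"
  shows "\<exists>A. L_roots l \<chi> A"
proof -
  have l: "{..l - 1} = {..<l}" using nonprincipal_level_pos[OF assms] by auto
  obtain A where "0 \<notin># A" "\<And>n. n \<ge> 1 \<Longrightarrow> prime_power_sum \<chi> n = - (\<Sum>g\<in>#A. g ^ n)"
    "\<And>g. g \<in># A \<Longrightarrow> (\<Sum>j\<le>l - 1. L_coeff \<chi> j * g ^ (l - 1 - j)) = 0"
    by (rule power_sum_of_recurrence[of "L_coeff \<chi>" "l - 1", OF L_coeff_0[OF assms(1)] _
          L_coeff_recurrence[OF assms(1)]])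
       (auto intro!: L_coeff_eq_0[OF assms])
  then show ?thesis unfolding L_roots_def l by blast
qed

lemma sum_mset_sum_family:
  "finite S \<Longrightarrow> (\<Sum>x\<in>#(\<Sum>i\<in>S. A i). f x) = (\<Sum>i\<in>S. \<Sum>x\<in>#A i. f x)"
  by (induction S rule: finite_induct) auto

lemma set_mset_sum_family: "finite S \<Longrightarrow> x \<in># (\<Sum>i\<in>S. A i) \<longleftrightarrow> (\<exists>i\<in>S. x \<in># A i)"
  by (induction S rule: finite_induct) auto

text \<open>The multiset \<open>B\<close> unites the reciprocal roots of all nonprincipal characters
  with multiplicity. The factor q ^ l is the order of the character group.\<close>

lemma error_power_sum:
  obtains A :: "('a::{finite,field} poly \<Rightarrow> complex) \<Rightarrow> complex multiset" and B where
    "\<And>\<chi>. unit_char l \<chi> \<Longrightarrow> \<chi> \<noteq> principal_char \<Longrightarrow> L_roots l \<chi> (A \<chi>)"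
    "\<And>g. g \<in># B \<longleftrightarrow> (\<exists>\<chi>. unit_char l \<chi> \<and> \<chi> \<noteq> principal_char \<and> g \<in># A \<chi>)"
    "\<And>n. n \<ge> 1 \<Longrightarrow> of_real (normalized_error TYPE('a) l n * real CARD('a) powr (real n / 2)
        * real CARD('a) ^ l) = - (\<Sum>g\<in>#B. g ^ n)"
proof -
  let ?X = "unit_chars l - {principal_char} :: ('a poly \<Rightarrow> complex) set"
  obtain A :: "('a poly \<Rightarrow> complex) \<Rightarrow> complex multiset"
    where A: "\<And>\<chi>. unit_char l \<chi> \<Longrightarrow> \<chi> \<noteq> principal_char \<Longrightarrow> L_roots l \<chi> (A \<chi>)"
    using L_roots_exist choice[of "\<lambda>\<chi> A. unit_char l \<chi> \<longrightarrow> \<chi> \<noteq> principal_char \<longrightarrow> L_roots l \<chi> A"]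
    by blast
  define B where "B = (\<Sum>\<chi>\<in>?X. A \<chi>)"
  have fin: "finite ?X" by (simp add: finite_unit_chars)
  show ?thesis
  proof (rule that[of A B])
    show "L_roots l \<chi> (A \<chi>)" if "unit_char l \<chi>" "\<chi> \<noteq> principal_char" for \<chi> using A that .
    show "g \<in># B \<longleftrightarrow> (\<exists>\<chi>. unit_char l \<chi> \<and> \<chi> \<noteq> principal_char \<and> g \<in># A \<chi>)" for g
      unfolding B_def set_mset_sum_family[OF fin] by (auto simp: unit_chars_def)
    fix n :: nat assume n: "n \<ge> 1"
    let ?q = "CARD('a)"
    have q: "real ?q > 0" by simp
    have "of_nat (?q ^ l * psi n (replicate l (0::'a))) =
        prime_power_sum (principal_char :: 'a poly \<Rightarrow> complex) n + (\<Sum>\<chi>\<in>?X. prime_power_sum \<chi> n)"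
      unfolding sum_prime_power_sum[symmetric]
      by (rule sum.remove) (auto simp: finite_unit_chars principal_char_in)
    also have "(\<Sum>\<chi>\<in>?X. prime_power_sum \<chi> n) = (\<Sum>\<chi>\<in>?X. - (\<Sum>g\<in>#A \<chi>. g ^ n))"
      by (rule sum.cong) (use A n in \<open>auto simp: unit_chars_def L_roots_def\<close>)
    also have "\<dots> = - (\<Sum>g\<in>#B. g ^ n)"
      unfolding B_def sum_mset_sum_family[OF fin] by (simp add: sum_negf)
    finally have 1: "of_nat (?q ^ l * psi n (replicate l (0::'a))) - of_nat (?q ^ n) = - (\<Sum>g\<in>#B. g ^ n)"
      by (simp add: prime_power_sum_principal[OF n])
    have "real ?q powi (int n - int l) * real ?q ^ l = real ?q ^ n"
      using q by (simp add: power_int_diff)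
    moreover have "normalized_error TYPE('a) l n * real ?q powr (real n / 2) =
        real (psi n (replicate l (0::'a))) - real ?q powi (int n - int l)"
      using q by (simp add: normalized_error_def)
    ultimately have "normalized_error TYPE('a) l n * real ?q powr (real n / 2) * real ?q ^ l =
       real (?q ^ l * psi n (replicate l (0::'a))) - real (?q ^ n)"
      by (simp add: left_diff_distrib)
    then show "of_real (normalized_error TYPE('a) l n * real ?q powr (real n / 2) * real ?q ^ l) =
       - (\<Sum>g\<in>#B. g ^ n)"
      unfolding 1[symmetric] by (simp only: of_real_diff of_real_of_nat_eq)
  qed
qed

lemma period_imp_L_roots:
  fixes \<chi> :: "'a::{finite,field} poly \<Rightarrow> complex"
  assumes per: "is_period (normalized_error TYPE('a) l) N"
    and \<chi>: "unit_char l \<chi>" "\<chi> \<noteq> principal_char"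
  shows "\<exists>A. L_roots l \<chi> A \<and> (\<forall>g\<in>#A. g ^ (2 * N) = of_nat (CARD('a) ^ N))"
proof -
  obtain A :: "('a poly \<Rightarrow> complex) \<Rightarrow> complex multiset" and B where
    A: "\<And>\<chi>. unit_char l \<chi> \<Longrightarrow> \<chi> \<noteq> principal_char \<Longrightarrow> L_roots l \<chi> (A \<chi>)" and
    B: "\<And>g. g \<in># B \<longleftrightarrow> (\<exists>\<chi>. unit_char l \<chi> \<and> \<chi> \<noteq> principal_char \<and> g \<in># A \<chi>)" and
    err: "\<And>n. n \<ge> 1 \<Longrightarrow> of_real (normalized_error TYPE('a) l n * real CARD('a) powr (real n / 2)
        * real CARD('a) ^ l) = - (\<Sum>g\<in>#B. g ^ n)"
    by (rule error_power_sum[of l, where 'a = 'a]) blast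
  \<comment> \<open>Doubling the period turns the change of the normalization q ^ (n / 2) into the
    integral power q ^ N.\<close>
  have per2: "normalized_error TYPE('a) l (n + 2 * N) = normalized_error TYPE('a) l n" if "n \<ge> 1" for n
    using per that unfolding is_period_def by (metis add.assoc mult_2 trans_le_add1)
  have "(\<Sum>g\<in>#B. g ^ (n + 2 * N)) = of_nat (CARD('a) ^ N) * (\<Sum>g\<in>#B. g ^ n)" if n: "n \<ge> 1" for n
  proof -
    have "real CARD('a) powr (real (n + 2 * N) / 2) = real CARD('a) powr (real n / 2) * real CARD('a) ^ N"
      by (simp add: add_divide_distrib powr_add powr_realpow)
    then have "- (\<Sum>g\<in>#B. g ^ (n + 2 * N)) = of_nat (CARD('a) ^ N) * - (\<Sum>g\<in>#B. g ^ n)"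
      using n by (simp add: err[symmetric] per2[OF n])
    then show ?thesis by simp
  qed
  moreover have "0 \<notin># B" using A B by (auto simp: L_roots_def)
  ultimately have "g ^ (2 * N) = of_nat (CARD('a) ^ N)" if "g \<in># B" for g
    using that by (intro power_sum_periodic_imp[of B])
  then show ?thesis using A[OF \<chi>] B \<chi> by (intro exI[of _ "A \<chi>"]) blast
qed

lemma period_if_L_roots:
  assumes N: "N \<ge> 1"
    and roots: "\<And>\<chi> g. unit_char l \<chi> \<Longrightarrow> \<chi> \<noteq> principal_char \<Longrightarrow> g \<noteq> 0 \<Longrightarrow>
      (\<Sum>j<l. L_coeff (\<chi> :: 'a::{finite,field} poly \<Rightarrow> complex) j * g ^ (l - 1 - j)) = 0 \<Longrightarrow>
      g ^ N = of_real (real CARD('a) powr (real N / 2))"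
  shows "is_period (normalized_error TYPE('a) l) N"
proof -
  obtain A :: "('a poly \<Rightarrow> complex) \<Rightarrow> complex multiset" and B where
    A: "\<And>\<chi>. unit_char l \<chi> \<Longrightarrow> \<chi> \<noteq> principal_char \<Longrightarrow> L_roots l \<chi> (A \<chi>)" and
    B: "\<And>g. g \<in># B \<longleftrightarrow> (\<exists>\<chi>. unit_char l \<chi> \<and> \<chi> \<noteq> principal_char \<and> g \<in># A \<chi>)" and
    err: "\<And>n. n \<ge> 1 \<Longrightarrow> of_real (normalized_error TYPE('a) l n * real CARD('a) powr (real n / 2)
        * real CARD('a) ^ l) = - (\<Sum>g\<in>#B. g ^ n)"
    by (rule error_power_sum[of l, where 'a = 'a]) blast
  have g: "g ^ N = of_real (real CARD('a) powr (real N / 2))" if gB: "g \<in># B" for g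
  proof -
    obtain \<chi> where \<chi>: "unit_char l \<chi>" "\<chi> \<noteq> principal_char" "g \<in># A \<chi>" using gB B by blast
    have "L_roots l \<chi> (A \<chi>)" by (rule A[OF \<chi>(1,2)])
    then have "g \<noteq> 0" "(\<Sum>j<l. L_coeff \<chi> j * g ^ (l - 1 - j)) = 0"
      using \<chi>(3) unfolding L_roots_def by metis+
    then show ?thesis by (rule roots[OF \<chi>(1,2)])
  qed
  show ?thesis unfolding is_period_def
  proof (intro conjI N allI impI)
    fix n :: nat assume n: "n \<ge> 1"
    let ?e = "normalized_error TYPE('a) l" and ?q = "real CARD('a)"
    have "(\<Sum>g\<in>#B. g ^ (n + N)) = (\<Sum>g\<in>#B. of_real (?q powr (real N / 2)) * g ^ n)"
      by (rule arg_cong[of _ _ sum_mset], rule image_mset_cong) (simp add: power_add g)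
    then have "complex_of_real (?e (n + N) * ?q powr (real (n + N) / 2) * ?q ^ l) =
        of_real (?q powr (real N / 2)) * of_real (?e n * ?q powr (real n / 2) * ?q ^ l)"
      using n by (simp only: err trans_le_add1 sum_mset_distrib_left mult_minus_right)
    then have "?e (n + N) * ?q powr (real (n + N) / 2) * ?q ^ l =
        ?q powr (real N / 2) * (?e n * ?q powr (real n / 2) * ?q ^ l)"
      by (simp only: of_real_mult [symmetric] of_real_eq_iff)
    then show "?e (n + N) = ?e n"
      by (simp add: add_divide_distrib powr_add)
  qed
qed

lemma least_period_dvd:
  assumes "is_period f N"
  shows "least_period f dvd N"
proof -
  let ?L = "least_period f"
  have L: "is_period f ?L" unfolding least_period_def by (rule LeastI) fact
  have Lmin: "?L \<le> M" if "is_period f M" for M unfolding least_period_def by (rule Least_le) fact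
  have mult: "f (n + k * ?L) = f n" if "n \<ge> 1" for n k
  proof (induction k)
    case (Suc k)
    have "f (n + Suc k * ?L) = f ((n + k * ?L) + ?L)" by (simp add: algebra_simps)
    also have "\<dots> = f (n + k * ?L)" using L that by (simp add: is_period_def)
    finally show ?case using Suc by simp
  qed simp
  have "is_period f (N mod ?L)" if "N mod ?L \<noteq> 0"
    unfolding is_period_def
  proof (intro conjI allI impI)
    fix n :: nat assume n: "n \<ge> 1"
    have "f (n + N mod ?L) = f (n + N mod ?L + (N div ?L) * ?L)"
      by (rule mult[symmetric]) (use n in simp)
    also have "n + N mod ?L + (N div ?L) * ?L = n + N" by (simp only: add.assoc mod_div_mult_eq)
    finally show "f (n + N mod ?L) = f n" using assms n by (simp add: is_period_def)
  qed (use that in auto)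
  moreover have "N mod ?L < ?L" using L by (simp add: is_period_def)
  ultimately show ?thesis using Lmin by (metis dvd_eq_mod_eq_0 not_le)
qed

subsection \<open>Additive characters of finite fields\<close>

lemma prime_CHAR_finite_field: "prime CHAR('a::{finite,field})"
  by (intro prime_CHAR_semidom finite_imp_CHAR_pos) simp

lemma of_nat_CARD_eq_0: "of_nat CARD('a::{finite,field}) = (0::'a)"
proof -
  have "bij (\<lambda>x::'a. x + 1)"
    by (rule o_bij[of "\<lambda>x. x - 1"]) auto
  then have "(\<Sum>x\<in>UNIV. x + 1 :: 'a) = (\<Sum>x\<in>UNIV. x)"
    by (rule sum.reindex_bij_betw)
  then show ?thesis by (simp add: sum.distrib)
qed

lemma CHAR_eq_of_CARD:
  assumes "CARD('a::{finite,field}) = p ^ r" "prime p"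
  shows "CHAR('a::{finite,field}) = p"
proof -
  have "CHAR('a) dvd p ^ r"
    using of_nat_CARD_eq_0[where 'a = 'a] assms by (metis of_nat_eq_0_iff_char_dvd)
  then have "CHAR('a) dvd p" using prime_CHAR_finite_field prime_dvd_power by blast
  then show ?thesis using assms(2) prime_CHAR_finite_field[where 'a = 'a] primes_dvd_imp_eq by blast
qed

lemma power_CARD_eq_same:
  fixes x :: "'a::{finite,field}"
  shows "x ^ CARD('a) = x"
proof (cases "x = 0")
  case False
  have "bij_betw (\<lambda>y. x * y) (UNIV - {0}) (UNIV - {0})"
    by (rule bij_betw_byWitness[where f' = "\<lambda>y. y / x"]) (use False in auto)
  then have "(\<Prod>y\<in>UNIV - {0}. x * y) = (\<Prod>y\<in>UNIV - {0}. y)"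
    by (rule prod.reindex_bij_betw)
  then have "x ^ (CARD('a) - 1) = 1" by (simp add: prod.distrib card_Diff_singleton)
  then show ?thesis using power_Suc[of x "CARD('a) - 1"] by simp
qed simp

lemma card_additive_subgroup_dvd:
  fixes R :: "'a::{finite,field} set"
  assumes "0 \<in> R" "\<And>x y. x \<in> R \<Longrightarrow> y \<in> R \<Longrightarrow> x - y \<in> R"
  shows "card R dvd CARD('a)"
proof -
  let ?r = "{(x, y). x - y \<in> R}"
  have neg: "- x \<in> R" if "x \<in> R" for x using assms(2)[OF assms(1) that] by simp
  have add: "x + y \<in> R" if "x \<in> R" "y \<in> R" for x y using assms(2)[OF that(1) neg[OF that(2)]] by simp
  have "equiv UNIV ?r"
  proof (rule equivI)
    show "sym ?r" using neg by (force intro!: symI)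
    show "trans ?r" using add by (force intro!: transI)
  qed (use assms(1) in \<open>auto simp: refl_on_def\<close>)
  have "card R dvd card Y" if Y: "Y \<in> UNIV // ?r" for Y
  proof -
    obtain x where "Y = {y. x - y \<in> R}" using Y by (auto elim!: quotientE)
    also have "\<dots> = (\<lambda>z. x - z) ` R"
    proof (intro equalityI subsetI)
      fix y assume "y \<in> {y. x - y \<in> R}"
      then show "y \<in> (\<lambda>z. x - z) ` R" by (intro image_eqI[of _ _ "x - y"]) auto
    qed auto
    finally have "card Y = card R" by (simp add: card_image inj_on_def)
    then show ?thesis by simp
  qed
  then show ?thesis using equiv_imp_dvd_card[OF finite \<open>equiv UNIV ?r\<close>, of "card R"] by blast
qed

definition additive_char :: "('a::{finite,field} \<Rightarrow> complex) \<Rightarrow> bool" where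
  "additive_char \<psi> \<longleftrightarrow> \<psi> 0 = 1 \<and> (\<forall>a b. \<psi> (a + b) = \<psi> a * \<psi> b)"

lemma additive_char_0: "additive_char \<psi> \<Longrightarrow> \<psi> 0 = 1"
  and additive_char_add: "additive_char \<psi> \<Longrightarrow> \<psi> (a + b) = \<psi> a * \<psi> b"
  by (auto simp: additive_char_def)

lemma additive_char_nonzero: "additive_char \<psi> \<Longrightarrow> \<psi> a \<noteq> 0"
  using additive_char_add[of \<psi> a "- a"] additive_char_0[of \<psi>] by auto

lemma additive_char_minus: "additive_char \<psi> \<Longrightarrow> \<psi> (- a) = inverse (\<psi> a)"
  using additive_char_add[of \<psi> a "- a"] additive_char_0[of \<psi>] additive_char_nonzero[of \<psi> a]
  by (simp add: field_simps)

lemma additive_char_of_nat_mult: "additive_char \<psi> \<Longrightarrow> \<psi> (of_nat n * a) = \<psi> a ^ n"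
proof (induction n)
  case (Suc n)
  then show ?case
    using additive_char_add[OF Suc.prems, of "of_nat n * a" a] by (simp add: algebra_simps)
qed (simp add: additive_char_0)

lemma additive_char_power_CHAR: "additive_char \<psi> \<Longrightarrow> \<psi> (a::'a::{finite,field}) ^ CHAR('a) = 1"
  using additive_char_of_nat_mult[of \<psi> "CHAR('a)" a] additive_char_0[of \<psi>] by simp

lemma norm_additive_char:
  assumes "additive_char (\<psi> :: 'a::{finite,field} \<Rightarrow> complex)"
  shows "norm (\<psi> a) = 1"
proof (rule power_eq_imp_eq_base)
  show "norm (\<psi> a) ^ CHAR('a) = 1 ^ CHAR('a)"
    using additive_char_power_CHAR[OF assms] by (simp flip: norm_power)
  show "CHAR('a) > 0" using prime_CHAR_finite_field prime_gt_0_nat by blast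
qed auto

lemma unit_norm_cnj: "norm (z::complex) = 1 \<Longrightarrow> cnj z = inverse z"
  using complex_norm_square[of z] by (intro inverse_unique[symmetric]) simp

lemma cnj_additive_char: "additive_char \<psi> \<Longrightarrow> cnj (\<psi> a) = \<psi> (- a)"
  by (simp add: unit_norm_cnj norm_additive_char additive_char_minus)

lemma additive_char_scale: "additive_char \<psi> \<Longrightarrow> additive_char (\<lambda>a. \<psi> (c * a))"
  by (simp add: additive_char_def algebra_simps)

lemma sum_additive_char:
  assumes "additive_char (\<psi> :: 'a::{finite,field} \<Rightarrow> complex)"
  shows "(\<Sum>a\<in>UNIV. \<psi> a) = (if \<forall>a. \<psi> a = 1 then of_nat CARD('a) else 0)"
proof (cases "\<forall>a. \<psi> a = 1")
  case False
  then obtain b where b: "\<psi> b \<noteq> 1" by blast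
  have "bij (\<lambda>a::'a. b + a)" by (rule o_bij[of "\<lambda>a. a - b"]) auto
  then have "(\<Sum>a\<in>UNIV. \<psi> a) = (\<Sum>a\<in>UNIV. \<psi> (b + a))"
    by (rule sum.reindex_bij_betw[symmetric])
  also have "\<dots> = \<psi> b * (\<Sum>a\<in>UNIV. \<psi> a)"
    by (simp add: additive_char_add[OF assms] sum_distrib_left)
  finally show ?thesis using b False by simp
qed simp

lemma sum_additive_char_scale:
  assumes "additive_char (\<psi> :: 'a::{finite,field} \<Rightarrow> complex)" "\<psi> x \<noteq> 1"
  shows "(\<Sum>a\<in>UNIV. \<psi> (c * a)) = (if c = 0 then of_nat CARD('a) else 0)"
proof -
  have "\<exists>a. \<psi> (c * a) \<noteq> 1" if "c \<noteq> 0"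
    using that assms(2) by (intro exI[of _ "x / c"]) simp
  then show ?thesis
    using sum_additive_char[OF additive_char_scale[OF assms(1), of c]] additive_char_0[OF assms(1)]
    by auto
qed

lemma additive_char_scale_trivial:
  assumes "additive_char (\<psi> :: 'a::{finite,field} \<Rightarrow> complex)" "\<psi> x \<noteq> 1" "\<And>a. \<psi> (c * a) = 1"
  shows "c = 0"
proof (rule ccontr)
  assume "c \<noteq> 0"
  then show False using assms(3)[of "x / c"] assms(2) by simp
qed

text \<open>Units modulo T ^ 2 multiply by adding their linear coefficients, so
  \<open>card_unit_chars\<close> bounds the number of additive characters by q; the scalings of
  \<psi> are already q distinct ones.\<close>

lemma additive_char_dual:
  assumes "additive_char (\<psi> :: 'a::{finite,field} \<Rightarrow> complex)" "\<psi> x \<noteq> 1" "additive_char \<phi>"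
  obtains c where "\<And>a. \<phi> a = \<psi> (c * a)"
proof -
  let ?A = "{\<phi> :: 'a \<Rightarrow> complex. additive_char \<phi>}"
  let ?u = "\<lambda>\<phi> f. if coeff f 0 = 1 then \<phi> (coeff f (Suc 0)) else (0::complex)"
  have inj: "inj_on ?u ?A"
  proof (rule inj_onI)
    fix \<phi> \<phi>' :: "'a \<Rightarrow> complex" assume *: "?u \<phi> = ?u \<phi>'"
    show "\<phi> = \<phi>'"
    proof
      fix a show "\<phi> a = \<phi>' a" using fun_cong[OF *, of "[:1, a:]"] by simp
    qed
  qed
  have "?u \<phi> \<in> unit_chars 1" if "additive_char \<phi>" for \<phi>
    unfolding unit_chars_def mem_Collect_eq
    by (rule unit_charI) (auto simp: additive_char_0[OF that] additive_char_add[OF that] coeff_mult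
        tcong_iff add.commute mult.commute)
  then have sub: "?u ` ?A \<subseteq> unit_chars 1" by auto
  have finA: "finite ?A" by (rule finite_imageD[OF finite_subset[OF sub finite_unit_chars] inj])
  have "card ?A \<le> CARD('a)"
    using card_mono[OF finite_unit_chars sub] by (simp add: card_image[OF inj] card_unit_chars)
  moreover have inj2: "inj (\<lambda>c a. \<psi> (c * a))"
  proof (rule injI)
    fix c c' assume *: "(\<lambda>a. \<psi> (c * a)) = (\<lambda>a. \<psi> (c' * a))"
    have "\<psi> ((c - c') * a) = 1" for a
      using fun_cong[OF *, of a] additive_char_add[OF assms(1), of "c * a" "- (c' * a)"]
      by (simp add: additive_char_minus[OF assms(1)] additive_char_nonzero[OF assms(1)] algebra_simps)
    then show "c = c'" using additive_char_scale_trivial[OF assms(1,2), of "c - c'"] by simp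
  qed
  moreover have sub2: "range (\<lambda>c a. \<psi> (c * a)) \<subseteq> ?A" using additive_char_scale[OF assms(1)] by auto
  ultimately have "range (\<lambda>c a. \<psi> (c * a)) = ?A"
    by (intro card_subset_eq finA sub2 antisym) (simp_all add: card_image card_mono[OF finA sub2, simplified card_image[OF inj2]])
  then show ?thesis using assms(3) that by (metis (mono_tags, lifting) imageE mem_Collect_eq)
qed

lemma fixed_by_Frobenius_imp_of_nat:
  fixes x :: "'a::{finite,field}"
  assumes "x ^ CHAR('a) = x"
  obtains k where "x = of_nat k"
proof -
  let ?p = "CHAR('a)"
  have p: "prime ?p" by (rule prime_CHAR_finite_field)
  define f where "f = monom (1::'a) ?p - monom 1 1"
  have p1: "?p > 1" using p prime_gt_1_nat by blast
  then have "coeff f ?p = 1" by (simp add: f_def)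
  then have f0: "f \<noteq> 0" by auto
  have deg: "degree f \<le> ?p" using p1
    by (auto simp: f_def intro!: degree_diff_le degree_monom_le order.trans[OF degree_monom_le])
  have sub: "of_nat ` {..<?p} \<subseteq> {x. poly f x = 0}"
  proof (rule image_subsetI)
    fix n assume "n \<in> {..<?p}"
    have "(of_nat n :: 'a) ^ ?p = of_nat n"
    proof (induction n)
      case (Suc n)
      then show ?case using freshmans_dream[OF p refl, of "1::'a" "of_nat n"] by simp
    qed (use p1 in simp)
    then show "(of_nat n :: 'a) \<in> {x. poly f x = 0}" by (simp add: f_def poly_monom)
  qed
  have "inj_on (of_nat :: nat \<Rightarrow> 'a) {..<?p}"
    by (auto simp: inj_on_def of_nat_eq_iff_cong_CHAR cong_def)
  then have "card (of_nat ` {..<?p} :: 'a set) = ?p" by (simp add: card_image)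
  moreover have "card {x. poly f x = 0} \<le> ?p" using card_poly_roots_bound[OF f0] deg by simp
  ultimately have "of_nat ` {..<?p} = {x. poly f x = 0}"
    using poly_roots_finite[OF f0] by (intro card_seteq sub) auto
  moreover have "poly f x = 0" using assms by (simp add: f_def poly_monom)
  ultimately show ?thesis using that by auto
qed

text \<open>The trace to the prime field composed with a primitive p-th root of unity. Frobenius
  invariance later linearizes p-th powers: \<theta> (c ^ p * a ^ p) = \<theta> (c * a).\<close>

lemma Frobenius_invariant_additive_char:
  assumes r: "CARD('a) = CHAR('a::{finite,field}) ^ r"
  obtains \<psi> :: "'a::{finite,field} \<Rightarrow> complex" and x
  where "additive_char \<psi>" "\<psi> x \<noteq> 1" "\<And>a. \<psi> (a ^ CHAR('a)) = \<psi> a"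
proof -
  let ?p = "CHAR('a)"
  have p: "prime ?p" by (rule prime_CHAR_finite_field)
  have p1: "?p > 1" using p prime_gt_1_nat by blast
  have r0: "r > 0"
    using r card_mono[of UNIV "{0, 1::'a}"] by (cases r) auto
  define T where "T = (\<lambda>a::'a. \<Sum>i<r. a ^ (?p ^ i))"
  have Tadd: "T (a + b) = T a + T b" for a b
    by (simp add: T_def freshmans_dream'[OF p refl] sum.distrib)
  have Tp: "T (a ^ ?p) = T a" for a
  proof -
    have "T (a ^ ?p) = (\<Sum>i<r. a ^ (?p ^ Suc i))" by (simp add: T_def flip: power_mult)
    also have "\<dots> = (\<Sum>i<r. a ^ (?p ^ i)) + a ^ (?p ^ r) - a"
      using sum.lessThan_Suc_shift[of "\<lambda>i. a ^ (?p ^ i)" r] by simp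
    also have "\<dots> = T a" using power_CARD_eq_same[of a] by (simp add: T_def r)
    finally show ?thesis .
  qed
  have "T a ^ ?p = T (a ^ ?p)" for a
    by (simp add: T_def freshmans_dream_sum[OF p refl] mult.commute flip: power_mult)
  then have "\<exists>k. T a = of_nat k" for a
    using fixed_by_Frobenius_imp_of_nat[of "T a"] Tp by metis
  then obtain k where k: "\<And>a. T a = of_nat (k a)" by metis
  define \<omega> where "\<omega> = cis (2 * pi / ?p)"
  have \<omega>p: "\<omega> ^ ?p = 1" unfolding \<omega>_def using p1 by (intro cis_root_of_unity_power) simp
  have \<omega>_cong: "\<omega> ^ m = \<omega> ^ n" if "(of_nat m :: 'a) = of_nat n" for m n
  proof -
    have red: "\<omega> ^ m = \<omega> ^ (m mod ?p)" for m
      by (metis \<omega>p div_mult_mod_eq mult.commute mult_1 power_add power_mult power_one)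
    have "m mod ?p = n mod ?p" using that by (simp add: of_nat_eq_iff_cong_CHAR cong_def)
    then show ?thesis using red[of m] red[of n] by simp
  qed
  have \<omega>1: "\<omega> ^ m \<noteq> 1" if "\<not> ?p dvd m" for m
  proof -
    have "\<omega> ^ m = \<omega> ^ (m mod ?p)" by (rule \<omega>_cong) (simp add: of_nat_eq_iff_cong_CHAR cong_def)
    also have "\<dots> = cis (2 * pi * real (m mod ?p) / real ?p)" by (simp add: \<omega>_def DeMoivre mult_ac)
    also have "\<dots> \<noteq> cis (2 * pi * real 0 / real ?p)"
    proof -
      have "inj_on (\<lambda>k. cis (2 * pi * real k / real ?p)) {..<?p}"
        using bij_betw_roots_unity[of ?p] p1 by (simp add: bij_betw_def)
      moreover have "m mod ?p \<in> {..<?p}" "0 \<in> {..<?p}" "m mod ?p \<noteq> 0"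
        using that p1 by (simp_all add: dvd_eq_mod_eq_0)
      ultimately show ?thesis using inj_onD by metis
    qed
    finally show ?thesis by simp
  qed
  define \<psi> where "\<psi> = (\<lambda>a. \<omega> ^ k a)"
  have T0: "T 0 = 0" using Tadd[of 0 0] add_cancel_left_left[of "T 0" "T 0"] by (simp only: add_0_left) simp
  have "additive_char \<psi>"
    unfolding additive_char_def \<psi>_def
  proof (intro conjI allI)
    show "\<omega> ^ k 0 = 1" using \<omega>_cong[of "k 0" 0] k[of 0] T0 by simp
    fix a b
    have "\<omega> ^ k (a + b) = \<omega> ^ (k a + k b)" by (rule \<omega>_cong) (simp add: k[symmetric] Tadd)
    then show "\<omega> ^ k (a + b) = \<omega> ^ k a * \<omega> ^ k b" by (simp add: power_add)
  qed
  moreover have "\<psi> (a ^ ?p) = \<psi> a" for a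
    unfolding \<psi>_def by (rule \<omega>_cong) (simp add: k[symmetric] Tp)
  moreover have "\<exists>x. \<psi> x \<noteq> 1"
  proof -
    \<comment> \<open>The trace is given by a polynomial of degree p ^ (r - 1) < q, so it has a
      nonzero value.\<close>
    define f where "f = (\<Sum>i<r. monom (1::'a) (?p ^ i))"
    have "coeff f (?p ^ (r - 1)) = (\<Sum>i<r. if i = r - 1 then 1 else 0)"
      using p1 by (auto simp: f_def coeff_sum power_inject_exp intro!: sum.cong)
    then have f0: "f \<noteq> 0" using r0 by auto
    have "degree f \<le> ?p ^ (r - 1)" unfolding f_def
      by (rule degree_sum_le) (use p1 in \<open>auto simp: degree_monom_eq intro!: power_increasing\<close>)
    also have "\<dots> < ?p ^ r" using p1 r0 by (intro power_strict_increasing) auto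
    finally have "card {x. poly f x = 0} < CARD('a)"
      using card_poly_roots_bound[OF f0] r by simp
    then have "{x. poly f x = 0} \<noteq> UNIV" by auto
    then obtain x where "poly f x \<noteq> 0" by auto
    then have "T x \<noteq> 0" by (simp add: f_def T_def poly_sum poly_monom)
    then have "\<not> ?p dvd k x" using k[of x] by (auto simp: of_nat_eq_0_iff_char_dvd)
    then show ?thesis using \<omega>1 by (auto simp: \<psi>_def)
  qed
  ultimately show ?thesis using that by blast
qed

section \<open>Squares and nonsquares in odd characteristic\<close>

definition nonzero_squares :: "'a::{finite,field} set" where
  "nonzero_squares = (\<lambda>x. x ^ 2) ` (UNIV - {0})"

lemma sum_over_squares:
  fixes h :: "'a::{finite,field} \<Rightarrow> 'b::comm_ring_1"
  assumes "(2::'a) \<noteq> 0"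
  shows "(\<Sum>x\<in>UNIV - {0}. h (x ^ 2)) = 2 * (\<Sum>s\<in>nonzero_squares. h s)"
proof -
  have "(\<Sum>x\<in>UNIV - {0}. h (x ^ 2)) =
    (\<Sum>s\<in>nonzero_squares. \<Sum>x\<in>{x \<in> UNIV - {0}. x ^ 2 = s}. h (x ^ 2))"
    unfolding nonzero_squares_def by (rule sum.image_gen) simp
  also have "\<dots> = (\<Sum>s\<in>nonzero_squares. 2 * h s)"
  proof (rule sum.cong[OF refl])
    fix s :: 'a assume "s \<in> nonzero_squares"
    then obtain y where y: "y \<noteq> 0" "s = y ^ 2" by (auto simp: nonzero_squares_def)
    then have "{x \<in> UNIV - {0}. x ^ 2 = s} = {y, - y}" by (auto simp: power2_eq_iff)
    moreover have "y \<noteq> - y" using y assms by (metis add_eq_0_iff mult_2 mult_eq_0_iff)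
    ultimately show "(\<Sum>x\<in>{x \<in> UNIV - {0}. x ^ 2 = s}. h (x ^ 2)) = 2 * h s"
      using y by simp
  qed
  finally show ?thesis by (simp add: sum_distrib_left)
qed

lemma card_nonzero_squares:
  assumes "(2::'a::{finite,field}) \<noteq> 0"
  shows "2 * card (nonzero_squares :: 'a::{finite,field} set) = CARD('a) - 1"
proof -
  have "int (CARD('a) - 1) = 2 * int (card (nonzero_squares :: 'a set))"
    using sum_over_squares[OF assms, of "\<lambda>_. 1 :: int"] by (simp add: card_Diff_singleton)
  then show ?thesis by linarith
qed

text \<open>The nonzero squares and their multiples by a nonsquare partition the nonzero elements.\<close>

lemma sum_squares_nonsquares:
  fixes h :: "'a::{finite,field} \<Rightarrow> 'b::comm_ring_1"
  assumes "(2::'a) \<noteq> 0" "\<And>x. x ^ 2 \<noteq> g"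
  shows "(\<Sum>x\<in>UNIV. h (x ^ 2)) + (\<Sum>x\<in>UNIV. h (g * x ^ 2)) = 2 * (\<Sum>x\<in>UNIV. h x)"
proof -
  let ?S = "nonzero_squares :: 'a set"
  have g0: "g \<noteq> 0" using assms(2)[of 0] by auto
  have inj: "inj_on ((*) g) ?S" using g0 by (auto simp: inj_on_def)
  have "?S \<inter> (*) g ` ?S = {}"
  proof (rule ccontr)
    assume "?S \<inter> (*) g ` ?S \<noteq> {}"
    then obtain x y where "x \<noteq> 0" "y \<noteq> 0" "x ^ 2 = g * y ^ 2" by (auto simp: nonzero_squares_def)
    then have "(x / y) ^ 2 = g" by (simp add: power_divide)
    then show False using assms(2) by blast
  qed
  moreover have "?S \<union> (*) g ` ?S = UNIV - {0}"
  proof (rule card_subset_eq)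
    show "?S \<union> (*) g ` ?S \<subseteq> UNIV - {0}" using g0 by (auto simp: nonzero_squares_def)
    show "card (?S \<union> (*) g ` ?S) = card (UNIV - {0::'a})"
      using card_nonzero_squares[OF assms(1)] calculation
      by (simp add: card_Un_disjoint card_image[OF inj] card_Diff_singleton)
  qed simp
  ultimately have "(\<Sum>x\<in>UNIV - {0}. h x) = (\<Sum>x\<in>?S. h x) + (\<Sum>x\<in>?S. h (g * x))"
  proof -
    assume d: "?S \<inter> (*) g ` ?S = {}" and u: "?S \<union> (*) g ` ?S = UNIV - {0}"
    have "(\<Sum>x\<in>UNIV - {0}. h x) = (\<Sum>x\<in>?S. h x) + (\<Sum>x\<in>(*) g ` ?S. h x)"
      unfolding u[symmetric] by (rule sum.union_disjoint) (use d in auto)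
    then show ?thesis by (simp add: sum.reindex[OF inj])
  qed
  moreover have "(\<Sum>x\<in>UNIV. f x) = f 0 + (\<Sum>x\<in>UNIV - {0}. f x)" for f :: "'a \<Rightarrow> 'b"
    by (rule sum.remove) auto
  ultimately show ?thesis
    using sum_over_squares[OF assms(1), of h] sum_over_squares[OF assms(1), of "\<lambda>x. h (g * x)"]
    by (simp add: algebra_simps)
qed

lemma nonsquare_exists:
  assumes "(2::'a::{finite,field}) \<noteq> 0"
  obtains g :: "'a::{finite,field}" where "\<And>x. x ^ 2 \<noteq> g"
proof -
  have c2: "CARD('a) \<ge> 2" using card_mono[of UNIV "{0, 1::'a}"] by simp
  have "nonzero_squares \<noteq> (UNIV - {0::'a})"
  proof
    assume "nonzero_squares = (UNIV - {0::'a})"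
    then have "card (nonzero_squares :: 'a set) = card (UNIV - {0::'a})" by (rule arg_cong)
    also have "\<dots> = CARD('a) - 1" by (simp add: card_Diff_singleton)
    finally have "card (nonzero_squares :: 'a set) = CARD('a) - 1" .
    then show False using card_nonzero_squares[OF assms] c2 by simp
  qed
  moreover have "nonzero_squares \<subseteq> (UNIV - {0::'a})" by (auto simp: nonzero_squares_def)
  ultimately obtain g :: 'a where g: "g \<noteq> 0" "g \<notin> nonzero_squares" by blast
  have "x ^ 2 \<noteq> g" for x
    using g by (cases "x = 0") (auto simp: nonzero_squares_def)
  then show ?thesis using that by blast
qed

subsection \<open>Characters of level 3\<close>

lemma tcong_3_iff:
  "tcong (Suc (Suc (Suc 0))) f g \<longleftrightarrow> coeff f 0 = coeff g 0 \<and> coeff f (Suc 0) = coeff g (Suc 0) \<and>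
     coeff f (Suc (Suc 0)) = coeff g (Suc (Suc 0)) \<and>
     coeff f (Suc (Suc (Suc 0))) = coeff g (Suc (Suc (Suc 0)))"
  by (auto simp: tcong_iff le_Suc_eq)

text \<open>Every unit modulo T ^ 4 is a product (1 + a T) (1 + b T ^ 2) (1 + c T ^ 3), so \<chi> is
  determined by \<open>F\<close>, \<open>\<phi>\<close> and \<open>\<psi>\<close>. The last two are
  additive characters; \<open>F_add\<close> measures how far \<open>F\<close> is from being one.
  Characters of level 2 are those with trivial \<open>\<psi>\<close>.\<close>

locale level_3_char =
  fixes \<chi> :: "'a::{finite,field} poly \<Rightarrow> complex"
  assumes level_3: "unit_char 3 \<chi>"
begin

definition F where "F a = \<chi> [:1, a:]"
definition \<phi> where "\<phi> b = \<chi> [:1, 0, b:]"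
definition \<psi> where "\<psi> c = \<chi> [:1, 0, 0, c:]"

lemma char_cong: "coeff f 0 = 1 \<Longrightarrow> coeff g 0 = 1 \<Longrightarrow> tcong 3 f g \<Longrightarrow> \<chi> f = \<chi> g"
  by (rule unit_char_cong[OF level_3])

lemma char_mult: "coeff f 0 = 1 \<Longrightarrow> coeff g 0 = 1 \<Longrightarrow> \<chi> (f * g) = \<chi> f * \<chi> g"
  by (rule unit_char_mult[OF level_3])

lemma additive_\<psi>: "additive_char \<psi>"
  unfolding additive_char_def
proof (intro conjI allI)
  show "\<psi> 0 = 1" using unit_char_1[OF level_3] by (simp add: \<psi>_def one_pCons)
  fix a b
  have "\<chi> [:1, 0, 0, a + b:] = \<chi> ([:1, 0, 0, a:] * [:1, 0, 0, b:])"
    by (rule char_cong) (auto simp: tcong_3_iff numeral_eq_Suc)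
  then show "\<psi> (a + b) = \<psi> a * \<psi> b" by (simp add: \<psi>_def char_mult del: mult_pCons_left mult_pCons_right)
qed

lemma additive_\<phi>: "additive_char \<phi>"
  unfolding additive_char_def
proof (intro conjI allI)
  show "\<phi> 0 = 1" using unit_char_1[OF level_3] by (simp add: \<phi>_def one_pCons)
  fix a b
  have "\<chi> [:1, 0, a + b:] = \<chi> ([:1, 0, a:] * [:1, 0, b:])"
    by (rule char_cong) (auto simp: tcong_3_iff numeral_eq_Suc)
  then show "\<phi> (a + b) = \<phi> a * \<phi> b" by (simp add: \<phi>_def char_mult del: mult_pCons_left mult_pCons_right)
qed

lemma F_add: "F a * F b = F (a + b) * \<phi> (a * b) * \<psi> (- (a * b * (a + b)))"
proof -
  have "\<chi> ([:1, a:] * [:1, b:]) =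
      \<chi> ([:1, a + b:] * [:1, 0, a * b:] * [:1, 0, 0, - (a * b * (a + b)):])"
    by (rule char_cong) (auto simp: tcong_3_iff numeral_eq_Suc algebra_simps)
  then show ?thesis
    by (simp add: F_def \<phi>_def \<psi>_def char_mult coeff_mult_0 del: mult_pCons_left mult_pCons_right)
qed

lemma char_quadratic: "\<chi> [:1, a, b:] = F a * (\<phi> b * \<psi> (- (a * b)))"
proof -
  have "\<chi> [:1, a, b:] = \<chi> ([:1, a:] * ([:1, 0, b:] * [:1, 0, 0, - (a * b):]))"
    by (rule char_cong) (auto simp: tcong_3_iff numeral_eq_Suc algebra_simps)
  then show ?thesis
    by (simp add: F_def \<phi>_def \<psi>_def char_mult coeff_mult_0 del: mult_pCons_left mult_pCons_right)
qed

lemma F_0: "F 0 = 1"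
  using unit_char_1[OF level_3] by (simp add: F_def one_pCons)

lemma norm_F: "norm (F a) = 1"
  by (simp add: F_def norm_unit_char[OF level_3])

lemma F_nonzero: "F a \<noteq> 0"
  using norm_F[of a] by auto

lemma cnj_F: "cnj (F a) = inverse (F a)"
  by (simp add: unit_norm_cnj norm_F)

definition S where "S = (\<Sum>a\<in>UNIV. F a)"

lemma L_coeff_1_eq: "L_coeff \<chi> 1 = S"
  by (simp only: L_coeff_1 S_def F_def)

lemma unit_char_2: assumes "\<And>c. \<psi> c = 1" shows "unit_char 2 \<chi>"
proof (rule unit_charI)
  fix f g :: "'a poly" assume fg: "coeff f 0 = 1" "coeff g 0 = 1" and c: "tcong 2 f g"
  have eq: "coeff f 1 = coeff g 1" "coeff f 2 = coeff g 2" using c by (auto simp: tcong_iff)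
  have "\<chi> f = \<chi> (g * [:1, 0, 0, coeff f 3 - coeff g 3:])"
  proof (rule char_cong)
    show "tcong 3 f (g * [:1, 0, 0, coeff f 3 - coeff g 3:])"
      using fg eq by (simp add: tcong_3_iff coeff_mult numeral_eq_Suc)
  qed (use fg in \<open>auto simp: coeff_mult_0\<close>)
  then show "\<chi> f = \<chi> g" using assms fg by (simp add: char_mult \<psi>_def del: mult_pCons_left mult_pCons_right)
qed (fact unit_char_1[OF level_3] unit_char_mult[OF level_3] unit_char_0[OF level_3])+

lemma sum_F_eq_0_if_level_1:
  assumes "\<And>c. \<psi> c = 1" "\<And>b. \<phi> b = 1" "\<chi> \<noteq> principal_char"
  shows "S = 0"
proof -
  have "unit_char 1 \<chi>"
  proof (rule unit_charI)
    fix f g :: "'a poly" assume fg: "coeff f 0 = 1" "coeff g 0 = 1" and c: "tcong 1 f g"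
    have eq: "coeff f 1 = coeff g 1" using c by (auto simp: tcong_iff)
    have "\<chi> f = \<chi> (g * [:1, 0, coeff f 2 - coeff g 2:])"
      by (rule unit_char_cong[OF unit_char_2[OF assms(1)]])
         (use fg eq in \<open>auto simp: tcong_iff le_Suc_eq coeff_mult numeral_eq_Suc\<close>)
    then show "\<chi> f = \<chi> g" using assms fg by (simp add: char_mult \<phi>_def del: mult_pCons_left mult_pCons_right)
  qed (fact unit_char_1[OF level_3] unit_char_mult[OF level_3] unit_char_0[OF level_3])+
  then show ?thesis using L_coeff_eq_0[of 1 \<chi> 1] assms(3) unfolding L_coeff_1_eq by simp
qed

text \<open>Weyl differencing: the inner sum over a involves only the defect of additivity of
  \<open>F\<close>.\<close>

lemma cmod_S_squared:
  "S * cnj S = (\<Sum>h\<in>UNIV. F h * (\<Sum>a\<in>UNIV. inverse (\<phi> (a * h) * \<psi> (- (a * h * (a + h))))))"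
proof -
  have "S * cnj S = (\<Sum>a\<in>UNIV. \<Sum>x\<in>UNIV. F x * inverse (F a))"
    by (simp add: S_def sum_distrib_left sum_distrib_right cnj_F)
  also have "\<dots> = (\<Sum>a\<in>UNIV. \<Sum>h\<in>UNIV. F (a + h) * inverse (F a))"
  proof (rule sum.cong[OF refl])
    fix a :: 'a
    have "bij (\<lambda>h. a + h)" by (rule o_bij[of "\<lambda>h. h - a"]) auto
    then show "(\<Sum>x\<in>UNIV. F x * inverse (F a)) = (\<Sum>h\<in>UNIV. F (a + h) * inverse (F a))"
      by (rule sum.reindex_bij_betw[symmetric])
  qed
  also have "\<dots> = (\<Sum>a\<in>UNIV. \<Sum>h\<in>UNIV. F h * inverse (\<phi> (a * h) * \<psi> (- (a * h * (a + h)))))"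
  proof (intro sum.cong refl)
    fix a h
    show "F (a + h) * inverse (F a) = F h * inverse (\<phi> (a * h) * \<psi> (- (a * h * (a + h))))"
      using F_add[of a h] F_nonzero[of a] additive_char_nonzero[OF additive_\<phi>, of "a * h"]
        additive_char_nonzero[OF additive_\<psi>, of "- (a * h * (a + h))"]
      by (simp add: field_simps)
  qed
  also have "\<dots> = (\<Sum>h\<in>UNIV. F h * (\<Sum>a\<in>UNIV. inverse (\<phi> (a * h) * \<psi> (- (a * h * (a + h))))))"
    by (subst sum.swap) (simp add: sum_distrib_left)
  finally show ?thesis .
qed

text \<open>Summation over b leaves only a = a0. So the product of the two reciprocal roots is q
  times a root of unity, and what remains to be found is the linear coefficient
  \<open>S\<close>.\<close>

lemma L_coeff_2_eq:
  assumes "\<psi> x \<noteq> 1" "\<And>b. \<phi> b = \<psi> (a0 * b)"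
  shows "L_coeff \<chi> 2 = of_nat CARD('a) * F a0"
proof -
  have "L_coeff \<chi> 2 = (\<Sum>a\<in>UNIV. F a * (\<Sum>b\<in>UNIV. \<psi> ((a0 - a) * b)))"
    by (simp add: L_coeff_2 char_quadratic sum_distrib_left assms(2) left_diff_distrib
        flip: additive_char_add[OF additive_\<psi>])
  also have "\<dots> = (\<Sum>a\<in>UNIV. if a = a0 then F a * of_nat CARD('a) else 0)"
    by (rule sum.cong) (auto simp: sum_additive_char_scale[OF additive_\<psi> assms(1)])
  finally show ?thesis by simp
qed

end

subsection \<open>Quadratic Gauss sums\<close>

lemma gauss_sum_scale:
  assumes "additive_char (\<psi> :: 'a::{finite,field} \<Rightarrow> complex)" "\<psi> x \<noteq> 1" "(2::'a) \<noteq> 0"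
    and "\<And>x. x ^ 2 \<noteq> g" "c \<noteq> 0"
  shows "(\<Sum>x\<in>UNIV. \<psi> (c * (g * x ^ 2))) = - (\<Sum>x\<in>UNIV. \<psi> (c * x ^ 2))"
  using sum_squares_nonsquares[OF assms(3,4), of "\<lambda>y. \<psi> (c * y)"]
    sum_additive_char_scale[OF assms(1,2), of c] assms(5)
  by (simp add: add_eq_0_iff)

lemma sum_scale_square:
  fixes h :: "'a::{finite,field} \<Rightarrow> complex"
  assumes "d \<noteq> 0"
  shows "(\<Sum>x\<in>UNIV. h (d ^ 2 * x ^ 2)) = (\<Sum>x\<in>UNIV. h (x ^ 2))"
proof -
  have "bij (\<lambda>x. d * x)" by (rule o_bij[of "\<lambda>x. x / d"]) (use assms in auto)
  then have "(\<Sum>x\<in>UNIV. h ((d * x) ^ 2)) = (\<Sum>x\<in>UNIV. h (x ^ 2))"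
    by (rule sum.reindex_bij_betw)
  then show ?thesis by (simp add: power_mult_distrib)
qed

lemma gauss_sum_squared:
  assumes \<psi>: "additive_char (\<psi> :: 'a::{finite,field} \<Rightarrow> complex)" "\<psi> x \<noteq> 1"
    and two: "(2::'a) \<noteq> 0" and c: "c \<noteq> 0"
  defines "G \<equiv> (\<Sum>x\<in>UNIV. \<psi> (c * x ^ 2))"
  shows "G * cnj G = of_nat CARD('a)" "cnj G = G \<or> cnj G = - G"
proof -
  have cnjG: "cnj G = (\<Sum>x\<in>UNIV. \<psi> (c * (- 1 * x ^ 2)))"
    by (simp add: G_def cnj_additive_char[OF \<psi>(1)])
  show "cnj G = G \<or> cnj G = - G"
  proof (cases "\<exists>d::'a. d ^ 2 = - 1")
    case True
    then obtain d :: 'a where d: "d ^ 2 = - 1" by blast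
    then have "d \<noteq> 0" by auto
    then show ?thesis
      using sum_scale_square[of d "\<lambda>y. \<psi> (c * y)"] unfolding cnjG d by (simp add: G_def)
  next
    case False
    then show ?thesis
      using gauss_sum_scale[OF \<psi> two _ c, of "- 1"] unfolding cnjG by (auto simp: G_def)
  qed
  have "G * cnj G = (\<Sum>b\<in>UNIV. \<Sum>a\<in>UNIV. \<psi> (c * a ^ 2) * \<psi> (- (c * b ^ 2)))"
    by (simp add: G_def sum_distrib_left sum_distrib_right cnj_additive_char[OF \<psi>(1)])
  also have "\<dots> = (\<Sum>b\<in>UNIV. \<Sum>h\<in>UNIV. \<psi> (c * (b + h) ^ 2) * \<psi> (- (c * b ^ 2)))"
  proof (rule sum.cong[OF refl])
    fix b :: 'a
    have "bij (\<lambda>h. b + h)" by (rule o_bij[of "\<lambda>h. h - b"]) auto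
    then show "(\<Sum>a\<in>UNIV. \<psi> (c * a ^ 2) * \<psi> (- (c * b ^ 2))) =
        (\<Sum>h\<in>UNIV. \<psi> (c * (b + h) ^ 2) * \<psi> (- (c * b ^ 2)))"
      by (rule sum.reindex_bij_betw[symmetric])
  qed
  also have "\<dots> = (\<Sum>b\<in>UNIV. \<Sum>h\<in>UNIV. \<psi> (c * h ^ 2) * \<psi> (2 * c * h * b))"
  proof (intro sum.cong refl)
    fix b h :: 'a
    have "c * (b + h) ^ 2 + - (c * b ^ 2) = c * h ^ 2 + 2 * c * h * b"
      by (simp add: power2_eq_square algebra_simps)
    then show "\<psi> (c * (b + h) ^ 2) * \<psi> (- (c * b ^ 2)) = \<psi> (c * h ^ 2) * \<psi> (2 * c * h * b)"
      by (simp only: additive_char_add[OF \<psi>(1), symmetric])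
  qed
  also have "\<dots> = (\<Sum>h\<in>UNIV. \<psi> (c * h ^ 2) * (\<Sum>b\<in>UNIV. \<psi> (2 * c * h * b)))"
    by (subst sum.swap) (simp add: sum_distrib_left)
  also have "\<dots> = (\<Sum>h\<in>(UNIV :: 'a set). if h = 0 then of_nat CARD('a) else 0)"
    using two c by (intro sum.cong) (auto simp: sum_additive_char_scale[OF \<psi>] additive_char_0[OF \<psi>(1)])
  finally show "G * cnj G = of_nat CARD('a)" by simp
qed

text \<open>The defect a b of additivity is the polarization of a ^ 2 / 2, so this factor removes
  it. \<open>F_eq_cubic\<close> does the same for the cubic part with a ^ 3 / 3.\<close>

lemma (in level_3_char) F_eq_odd:
  assumes two: "(2::'a) \<noteq> 0" and \<psi>1: "\<And>c. \<psi> c = 1"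
  shows "additive_char (\<lambda>a. F a * \<phi> (a ^ 2 / 2))"
  unfolding additive_char_def
proof (intro conjI allI)
  show "F 0 * \<phi> (0\<^sup>2 / 2) = 1" by (simp add: F_0 additive_char_0[OF additive_\<phi>])
  fix a b :: 'a
  have "(a + b) ^ 2 / 2 = a * b + (a ^ 2 / 2 + b ^ 2 / 2)"
    using two by (simp add: power2_eq_square field_simps)
  then have "\<phi> ((a + b) ^ 2 / 2) = \<phi> (a * b) * (\<phi> (a ^ 2 / 2) * \<phi> (b ^ 2 / 2))"
    by (simp only: additive_char_add[OF additive_\<phi>])
  moreover have "F a * F b = F (a + b) * \<phi> (a * b)" using F_add[of a b] \<psi>1 by simp
  ultimately show "F (a + b) * \<phi> ((a + b)\<^sup>2 / 2) = F a * \<phi> (a\<^sup>2 / 2) * (F b * \<phi> (b\<^sup>2 / 2))"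
    by (simp add: mult_ac)
qed

text \<open>Completing the square at m gives S = \<phi> (m ^ 2 / 2) G with a Gauss sum G. As G ^ 2
  is q or - q, the exponent 4 suffices for G, and p for the value of \<phi>.\<close>

lemma (in level_3_char) sum_F_level_2_odd:
  assumes two: "(2::'a) \<noteq> 0" and \<psi>1: "\<And>c. \<psi> c = 1" and \<phi>x: "\<phi> x \<noteq> 1"
  shows "S ^ (4 * CHAR('a)) = of_nat CARD('a) ^ (2 * CHAR('a))"
proof -
  obtain m where m: "\<And>a. F a * \<phi> (a ^ 2 / 2) = \<phi> (m * a)"
    by (rule additive_char_dual[OF additive_\<phi> \<phi>x F_eq_odd[OF two \<psi>1]]) blast
  have F: "F (m + a) = \<phi> (m ^ 2 / 2) * \<phi> (- 1 / 2 * a ^ 2)" for a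
  proof -
    have "F (m + a) = \<phi> (m * (m + a)) * \<phi> (- ((m + a) ^ 2 / 2))"
      using m[of "m + a"] additive_char_nonzero[OF additive_\<phi>]
      by (simp add: additive_char_minus[OF additive_\<phi>] field_simps)
    also have "\<dots> = \<phi> (m ^ 2 / 2 + (- 1 / 2 * a ^ 2))"
      unfolding additive_char_add[OF additive_\<phi>, symmetric]
      by (rule arg_cong[where f = \<phi>]) (use two in \<open>simp add: power2_eq_square field_simps\<close>)
    finally show ?thesis by (simp only: additive_char_add[OF additive_\<phi>])
  qed
  define G where "G = (\<Sum>a\<in>UNIV. \<phi> (- 1 / 2 * a ^ 2))"
  have "bij (\<lambda>h. m + h)" by (rule o_bij[of "\<lambda>h. h - m"]) auto
  then have "S = (\<Sum>a\<in>UNIV. F (m + a))"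
    unfolding S_def by (rule sum.reindex_bij_betw[symmetric])
  also have "\<dots> = \<phi> (m ^ 2 / 2) * G" by (simp add: F G_def sum_distrib_left)
  finally have S: "S = \<phi> (m ^ 2 / 2) * G" .
  have "G * cnj G = of_nat CARD('a)" "cnj G = G \<or> cnj G = - G"
    unfolding G_def by (rule gauss_sum_squared[OF additive_\<phi> \<phi>x two]; use two in simp)+
  then have "G ^ 2 = of_nat CARD('a) \<or> G ^ 2 = - of_nat CARD('a)"
    by (metis minus_minus mult_minus_right power2_eq_square)
  then have "(G ^ 2) ^ (2 * CHAR('a)) = of_nat CARD('a) ^ (2 * CHAR('a))"
    by (elim disjE) (simp_all only: power_mult power2_minus)
  moreover have "(\<phi> (m ^ 2 / 2) ^ CHAR('a)) ^ 4 = 1"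
    using additive_char_power_CHAR[OF additive_\<phi>] by simp
  ultimately show ?thesis
    by (simp add: S power_mult_distrib mult.commute flip: power_mult)
qed

subsection \<open>Characteristic 2\<close>

text \<open>In characteristic 2, \<open>F (a + b) = F b * cnj (F a)\<close> for a suitable \<open>b\<close>, hence
  \<open>S = F b * cnj S\<close>.\<close>

lemma (in level_3_char) F_squared_char_2:
  assumes two: "(2::'a) = 0"
  shows "F a ^ 2 = \<phi> (a ^ 2)" "F a ^ 4 = 1"
proof -
  have aa: "a + a = 0" for a :: 'a using two by (metis mult_2 mult_zero_left)
  show 1: "F a ^ 2 = \<phi> (a ^ 2)"
    using F_add[of a a] by (simp add: aa F_0 additive_char_0[OF additive_\<psi>] power2_eq_square)
  have "F a ^ 4 = \<phi> (a ^ 2) * \<phi> (a ^ 2)" unfolding 1[symmetric] by (simp flip: power_add)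
  also have "\<dots> = 1"
    unfolding additive_char_add[OF additive_\<phi>, symmetric] aa by (rule additive_char_0[OF additive_\<phi>])
  finally show "F a ^ 4 = 1" .
qed

lemma char_2_self_inverse:
  assumes "(2::'a::{finite,field}) = 0" "additive_char (\<psi> :: 'a \<Rightarrow> complex)"
  shows "inverse (\<psi> a) = \<psi> a"
proof -
  have "a + a = 0" using assms(1) by (metis mult_2 mult_zero_left)
  then have "- a = a" by (rule minus_unique)
  with additive_char_minus[OF assms(2), of a] show ?thesis by (simp only:)
qed

lemma (in level_3_char) S_eq_cnj_char_2:
  assumes two: "(2::'a) = 0"
    and b: "\<And>a. \<phi> (a * b) * \<psi> (- (a * b * (a + b))) = \<phi> (a ^ 2)"
  shows "S = F b * cnj S"
proof -
  have "F (a + b) = F b * cnj (F a)" for a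
  proof -
    have "F a * F b = F (a + b) * F a ^ 2"
      using F_add[of a b] b[of a] F_squared_char_2(1)[OF two, of a] by (simp add: mult.assoc)
    then show ?thesis using F_nonzero[of a] by (simp add: cnj_F power2_eq_square field_simps)
  qed
  moreover have "bij (\<lambda>a. a + b)" by (rule o_bij[of "\<lambda>h. h - b"]) auto
  then have "S = (\<Sum>a\<in>UNIV. F (a + b))"
    unfolding S_def by (rule sum.reindex_bij_betw[symmetric])
  ultimately have "S = (\<Sum>a\<in>UNIV. F b * cnj (F a))" by simp
  also have "\<dots> = F b * cnj S" by (simp add: S_def sum_distrib_left)
  finally show ?thesis .
qed

lemma (in level_3_char) sum_F_level_2_even:
  assumes r: "CARD('a) = CHAR('a) ^ r" and two: "CHAR('a) = 2"
    and \<psi>1: "\<And>c. \<psi> c = 1" and \<phi>x: "\<phi> x \<noteq> 1"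
  shows "S ^ 8 = of_nat CARD('a) ^ 4"
proof -
  have t: "(2::'a) = 0" using of_nat_CHAR[where 'a = 'a] two by simp
  obtain \<theta> y where \<theta>: "additive_char \<theta>" "\<theta> y \<noteq> 1" "\<And>a. \<theta> (a ^ CHAR('a)) = \<theta> (a::'a)"
    using Frobenius_invariant_additive_char[OF r] by blast
  obtain l where l: "\<And>a. \<phi> a = \<theta> (l * a)"
    by (rule additive_char_dual[OF \<theta>(1,2) additive_\<phi>]) blast
  have l0: "l \<noteq> 0" using \<phi>x l[of x] additive_char_0[OF \<theta>(1)] by auto
  \<comment> \<open>A square root of \<open>l\<close>, since squaring is inverted by the power 2 ^
    (r - 1). It makes a \<mapsto> \<phi> (a ^ 2) a linear character, which provides the shift
    required by \<open>S_eq_cnj_char_2\<close>.\<close>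
  define s where "s = l ^ (2 ^ (r - 1))"
  have r0: "r > 0" using r card_mono[of UNIV "{0, 1::'a}"] by (cases r) auto
  have s2: "s ^ 2 = l"
  proof -
    have "s ^ 2 = l ^ (2 ^ Suc (r - 1))" by (simp add: s_def mult.commute flip: power_mult)
    then show ?thesis using r0 r two power_CARD_eq_same[of l] by simp
  qed
  have "\<phi> (a ^ 2) = \<phi> (a * (s / l))" for a
  proof -
    have "\<phi> (a ^ 2) = \<theta> ((s * a) ^ 2)" by (simp add: l power_mult_distrib s2)
    also have "\<dots> = \<theta> (s * a)" using \<theta>(3)[of "s * a"] two by simp
    also have "\<dots> = \<phi> (a * (s / l))" using l0 by (simp add: l mult_ac)
    finally show ?thesis .
  qed
  then have S: "S = F (s / l) * cnj S" by (intro S_eq_cnj_char_2[OF t]) (simp add: \<psi>1)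
  have "S * cnj S = (\<Sum>h\<in>UNIV. F h * (\<Sum>a\<in>UNIV. \<phi> (h * a)))"
    unfolding cmod_S_squared by (simp add: \<psi>1 char_2_self_inverse[OF t additive_\<phi>] mult.commute)
  also have "\<dots> = (\<Sum>h\<in>(UNIV :: 'a set). if h = 0 then of_nat CARD('a) else 0)"
    by (intro sum.cong) (auto simp: sum_additive_char_scale[OF additive_\<phi> \<phi>x] F_0)
  finally have n: "S * cnj S = of_nat CARD('a)" by simp
  have "S ^ 2 = F (s / l) * of_nat CARD('a)"
    unfolding power2_eq_square n[symmetric] by (subst (2) S) (simp add: mult_ac)
  then have "S ^ 8 = (F (s / l) * of_nat CARD('a)) ^ 4" by (metis mult_2 numeral_Bit0 power_mult mult.commute)
  then show ?thesis by (simp add: power_mult_distrib F_squared_char_2[OF t])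
qed

lemma (in level_3_char) sum_F_level_2:
  assumes r: "CARD('a) = CHAR('a) ^ r" and \<psi>1: "\<And>c. \<psi> c = 1" and "\<chi> \<noteq> principal_char" "S \<noteq> 0"
  shows "S ^ (4 * CHAR('a)) = of_nat CARD('a) ^ (2 * CHAR('a))"
proof -
  obtain x where x: "\<phi> x \<noteq> 1" using sum_F_eq_0_if_level_1[OF \<psi>1] assms(3,4) by blast
  show ?thesis
  proof (cases "CHAR('a) = 2")
    case True
    then show ?thesis using sum_F_level_2_even[OF r True \<psi>1 x] by simp
  next
    case False
    have "(2::'a) \<noteq> 0"
    proof
      assume "(2::'a) = 0"
      then have "CHAR('a) dvd 2" by (metis of_nat_eq_0_iff_char_dvd of_nat_numeral)
      then show False using False prime_CHAR_finite_field[where 'a = 'a]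
        by (metis primes_dvd_imp_eq two_is_prime_nat)
    qed
    then show ?thesis using sum_F_level_2_odd \<psi>1 x by blast
  qed
qed

section \<open>Quadratic L-functions in characteristic 2\<close>

lemma card_poly_roots_le:
  fixes f :: "'a::{finite,field} poly"
  assumes "f \<noteq> 0" "R \<subseteq> {x. poly f x = 0}"
  shows "card R \<le> degree f"
  using card_mono[OF poly_roots_finite[OF assms(1)] assms(2)] card_poly_roots_bound[OF assms(1)] by simp

text \<open>With z = g ^ 2, w = q F b and S ^ 2 = k w, squaring z + w = - S g gives (z + w) ^ 2 = k
  w z. Here k is 0 or the order of a group with at most four elements, so z / w is a 12th root of
  unity.\<close>

lemma (in level_3_char) cubic_roots_char_2:
  assumes r: "CARD('a) = CHAR('a) ^ r" and two: "CHAR('a) = 2" and \<psi>x: "\<psi> x \<noteq> 1"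
    and g: "g ^ 2 + S * g + L_coeff \<chi> 2 = 0"
  shows "g ^ 24 = of_nat CARD('a) ^ 12"
proof -
  let ?q = "of_nat CARD('a) :: complex"
  have t: "(2::'a) = 0" using of_nat_CHAR[where 'a = 'a] two by simp
  have aa: "a + a = 0" for a :: 'a using t by (metis mult_2 mult_zero_left)
  have neg: "- a = a" for a :: 'a using aa[of a] by (rule minus_unique)
  obtain \<theta> y where \<theta>: "additive_char \<theta>" "\<theta> y \<noteq> 1" "\<And>a. \<theta> (a ^ CHAR('a)) = \<theta> (a::'a)"
    using Frobenius_invariant_additive_char[OF r] by blast
  obtain l where l: "\<And>a. \<phi> a = \<theta> (l * a)"
    by (rule additive_char_dual[OF \<theta>(1,2) additive_\<phi>]) blast
  obtain m where m: "\<And>a. \<psi> a = \<theta> (m * a)"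
    by (rule additive_char_dual[OF \<theta>(1,2) additive_\<psi>]) blast
  have m0: "m \<noteq> 0" using \<psi>x m[of x] additive_char_0[OF \<theta>(1)] by auto
  \<comment> \<open>The same \<open>b\<close> is the surviving index in \<open>L_coeff_2_eq\<close>
    and the shift in \<open>S_eq_cnj_char_2\<close>. Thus the constant coefficient and S ^ 2 contain
    the same root of unity \<open>F b\<close>.\<close>
  define b where "b = l / m"
  have "\<phi> c = \<psi> (b * c)" for c using m0 by (simp add: l m b_def)
  then have L2: "L_coeff \<chi> 2 = ?q * F b" by (rule L_coeff_2_eq[OF \<psi>x])
  have "\<phi> (a * b) * \<psi> (- (a * b * (a + b))) = \<phi> (a ^ 2)" for a
  proof -
    have "l * (a * b) + m * (a * b * (a + b)) = l * a ^ 2 + (l * (a * b) + l * (a * b))"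
      using m0 by (simp add: b_def power2_eq_square field_simps)
    then have "l * (a * b) + m * (a * b * (a + b)) = l * a ^ 2" by (simp only: aa add_0_right)
    then show ?thesis
      by (simp only: neg l m additive_char_add[OF \<theta>(1), symmetric])
  qed
  then have S: "S = F b * cnj S" by (rule S_eq_cnj_char_2[OF t])
  define N where "N = S * cnj S"
  have S2: "S ^ 2 = F b * N" by (simp only: N_def power2_eq_square) (metis S mult.assoc mult.commute)

  \<comment> \<open>The radical: those h for which the inner sum of \<open>cmod_S_squared\<close>
    does not cancel.\<close>
  define R where "R = {h. \<forall>a. \<phi> (a * h) * \<psi> (a * h * (a + h)) = 1}"
  \<comment> \<open>\<open>v h\<close> is the square root of \<open>m * h\<close>, so that \<theta>
    (m h a ^ 2) = \<theta> (v h a) is linear in a.\<close>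
  define v where "v = (\<lambda>h. (m * h) ^ (2 ^ (r - 1)))"
  have r0: "r > 0" using r card_mono[of UNIV "{0, 1::'a}"] by (cases r) auto
  have v2: "v h ^ 2 = m * h" for h
  proof -
    have "v h ^ 2 = (m * h) ^ (2 ^ Suc (r - 1))" by (simp add: v_def mult.commute flip: power_mult)
    then show ?thesis using r0 r two power_CARD_eq_same[of "m * h"] by simp
  qed
  have bil: "\<phi> (a * h) * \<psi> (a * h * (a + h)) = \<theta> ((l * h + m * h ^ 2 + v h) * a)" for a h
  proof -
    have "\<theta> ((v h * a) ^ 2) = \<theta> (v h * a)" using \<theta>(3)[of "v h * a"] two by simp
    then have "\<theta> (m * h * a ^ 2) = \<theta> (v h * a)" by (simp add: power_mult_distrib v2)
    moreover have "\<phi> (a * h) * \<psi> (a * h * (a + h)) = \<theta> ((l * h + m * h ^ 2) * a + m * h * a ^ 2)"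
      unfolding l m additive_char_add[OF \<theta>(1), symmetric]
      by (rule arg_cong[where f = \<theta>]) (simp add: power2_eq_square algebra_simps)
    ultimately show ?thesis by (simp add: additive_char_add[OF \<theta>(1)] distrib_right)
  qed
  have N: "N = (\<Sum>h\<in>R. F h * ?q)"
  proof -
    have "N = (\<Sum>h\<in>UNIV. F h * (\<Sum>a\<in>UNIV. \<phi> (a * h) * \<psi> (a * h * (a + h))))"
      unfolding N_def cmod_S_squared neg
      by (simp add: char_2_self_inverse[OF t additive_\<phi>] char_2_self_inverse[OF t additive_\<psi>])
    also have "\<dots> = (\<Sum>h\<in>UNIV. if h \<in> R then F h * ?q else 0)"
    proof (rule sum.cong[OF refl])
      fix h
      have "(\<Sum>a\<in>UNIV. \<phi> (a * h) * \<psi> (a * h * (a + h))) = (if h \<in> R then ?q else 0)"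
        unfolding R_def mem_Collect_eq bil
        using sum_additive_char[OF additive_char_scale[OF \<theta>(1), of "l * h + m * h ^ 2 + v h"]] by simp
      then show "F h * (\<Sum>a\<in>UNIV. \<phi> (a * h) * \<psi> (a * h * (a + h))) = (if h \<in> R then F h * ?q else 0)"
        by simp
    qed
    finally show ?thesis by (simp add: sum.If_cases)
  qed
  have R_iff: "h \<in> R \<longleftrightarrow> l * h + m * h ^ 2 + v h = 0" for h
    unfolding R_def mem_Collect_eq bil
    using additive_char_scale_trivial[OF \<theta>(1,2)] additive_char_0[OF \<theta>(1)] by auto
  have vadd: "v (h + k) = v h + v k" for h k
    using freshmans_dream'[OF prime_CHAR_finite_field refl, of "m * h" "m * k" "r - 1"]
    unfolding two v_def distrib_left .
  have sq_add: "(h + k) ^ 2 = h ^ 2 + k ^ 2" for h k :: 'a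
    using freshmans_dream[OF prime_CHAR_finite_field refl, of h k] unfolding two .
  have R0: "0 \<in> R" by (simp add: R_def additive_char_0[OF additive_\<phi>] additive_char_0[OF additive_\<psi>])
  have Radd: "h + k \<in> R" if "h \<in> R" "k \<in> R" for h k
  proof -
    have "l * (h + k) + m * (h + k) ^ 2 + v (h + k) =
      (l * h + m * h ^ 2 + v h) + (l * k + m * k ^ 2 + v k)"
      by (simp add: sq_add vadd algebra_simps)
    then show ?thesis using that by (simp add: R_iff)
  qed
  have Rdiff: "h - k \<in> R" if "h \<in> R" "k \<in> R" for h k
    using Radd[OF that] by (simp only: diff_conv_add_uminus neg)
  have cardR: "card R \<in> {1, 2, 4}"
  proof -
    \<comment> \<open>The square of the equation defining \<open>R\<close>, which removes the square
      root \<open>v h\<close>.\<close>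
    define f where "f = [:0, m, l ^ 2, 0, m ^ 2:]"
    have "R \<subseteq> {h. poly f h = 0}"
    proof
      fix h assume "h \<in> R"
      then have "(l * h + m * h ^ 2 + v h) ^ 2 = 0" by (simp add: R_iff)
      then have "(l * h) ^ 2 + (m * h ^ 2) ^ 2 + m * h = 0" by (simp only: sq_add v2)
      moreover have "poly f h = (l * h) ^ 2 + (m * h ^ 2) ^ 2 + m * h"
        by (simp add: f_def power2_eq_square algebra_simps)
      ultimately show "h \<in> {h. poly f h = 0}" by simp
    qed
    moreover have "f \<noteq> 0" "degree f = 4" using m0 by (auto simp: f_def)
    ultimately have le: "card R \<le> 4" using card_poly_roots_le by metis
    have "card R dvd 2 ^ r" using card_additive_subgroup_dvd[OF R0 Rdiff] r two by simp
    then obtain i where i: "card R = 2 ^ i" using divides_primepow_nat[OF two_is_prime_nat] by blast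
    with le have "2 ^ i \<le> (2::nat) ^ 2" by simp
    then have "i \<le> 2" by (rule power_le_imp_le_exp[rotated]) simp
    then have "i = 0 \<or> i = 1 \<or> i = 2" by auto
    then show ?thesis using i by auto
  qed
  \<comment> \<open>On \<open>R\<close> the defect of \<open>F\<close> is trivial, so
    \<open>F\<close> restricts to a character of \<open>R\<close> and its sum over \<open>R\<close>
    is 0 or the order of \<open>R\<close>.\<close>
  have "N = 0 \<or> N = ?q * of_nat (card R)"
  proof (cases "\<forall>h\<in>R. F h = 1")
    case True
    then show ?thesis by (simp add: N)
  next
    case False
    then obtain k where k: "k \<in> R" "F k \<noteq> 1" by blast
    have "bij_betw (\<lambda>h. k + h) R R"
      by (rule bij_betw_byWitness[where f' = "\<lambda>h. h - k"]) (use Radd Rdiff k in auto)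
    then have "N = (\<Sum>h\<in>R. F (k + h) * ?q)" unfolding N by (rule sum.reindex_bij_betw[symmetric])
    also have "\<dots> = (\<Sum>h\<in>R. F k * (F h * ?q))"
    proof (rule sum.cong[OF refl])
      fix h assume "h \<in> R"
      then show "F (k + h) * ?q = F k * (F h * ?q)"
        using F_add[of k h] by (simp add: R_def neg mult.assoc)
    qed
    also have "\<dots> = F k * N" by (simp add: N sum_distrib_left)
    finally show ?thesis using k by simp
  qed
  then have "\<exists>k\<in>{0, 1, 2, 4}. N = ?q * k" using cardR by auto
  then obtain k where k: "k \<in> {0, 1, 2, 4}" "N = ?q * k" by blast
  define w z where "w = ?q * F b" and "z = g ^ 2"
  have "z + w = - (S * g)"
    using g L2 by (simp add: w_def z_def eq_neg_iff_add_eq_0 add_ac)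
  then have "(z + w) ^ 2 = (S * g) ^ 2" by simp
  also have "\<dots> = k * w * z" by (simp add: power_mult_distrib S2 k w_def z_def)
  finally have zw: "(z + w) ^ 2 = k * w * z" .
  have "z ^ 12 = w ^ 12"
  proof -
    consider "k = 0" | "k = 1" | "k = 2" | "k = 4" using k by auto
    then show ?thesis
    proof cases
      case 1
      then have "z = - w" using zw by (simp add: add_eq_0_iff2)
      then show ?thesis by simp
    next
      case 2
      then have e: "z ^ 2 + z * w + w ^ 2 = 0" using zw by (simp add: power2_eq_square algebra_simps)
      have "z ^ 3 - w ^ 3 = (z - w) * (z ^ 2 + z * w + w ^ 2)"
        by (simp add: power2_eq_square power3_eq_cube algebra_simps)
      then have "z ^ 3 = w ^ 3" unfolding e by simp
      then have "(z ^ 3) ^ 4 = (w ^ 3) ^ 4" by simp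
      then show ?thesis by simp
    next
      case 3
      then have "z ^ 2 = - (w ^ 2)" using zw by (simp add: power2_eq_square algebra_simps add_eq_0_iff2)
      then have "(z ^ 2) ^ 6 = (- (w ^ 2)) ^ 6" by simp
      then show ?thesis by simp
    next
      case 4
      then have "(z - w) ^ 2 = 0" using zw by (simp add: power2_eq_square algebra_simps)
      then show ?thesis by simp
    qed
  qed
  also have "w ^ 12 = ?q ^ 12 * (F b ^ 4) ^ 3" by (simp add: w_def power_mult_distrib)
  also have "\<dots> = ?q ^ 12" by (simp add: F_squared_char_2[OF t])
  finally show ?thesis by (simp add: z_def)
qed

subsection \<open>Characteristic 5\<close>

lemma numerals_char_5:
  assumes "CHAR('a::{finite,field}) = 5"
  shows "(5::'a::{finite,field}) = 0" "(2::'a) \<noteq> 0" "(3::'a) \<noteq> 0"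
proof -
  have "(of_nat n = (0::'a)) \<longleftrightarrow> 5 dvd n" for n
    using of_nat_eq_0_iff_char_dvd[of n, where 'a = 'a] assms by simp
  from this[of 5] this[of 2] this[of 3]
  show "(5::'a) = 0" "(2::'a) \<noteq> 0" "(3::'a) \<noteq> 0" by simp_all
qed

text \<open>The radical of the quadratic form \<open>x \<mapsto> a x\<^sup>6 + b x\<^sup>2\<close> over the prime field
  consists of roots of an additive polynomial of degree 25.\<close>

lemma quadratic_form_sum_char_5:
  fixes a b :: "'a::{finite,field}"
  assumes r: "CARD('a) = CHAR('a) ^ r" and five: "CHAR('a) = 5"
    and \<theta>: "additive_char \<theta>" "\<theta> y \<noteq> 1" "\<And>a. \<theta> (a ^ CHAR('a)) = \<theta> (a::'a)"
    and a0: "a \<noteq> 0"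
  defines "E \<equiv> (\<Sum>x\<in>UNIV. \<theta> (a * (x ^ 2) ^ 3 + b * x ^ 2))"
  shows "\<exists>m\<in>{1, 5, 25}. E ^ 2 = of_nat CARD('a) * m"
proof -
  let ?q = "of_nat CARD('a) :: complex"
  note num = numerals_char_5[OF five]
  have real: "cnj E = E"
  proof -
    \<comment> \<open>In characteristic 5 the substitution of 2x for x negates the quadratic form,
      so E is real and E ^ 2 is its squared absolute value.\<close>
    have "- 1 = (2::'a) ^ 2" using num(1) by (simp add: eq_neg_iff_add_eq_0 minus_equation_iff[of 1])
    then have "(\<Sum>x\<in>UNIV. \<theta> (a * (- 1 * x ^ 2) ^ 3 + b * (- 1 * x ^ 2))) = E"
      using sum_scale_square[OF num(2), of "\<lambda>y. \<theta> (a * y ^ 3 + b * y)"] by (simp only: E_def)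
    then show ?thesis
      by (simp add: E_def cnj_additive_char[OF \<theta>(1)] power3_eq_cube algebra_simps)
  qed
  define Q where "Q = (\<lambda>x. a * (x ^ 2) ^ 3 + b * x ^ 2)"
  define B where "B = (\<lambda>x w. a * (x ^ 5 * w + x * w ^ 5) + 2 * b * x * w)"
  have pow5: "(x + w) ^ 5 = x ^ 5 + w ^ 5" for x w :: 'a
    using freshmans_dream[OF prime_CHAR_finite_field refl, of x w] unfolding five .
  have Qadd: "Q (x + w) = Q x + Q w + B x w" for x w
  proof -
    have "(z ^ 2) ^ 3 = z ^ 5 * z" for z :: 'a by (simp flip: power_mult power_Suc2)
    then have Q: "Q z = a * (z ^ 5 * z) + b * z ^ 2" for z by (simp add: Q_def)
    show ?thesis unfolding Q B_def pow5 by (simp add: power2_eq_square algebra_simps)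
  qed
  \<comment> \<open>The fifth root of \<open>a * w\<close>: Frobenius invariance turns \<theta> (a w
    x ^ 5) into \<theta> (v w x), so the polar form \<open>B\<close> becomes linear in x.\<close>
  define v where "v = (\<lambda>w. (a * w) ^ (5 ^ (r - 1)))"
  have r0: "r > 0" using r card_mono[of UNIV "{0, 1::'a}"] by (cases r) auto
  have v5: "v w ^ 5 = a * w" for w
  proof -
    have "v w ^ 5 = (a * w) ^ (5 ^ Suc (r - 1))" by (simp add: v_def mult.commute flip: power_mult)
    then show ?thesis using r0 r five power_CARD_eq_same[of "a * w"] by simp
  qed
  have bil: "\<theta> (B x w) = \<theta> ((v w + a * w ^ 5 + 2 * b * w) * x)" for x w
  proof -
    have "\<theta> ((v w * x) ^ 5) = \<theta> (v w * x)" using \<theta>(3)[of "v w * x"] five by simp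
    then have "\<theta> (a * w * x ^ 5) = \<theta> (v w * x)" by (simp add: power_mult_distrib v5)
    moreover have "\<theta> (B x w) = \<theta> (a * w * x ^ 5 + (a * w ^ 5 + 2 * b * w) * x)"
      by (rule arg_cong[where f = \<theta>]) (simp add: B_def algebra_simps)
    ultimately have "\<theta> (B x w) = \<theta> (v w * x + (a * w ^ 5 + 2 * b * w) * x)"
      by (simp only: additive_char_add[OF \<theta>(1)])
    then show ?thesis by (simp add: algebra_simps)
  qed
  define R where "R = {w. v w + a * w ^ 5 + 2 * b * w = 0}"
  have inner: "(\<Sum>x\<in>UNIV. \<theta> (B x w)) = (if w \<in> R then ?q else 0)" for w
    unfolding bil R_def mem_Collect_eq by (rule sum_additive_char_scale[OF \<theta>(1,2)])
  have QR: "\<theta> (Q w) = 1" if "w \<in> R" for w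
  proof -
    have "\<theta> (B w w) = 1" using that by (simp add: bil R_def additive_char_0[OF \<theta>(1)])
    moreover have "B w w = of_nat 2 * Q w"
      by (simp add: B_def Q_def algebra_simps flip: power_Suc2 power_mult power_Suc)
         (simp add: power2_eq_square)
    ultimately have "\<theta> (Q w) ^ 2 = 1" by (simp only: additive_char_of_nat_mult[OF \<theta>(1)])
    moreover have "\<theta> (Q w) ^ 5 = 1" using additive_char_power_CHAR[OF \<theta>(1)] five by simp
    moreover have "\<theta> (Q w) ^ 5 = (\<theta> (Q w) ^ 2) ^ 2 * \<theta> (Q w)" by (simp flip: power_mult power_Suc2)
    ultimately show ?thesis by simp
  qed
  have "E * cnj E = (\<Sum>x\<in>UNIV. \<Sum>z\<in>UNIV. \<theta> (Q z) * \<theta> (- Q x))"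
    by (simp add: E_def Q_def sum_distrib_left sum_distrib_right cnj_additive_char[OF \<theta>(1)])
  also have "\<dots> = (\<Sum>x\<in>UNIV. \<Sum>w\<in>UNIV. \<theta> (Q (x + w)) * \<theta> (- Q x))"
  proof (rule sum.cong[OF refl])
    fix x :: 'a
    have "bij (\<lambda>w. x + w)" by (rule o_bij[of "\<lambda>h. h - x"]) auto
    then show "(\<Sum>z\<in>UNIV. \<theta> (Q z) * \<theta> (- Q x)) = (\<Sum>w\<in>UNIV. \<theta> (Q (x + w)) * \<theta> (- Q x))"
      by (rule sum.reindex_bij_betw[symmetric])
  qed
  also have "\<dots> = (\<Sum>x\<in>UNIV. \<Sum>w\<in>UNIV. \<theta> (Q w) * \<theta> (B x w))"
    by (intro sum.cong refl)
       (simp only: Qadd additive_char_add[OF \<theta>(1), symmetric], simp add: algebra_simps)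
  also have "\<dots> = (\<Sum>w\<in>UNIV. \<theta> (Q w) * (if w \<in> R then ?q else 0))"
    by (subst sum.swap) (simp flip: sum_distrib_left inner)
  also have "\<dots> = (\<Sum>w\<in>UNIV. if w \<in> R then ?q else 0)"
    by (rule sum.cong) (auto simp: QR)
  also have "\<dots> = ?q * of_nat (card R)" by (simp add: sum.If_cases)
  finally have E2: "E ^ 2 = ?q * of_nat (card R)" by (simp add: real power2_eq_square)
  have "card R \<in> {1, 5, 25}"
  proof -
    have vdiff: "v (x - w) = v x - v w" for x w
    proof -
      have "v (x - w + w) = v (x - w) + v w"
        using freshmans_dream'[OF prime_CHAR_finite_field refl, of "a * (x - w)" "a * w" "r - 1"]
        unfolding five v_def distrib_left .
      then show ?thesis by simp
    qed
    have p5diff: "(x - w) ^ 5 = x ^ 5 - w ^ 5" for x w :: 'a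
      using pow5[of "x - w" w] by simp
    have "0 \<in> R" by (simp add: R_def v_def)
    moreover have "x - w \<in> R" if "x \<in> R" "w \<in> R" for x w
    proof -
      have "v (x - w) + a * (x - w) ^ 5 + 2 * b * (x - w) =
        (v x + a * x ^ 5 + 2 * b * x) - (v w + a * w ^ 5 + 2 * b * w)"
        by (simp add: vdiff p5diff algebra_simps)
      then show ?thesis using that by (simp add: R_def)
    qed
    ultimately have "card R dvd 5 ^ r" using card_additive_subgroup_dvd[of R] r five by simp
    then obtain i where i: "card R = 5 ^ i"
      using divides_primepow_nat[of 5 "card R" r] by auto
    define f where "f = monom (a ^ 5) 25 + monom ((2 * b) ^ 5) 5 + monom a 1"
    have "R \<subseteq> {w. poly f w = 0}"
    proof
      fix w assume "w \<in> R"
      then have "(v w + a * w ^ 5 + 2 * b * w) ^ 5 = 0" by (simp add: R_def)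
      then have "a * w + (a * w ^ 5) ^ 5 + (2 * b * w) ^ 5 = 0" by (simp only: pow5 v5)
      moreover have "poly f w = a * w + (a * w ^ 5) ^ 5 + (2 * b * w) ^ 5"
        by (simp add: f_def poly_monom power_mult_distrib flip: power_mult)
      ultimately show "w \<in> {w. poly f w = 0}" by simp
    qed
    moreover have "coeff f 25 \<noteq> 0" using a0 by (simp add: f_def)
    then have "f \<noteq> 0" by auto
    moreover have "degree f \<le> 25"
      unfolding f_def by (intro degree_add_le order.trans[OF degree_monom_le]) auto
    ultimately have "card R \<le> 25" using card_poly_roots_le[of f R] by simp
    with i have "5 ^ i \<le> (5::nat) ^ 2" by simp
    then have "i \<le> 2" by (rule power_le_imp_le_exp[rotated]) simp
    then have "i = 0 \<or> i = 1 \<or> i = 2" by auto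
    then show ?thesis using i by auto
  qed
  then show ?thesis unfolding E2 by auto
qed

text \<open>Differencing leaves a Gauss sum with parameter z = 3 c h for each h. Its sign depends on
  whether z is a square, and splitting accordingly leads back to sums over forms in x ^ 2.\<close>

lemma cubic_sum_squared_char_5:
  fixes c b :: "'a::{finite,field}"
  assumes five: "CHAR('a) = 5" and \<theta>: "additive_char \<theta>" "\<theta> y \<noteq> 1"
    and c0: "c \<noteq> 0" and g: "\<And>x. x ^ 2 \<noteq> g"
  defines "T \<equiv> (\<Sum>x\<in>UNIV. \<theta> (c * x ^ 3 + b * x))" and "G \<equiv> (\<Sum>x\<in>UNIV. \<theta> (x ^ 2))"
    and "H \<equiv> \<lambda>z. \<theta> (- c * (z / (3 * c)) ^ 3 + b * (z / (3 * c)))"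
  shows "2 * T ^ 2 = 2 * of_nat CARD('a) + G * ((\<Sum>x\<in>UNIV. H (x ^ 2)) - (\<Sum>x\<in>UNIV. H (g * x ^ 2)))"
proof -
  let ?q = "of_nat CARD('a) :: complex"
  note num = numerals_char_5[OF five]
  have real: "cnj T = T"
  proof -
    have "bij (uminus :: 'a \<Rightarrow> 'a)" by (rule o_bij[of uminus]) auto
    then have "T = (\<Sum>x\<in>UNIV. \<theta> (c * (- x) ^ 3 + b * (- x)))"
      unfolding T_def by (rule sum.reindex_bij_betw[symmetric])
    also have "\<dots> = cnj T"
      by (simp add: T_def cnj_additive_char[OF \<theta>(1)] power3_eq_cube algebra_simps)
    finally show ?thesis ..
  qed
  define P where "P = (\<lambda>x. c * x ^ 3 + b * x)"
  define Gs where "Gs = (\<lambda>z. \<Sum>x\<in>UNIV. \<theta> (z * x ^ 2))"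
  have "T ^ 2 = (\<Sum>h\<in>UNIV. \<Sum>x\<in>UNIV. \<theta> (P (x + h)) * \<theta> (- P x))"
  proof -
    have "T * cnj T = (\<Sum>x\<in>UNIV. \<Sum>z\<in>UNIV. \<theta> (P z) * \<theta> (- P x))"
      by (simp add: T_def P_def sum_distrib_left sum_distrib_right cnj_additive_char[OF \<theta>(1)])
    also have "\<dots> = (\<Sum>x\<in>UNIV. \<Sum>w\<in>UNIV. \<theta> (P (x + w)) * \<theta> (- P x))"
    proof (rule sum.cong[OF refl])
      fix x :: 'a
      have "bij (\<lambda>w. x + w)" by (rule o_bij[of "\<lambda>h. h - x"]) auto
      then show "(\<Sum>z\<in>UNIV. \<theta> (P z) * \<theta> (- P x)) = (\<Sum>w\<in>UNIV. \<theta> (P (x + w)) * \<theta> (- P x))"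
        by (rule sum.reindex_bij_betw[symmetric])
    qed
    finally show ?thesis by (subst sum.swap) (simp add: real power2_eq_square)
  qed
  also have "\<dots> = (\<Sum>h\<in>UNIV. \<theta> (- c * h ^ 3 + b * h) * Gs (3 * c * h))"
  proof (rule sum.cong[OF refl])
    fix h :: 'a
    \<comment> \<open>P (x + h) - P x is a quadratic polynomial in x with vertex - h / 2, which is 2
      h in characteristic 5.\<close>
    have "bij (\<lambda>x. x + 2 * h)" by (rule o_bij[of "\<lambda>x. x - 2 * h"]) auto
    then have "(\<Sum>x\<in>UNIV. \<theta> (P (x + h)) * \<theta> (- P x)) =
        (\<Sum>x\<in>UNIV. \<theta> (P (x + 2 * h + h)) * \<theta> (- P (x + 2 * h)))"
      by (rule sum.reindex_bij_betw[symmetric])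
    also have "\<dots> = (\<Sum>x\<in>UNIV. \<theta> (- c * h ^ 3 + b * h) * \<theta> (3 * c * h * x ^ 2))"
    proof (rule sum.cong[OF refl])
      fix x
      have "P (x + 2 * h + h) + - P (x + 2 * h) =
        - c * h ^ 3 + b * h + 3 * c * h * x ^ 2 + 5 * (3 * c * x * h ^ 2 + 4 * c * h ^ 3)"
        by (simp add: P_def power2_eq_square power3_eq_cube algebra_simps)
      then show "\<theta> (P (x + 2 * h + h)) * \<theta> (- P (x + 2 * h)) =
          \<theta> (- c * h ^ 3 + b * h) * \<theta> (3 * c * h * x ^ 2)"
        by (simp only: additive_char_add[OF \<theta>(1), symmetric] num mult_zero_left add_0_right)
    qed
    finally show "(\<Sum>x\<in>UNIV. \<theta> (P (x + h)) * \<theta> (- P x)) = \<theta> (- c * h ^ 3 + b * h) * Gs (3 * c * h)"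
      by (simp add: Gs_def sum_distrib_left)
  qed
  also have "\<dots> = (\<Sum>z\<in>UNIV. H z * Gs z)"
  proof -
    have "bij (\<lambda>h. 3 * c * h)"
      by (rule o_bij[of "\<lambda>x. x / (3 * c)"]) (use c0 num in auto)
    then have "(\<Sum>z\<in>UNIV. H z * Gs z) = (\<Sum>h\<in>UNIV. H (3 * c * h) * Gs (3 * c * h))"
      by (rule sum.reindex_bij_betw[symmetric])
    then show ?thesis using c0 num by (simp add: H_def)
  qed
  finally have "2 * T ^ 2 = (\<Sum>x\<in>UNIV. H (x ^ 2) * Gs (x ^ 2)) + (\<Sum>x\<in>UNIV. H (g * x ^ 2) * Gs (g * x ^ 2))"
    using sum_squares_nonsquares[OF num(2) g, of "\<lambda>z. H z * Gs z"] by simp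
  moreover have Gsq: "Gs (x ^ 2) = (if x = 0 then ?q else G)" for x
  proof (cases "x = 0")
    case False
    then show ?thesis using sum_scale_square[OF False, of \<theta>] by (simp add: Gs_def G_def)
  qed (simp add: Gs_def additive_char_0[OF \<theta>(1)])
  moreover have "Gs (g * x ^ 2) = (if x = 0 then ?q else - G)" for x
  proof (cases "x = 0")
    case False
    have "Gs (x ^ 2 * g) = - Gs (x ^ 2)"
      unfolding Gs_def using gauss_sum_scale[OF \<theta> num(2) g, of "x ^ 2"] False by (simp add: mult.assoc)
    then show ?thesis using Gsq[of x] False by (simp add: mult.commute)
  qed (simp add: Gs_def additive_char_0[OF \<theta>(1)])
  ultimately have "2 * T ^ 2 = (\<Sum>x\<in>UNIV. H (x ^ 2) * (if x = 0 then ?q else G)) +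
      (\<Sum>x\<in>UNIV. H (g * x ^ 2) * (if x = 0 then ?q else - G))" by simp
  also have "\<dots> = (\<Sum>x\<in>UNIV. H (x ^ 2) * G + (if x = 0 then ?q - G else 0)) +
      (\<Sum>x\<in>UNIV. (if x = 0 then ?q + G else 0) - H (g * x ^ 2) * G)"
    by (intro arg_cong2[where f = "(+)"] sum.cong refl)
       (auto simp: H_def additive_char_0[OF \<theta>(1)] power3_eq_cube)
  also have "\<dots> = 2 * ?q + G * ((\<Sum>x\<in>UNIV. H (x ^ 2)) - (\<Sum>x\<in>UNIV. H (g * x ^ 2)))"
    by (simp add: sum.distrib sum_subtractf sum_distrib_left sum_distrib_right algebra_simps)
  finally show ?thesis .
qed

text \<open>Measured in units of a Gauss sum, \<open>e1\<close>, \<open>e2\<close>,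
  \<open>d1\<close>, \<open>d2\<close> are quadratic form sums and \<open>t\<close> is the cubic
  sum. The linear relation alone would admit values such as \<surd>5 and 3; the relation for t ^ 2
  rules them out and leaves values of 2 cos at rational multiples of \<pi>.\<close>

lemma golden_ratio_values:
  fixes s :: real
  assumes s: "s > 0" "s ^ 2 = 5"
    and e: "e1 \<in> {1, -1, s, -s, 5, -5}" "e2 \<in> {1, -1, s, -s, 5, -5}"
    and d: "d1 \<in> {1, -1, s, -s, 5, -5}" "d2 \<in> {1, -1, s, -s, 5, -5}"
    and t: "2 * t = e1 + e2" "2 * t ^ 2 = 2 + d1 - d2"
  shows "t \<in> {0, 1, -1, 2, -2} \<or> t ^ 2 = t + 1 \<or> t ^ 2 = 1 - t"
proof -
  have lo: "s > 2.236"
  proof (rule ccontr)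
    assume "\<not> s > 2.236"
    then have "s ^ 2 \<le> 2.236 ^ 2" using s(1) by (intro power_mono) auto
    then show False using s by (simp add: power2_eq_square)
  qed
  have hi: "s < 2.2361"
  proof (rule ccontr)
    assume "\<not> s < 2.2361"
    then have "s ^ 2 \<ge> 2.2361 ^ 2" using s(1) by (intro power_mono) auto
    then show False using s by (simp add: power2_eq_square)
  qed
  have ss: "s * s = 5" using s by (simp add: power2_eq_square)
  define D where "D = d1 - d2"
  \<comment> \<open>These facts refute, in this order, \<plusminus>s; then \<plusminus>3,
    \<plusminus>5 and \<plusminus>(5 + s) / 2; then \<plusminus>(5 - s) / 2. The decimal bounds on
    \<open>s\<close> are sharp enough to separate the possible values of \<open>D\<close>.\<close>
  have D: "D \<noteq> 8" "D \<le> 10" "D \<noteq> 13 - 5 * s"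
    using d lo hi by (auto simp: D_def)
  have t2: "4 * (t * t) = 4 + 2 * D" using t by (simp add: D_def power2_eq_square)
  have "t = (e1 + e2) / 2" using t by simp
  then have "t \<in> {0, 1, -1, 2, -2} \<or> t \<in> {s, -s} \<or> t \<in> {3, -3, 5, -5} \<or>
      t \<in> {(1 + s) / 2, (1 - s) / 2} \<or> t \<in> {(-1 + s) / 2, (-1 - s) / 2} \<or>
      t \<in> {(5 + s) / 2, (-5 - s) / 2} \<or> t \<in> {(5 - s) / 2, (-5 + s) / 2}"
    using e by (elim insertE emptyE) simp_all
  moreover have "t \<notin> {s, -s}" using t2 D(1) ss by auto
  moreover have "t \<notin> {3, -3, 5, -5}" using t2 D(2) by auto
  moreover have "t * t = t + 1" if "t \<in> {(1 + s) / 2, (1 - s) / 2}"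
  proof -
    have "2 * t - 1 = s \<or> 2 * t - 1 = - s" using that by auto
    then have "(2 * t - 1) * (2 * t - 1) = s * s" by (elim disjE) simp_all
    then show ?thesis by (simp add: ss algebra_simps)
  qed
  moreover have "t * t = 1 - t" if "t \<in> {(-1 + s) / 2, (-1 - s) / 2}"
  proof -
    have "2 * t + 1 = s \<or> 2 * t + 1 = - s" using that by auto
    then have "(2 * t + 1) * (2 * t + 1) = s * s" by (elim disjE) simp_all
    then show ?thesis by (simp add: ss algebra_simps)
  qed
  moreover have "t \<notin> {(5 + s) / 2, (-5 - s) / 2}"
  proof
    assume "t \<in> {(5 + s) / 2, (-5 - s) / 2}"
    then have "2 * t = 5 + s \<or> 2 * t = - (5 + s)" by auto
    then have "(2 * t) * (2 * t) = (5 + s) * (5 + s)" by (elim disjE) (simp_all only: minus_mult_minus)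
    then have "4 * (t * t) = 30 + 10 * s" by (simp add: ss algebra_simps)
    then show False using t2 D(2) s by simp
  qed
  moreover have "t \<notin> {(5 - s) / 2, (-5 + s) / 2}"
  proof
    assume "t \<in> {(5 - s) / 2, (-5 + s) / 2}"
    then have "2 * t = 5 - s \<or> 2 * t = - (5 - s)" by auto
    then have "(2 * t) * (2 * t) = (5 - s) * (5 - s)" by (elim disjE) (simp_all only: minus_mult_minus)
    then have "4 * (t * t) = 30 - 10 * s" by (simp add: ss algebra_simps)
    then show False using t2 D(3) by simp
  qed
  ultimately show ?thesis unfolding power2_eq_square by blast
qed

text \<open>As z + 1 / z = - t, the values of \<open>t\<close> correspond to roots of unity of
  orders 1, 2, 3, 4, 5, 6 and 10, with least common multiple 60.\<close>

lemma golden_ratio_root_of_unity: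
  fixes z t :: complex
  assumes z: "z ^ 2 + t * z + 1 = 0"
    and t: "t \<in> {0, 1, -1, 2, -2} \<or> t ^ 2 = t + 1 \<or> t ^ 2 = 1 - t"
  shows "z ^ 60 = 1"
proof -
  have gold: "w ^ 5 = 1" if "w ^ 2 + u * w + 1 = 0" "u ^ 2 = u + 1" for w u :: complex
  proof -
    \<comment> \<open>For u ^ 2 = u + 1 the two quadratic polynomials are the factors of the fifth
      cyclotomic polynomial over the field generated by \<surd>5.\<close>
    have "w ^ 5 - 1 = (w - 1) * ((w ^ 2 + u * w + 1) * (w ^ 2 + (1 - u) * w + 1) + (u ^ 2 - u - 1) * w ^ 2)"
      by (simp add: algebra_simps eval_nat_numeral)
    then show ?thesis using that by simp
  qed
  consider "t = 0" | "t = 1" | "t = -1" | "t = 2" | "t = -2" | "t ^ 2 = t + 1" | "t ^ 2 = 1 - t"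
    using t by blast
  then show ?thesis
  proof cases
    case 1
    then have "z ^ 2 = - 1" using z by (simp add: add_eq_0_iff2)
    then have "(z ^ 2) ^ 30 = (- 1) ^ 30" by simp
    then show ?thesis by simp
  next
    case 2
    have "z ^ 3 - 1 = (z - 1) * (z ^ 2 + z + 1)" by (simp add: algebra_simps eval_nat_numeral)
    then have "z ^ 3 = 1" using z 2 by simp
    then have "(z ^ 3) ^ 20 = 1 ^ 20" by simp
    then show ?thesis by simp
  next
    case 3
    have "z ^ 3 + 1 = (z + 1) * (z ^ 2 - z + 1)" by (simp add: algebra_simps eval_nat_numeral)
    then have "z ^ 3 = - 1" using z 3 by (simp add: add_eq_0_iff2)
    then have "(z ^ 3) ^ 20 = (- 1) ^ 20" by simp
    then show ?thesis by simp
  next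
    case 4
    then have "(z + 1) ^ 2 = 0" using z by (simp add: algebra_simps eval_nat_numeral)
    then have "z = - 1" by (simp add: add_eq_0_iff2)
    then show ?thesis by simp
  next
    case 5
    then have "(z - 1) ^ 2 = 0" using z by (simp add: algebra_simps eval_nat_numeral)
    then show ?thesis by simp
  next
    case 6
    then have "z ^ 5 = 1" using gold z by blast
    then have "(z ^ 5) ^ 12 = 1 ^ 12" by simp
    then show ?thesis by simp
  next
    case 7
    have "(- z) ^ 5 = 1" by (rule gold[of "- z" "- t"]) (use z 7 in simp_all)
    then have "((- z) ^ 5) ^ 12 = 1 ^ 12" by simp
    then show ?thesis by simp
  qed
qed

lemma sqrt_5_multiple:
  fixes E G :: complex
  assumes "E ^ 2 = q * m" "m \<in> {1, 5, 25}" "G ^ 2 = q"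
  shows "\<exists>e\<in>{1, -1, sqrt 5, - sqrt 5, 5, -5}. E = of_real e * G"
proof -
  have s5: "complex_of_real (sqrt 5) ^ 2 = 5" by (simp flip: of_real_power)
  have *: "E = c * G \<or> E = - c * G" if "c ^ 2 = m" for c :: complex
  proof -
    have "E ^ 2 = (c * G) ^ 2" using assms that by (simp add: power_mult_distrib mult.commute)
    then show ?thesis by (auto simp: power2_eq_iff)
  qed
  consider "m = 1" | "m = 5" | "m = 25" using assms(2) by blast
  then show ?thesis
  proof cases
    case 1
    then show ?thesis using *[of 1] by auto
  next
    case 2
    then show ?thesis using *[of "of_real (sqrt 5)"] s5 by auto
  next
    case 3
    then show ?thesis using *[of 5] by auto
  qed
qed

text \<open>Division by the Gauss sum \<open>G\<close>, whose square is q, turns the cubic sum into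
  a real number t. Splitting x over squares and nonsquares gives 2 t as a sum of two quadratic form
  values, and \<open>cubic_sum_squared_char_5\<close> gives 2 t ^ 2 by two more.\<close>

lemma cubic_sum_char_5:
  fixes c b :: "'a::{finite,field}"
  assumes r: "CARD('a) = CHAR('a) ^ r" and five: "CHAR('a) = 5"
    and \<theta>: "additive_char \<theta>" "\<theta> y \<noteq> 1" "\<And>a. \<theta> (a ^ CHAR('a)) = \<theta> (a::'a)"
    and c0: "c \<noteq> 0"
    and w: "w ^ 2 + (\<Sum>x\<in>UNIV. \<theta> (c * x ^ 3 + b * x)) * w + of_nat CARD('a) = 0"
  shows "w ^ 60 = of_nat CARD('a) ^ 30"
proof -
  let ?q = "of_nat CARD('a) :: complex"
  note num = numerals_char_5[OF five]
  define T where "T = (\<Sum>x\<in>UNIV. \<theta> (c * x ^ 3 + b * x))"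
  define G where "G = (\<Sum>x\<in>UNIV. \<theta> (x ^ 2))"
  obtain g :: 'a where g: "\<And>x. x ^ 2 \<noteq> g" using nonsquare_exists[OF num(2)] by blast
  have g0: "g \<noteq> 0" using g[of 0] by auto
  have m1: "- 1 = (2::'a) ^ 2" using num(1) by (simp add: eq_neg_iff_add_eq_0 minus_equation_iff[of 1])
  have G2: "G ^ 2 = ?q"
  proof -
    have "(\<Sum>x\<in>UNIV. \<theta> (- 1 * x ^ 2)) = G"
      unfolding m1 G_def using sum_scale_square[OF num(2), of \<theta>] .
    then have "cnj G = G" by (simp add: G_def cnj_additive_char[OF \<theta>(1)])
    moreover have "G * cnj G = ?q"
      using gauss_sum_squared(1)[OF \<theta>(1,2) num(2), of 1] by (simp add: G_def)
    ultimately show ?thesis by (simp add: power2_eq_square)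
  qed
  have G0: "G \<noteq> 0" using G2 by auto
  define e where "e = (\<lambda>a b. \<Sum>x\<in>UNIV. \<theta> (a * (x ^ 2) ^ 3 + b * x ^ 2))"
  have ex: "\<exists>u\<in>{1, -1, sqrt 5, - sqrt 5, 5, -5}. e a b = of_real u * G" if "a \<noteq> 0" for a b
    using quadratic_form_sum_char_5[OF r five \<theta> that, of b] sqrt_5_multiple[OF _ _ G2]
    unfolding e_def by blast
  \<comment> \<open>The coefficients of the argument of \<theta> in \<open>H z\<close> of
    \<open>cubic_sum_squared_char_5\<close>, as a polynomial in z.\<close>
  define a' b' where "a' = - c / (3 * c) ^ 3" and "b' = b / (3 * c)"
  have "(3 * c) ^ 3 \<noteq> 0" using c0 num by (metis mult_eq_0_iff power_not_zero)
  then have "a' \<noteq> 0" using c0 by (metis a'_def divide_eq_0_iff neg_equal_0_iff_equal)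
  then have nz: "a' \<noteq> 0" "c * g ^ 3 \<noteq> 0" "a' * g ^ 3 \<noteq> 0" using c0 g0 by auto
  obtain e1 e2 d1 d2 where e:
    "e1 \<in> {1, -1, sqrt 5, - sqrt 5, 5, -5}" "e c b = of_real e1 * G"
    "e2 \<in> {1, -1, sqrt 5, - sqrt 5, 5, -5}" "e (c * g ^ 3) (b * g) = of_real e2 * G"
    "d1 \<in> {1, -1, sqrt 5, - sqrt 5, 5, -5}" "e a' b' = of_real d1 * G"
    "d2 \<in> {1, -1, sqrt 5, - sqrt 5, 5, -5}" "e (a' * g ^ 3) (b' * g) = of_real d2 * G"
    using ex[OF c0, of b] ex[OF nz(2), of "b * g"] ex[OF nz(1), of b'] ex[OF nz(3), of "b' * g"]
    by blast
  have "e c b + e (c * g ^ 3) (b * g) = 2 * T"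
    using sum_squares_nonsquares[OF num(2) g, of "\<lambda>x. \<theta> (c * x ^ 3 + b * x)"]
    by (simp add: e_def T_def power_mult_distrib mult_ac)
  then have T: "2 * T = of_real (e1 + e2) * G" unfolding e by (simp add: distrib_right)
  have "2 * T ^ 2 = 2 * ?q + G * (e a' b' - e (a' * g ^ 3) (b' * g))"
    using cubic_sum_squared_char_5[OF five \<theta>(1,2) c0 g, of b]
    by (simp add: T_def G_def e_def a'_def b'_def power_mult_distrib power_divide mult_ac)
  also have "\<dots> = of_real (2 + d1 - d2) * G ^ 2"
    unfolding e G2[symmetric] by (simp add: algebra_simps power2_eq_square)
  finally have T2: "2 * T ^ 2 = of_real (2 + d1 - d2) * G ^ 2" .
  define t where "t = (e1 + e2) / 2"
  have Tt: "T = of_real t * G" using T by (simp add: t_def field_simps)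
  have "of_real (2 * t ^ 2) * G ^ 2 = of_real (2 + d1 - d2) * G ^ 2"
    using T2 unfolding Tt by (simp add: power_mult_distrib)
  then have "complex_of_real (2 * t ^ 2) = of_real (2 + d1 - d2)" using G0 by simp
  then have t2: "2 * t ^ 2 = 2 + d1 - d2" by (simp only: of_real_eq_iff)
  have "t \<in> {0, 1, -1, 2, -2} \<or> t ^ 2 = t + 1 \<or> t ^ 2 = 1 - t"
    by (rule golden_ratio_values[of "sqrt 5", OF _ _ e(1,3,5,7) _ t2]) (simp_all add: t_def)
  then have tc: "complex_of_real t \<in> {0, 1, -1, 2, -2} \<or> complex_of_real t ^ 2 = of_real t + 1 \<or>
      complex_of_real t ^ 2 = 1 - of_real t"
    by (elim disjE) (auto simp flip: of_real_power)
  define z where "z = w / G"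
  have "G ^ 2 * (z ^ 2 + of_real t * z + 1) = w ^ 2 + T * w + ?q"
    using G0 by (simp add: z_def Tt G2[symmetric] power2_eq_square field_simps)
  then have "z ^ 2 + of_real t * z + 1 = 0" using w G0 by (simp add: T_def)
  from golden_ratio_root_of_unity[OF this tc] have "w ^ 60 = G ^ 60" using G0 by (simp add: z_def power_divide)
  also have "\<dots> = (G ^ 2) ^ 30" by (simp flip: power_mult)
  finally show ?thesis by (simp add: G2)
qed

lemma (in level_3_char) F_eq_cubic:
  assumes two: "(2::'a) \<noteq> 0" and three: "(3::'a) \<noteq> 0"
  shows "additive_char (\<lambda>a. F a * (\<phi> (a ^ 2 / 2) * \<psi> (- (a ^ 3 / 3))))"
  unfolding additive_char_def
proof (intro conjI allI)
  show "F 0 * (\<phi> (0\<^sup>2 / 2) * \<psi> (- (0 ^ 3 / 3))) = 1"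
    by (simp add: F_0 additive_char_0[OF additive_\<phi>] additive_char_0[OF additive_\<psi>])
  fix a b :: 'a
  have "(a + b) ^ 2 / 2 = a * b + (a ^ 2 / 2 + b ^ 2 / 2)"
    using two by (simp add: power2_eq_square field_simps)
  then have "\<phi> ((a + b) ^ 2 / 2) = \<phi> (a * b) * (\<phi> (a ^ 2 / 2) * \<phi> (b ^ 2 / 2))"
    by (simp only: additive_char_add[OF additive_\<phi>])
  moreover have "- ((a + b) ^ 3 / 3) = - (a * b * (a + b)) + (- (a ^ 3 / 3) + - (b ^ 3 / 3))"
    using three by (simp add: power3_eq_cube field_simps)
  then have "\<psi> (- ((a + b) ^ 3 / 3)) = \<psi> (- (a * b * (a + b))) * (\<psi> (- (a ^ 3 / 3)) * \<psi> (- (b ^ 3 / 3)))"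
    by (simp only: additive_char_add[OF additive_\<psi>])
  ultimately show "F (a + b) * (\<phi> ((a + b)\<^sup>2 / 2) * \<psi> (- ((a + b) ^ 3 / 3))) =
    F a * (\<phi> (a\<^sup>2 / 2) * \<psi> (- (a ^ 3 / 3))) * (F b * (\<phi> (b\<^sup>2 / 2) * \<psi> (- (b ^ 3 / 3))))"
    using F_add[of a b] by (simp add: mult_ac)
qed

lemma (in level_3_char) cubic_roots_char_5:
  assumes r: "CARD('a) = CHAR('a) ^ r" and five: "CHAR('a) = 5" and \<psi>x: "\<psi> x \<noteq> 1"
    and g: "g ^ 2 + S * g + L_coeff \<chi> 2 = 0"
  shows "g ^ 60 = of_nat CARD('a) ^ 30"
proof -
  let ?q = "of_nat CARD('a) :: complex"
  note num = numerals_char_5[OF five]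
  obtain \<theta> y where \<theta>: "additive_char \<theta>" "\<theta> y \<noteq> 1" "\<And>a. \<theta> (a ^ CHAR('a)) = \<theta> (a::'a)"
    using Frobenius_invariant_additive_char[OF r] by blast
  obtain l where l: "\<And>a. \<phi> a = \<theta> (l * a)"
    by (rule additive_char_dual[OF \<theta>(1,2) additive_\<phi>]) blast
  obtain m where m: "\<And>a. \<psi> a = \<theta> (m * a)"
    by (rule additive_char_dual[OF \<theta>(1,2) additive_\<psi>]) blast
  obtain k where k: "\<And>a. F a * (\<phi> (a ^ 2 / 2) * \<psi> (- (a ^ 3 / 3))) = \<theta> (k * a)"
    by (rule additive_char_dual[OF \<theta>(1,2) F_eq_cubic[OF num(2,3)]]) blast
  have m0: "m \<noteq> 0" using \<psi>x m[of x] additive_char_0[OF \<theta>(1)] by auto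
  define c where "c = m / 3"
  have c0: "c \<noteq> 0" using m0 num by (simp add: c_def)
  define P where "P = (\<lambda>a. k * a - l * (a ^ 2 / 2) + c * a ^ 3)"
  have F: "F a = \<theta> (P a)" for a
  proof -
    have "F a = \<theta> (k * a) * (\<phi> (- (a ^ 2 / 2)) * \<psi> (a ^ 3 / 3))"
      using k[of a] additive_char_nonzero[OF additive_\<phi>] additive_char_nonzero[OF additive_\<psi>]
      by (simp add: additive_char_minus[OF additive_\<phi>] additive_char_minus[OF additive_\<psi>] field_simps)
    also have "\<dots> = \<theta> (k * a + (l * - (a ^ 2 / 2) + m * (a ^ 3 / 3)))"
      by (simp only: l m additive_char_add[OF \<theta>(1)])
    also have "\<dots> = \<theta> (P a)" by (rule arg_cong[where f = \<theta>]) (simp add: P_def c_def)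
    finally show ?thesis .
  qed
  \<comment> \<open>The centre of symmetry of the cubic \<open>P\<close>: expanded at
    \<open>s\<close> it has no quadratic term.\<close>
  define s where "s = l / (2 * m)"
  define b where "b = k - l * s + 3 * c * s ^ 2"
  have lhalf: "l * (x / 2) = 3 * c * s * x" for x using m0 num by (simp add: s_def c_def)
  have shift: "P (s + a) = P s + (c * a ^ 3 + b * a)" for a
  proof -
    have "l * s = 2 * (l * (s / 2))" using num by simp
    also have "\<dots> = 6 * c * s * s" unfolding lhalf by simp
    finally have "l * s = 6 * c * s * s" .
    then show ?thesis
      unfolding P_def b_def lhalf by (simp add: power2_eq_square power3_eq_cube algebra_simps)
  qed
  have P0: "P 0 = 0" by (simp add: P_def)
  \<comment> \<open>By the symmetry about \<open>s\<close>, P 0 + P (2 s) = 2 P s. Therefore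
    \<theta> (P s) occurs once in S and squared in the constant coefficient, and can be scaled out
    of g.\<close>
  have "P (2 * s) = of_nat 2 * P s"
    using shift[of "- s"] shift[of s] P0 by (simp add: power3_eq_cube algebra_simps)
  then have F2s: "F (2 * s) = \<theta> (P s) ^ 2"
    unfolding F by (simp only: additive_char_of_nat_mult[OF \<theta>(1)])
  have "\<phi> d = \<psi> (2 * s * d)" for d using m0 num by (simp add: l m s_def)
  then have L2: "L_coeff \<chi> 2 = ?q * \<theta> (P s) ^ 2" using L_coeff_2_eq[OF \<psi>x] F2s by simp
  define T where "T = (\<Sum>x\<in>UNIV. \<theta> (c * x ^ 3 + b * x))"
  have "bij (\<lambda>a. s + a)" by (rule o_bij[of "\<lambda>h. h - s"]) auto
  then have "S = (\<Sum>a\<in>UNIV. F (s + a))" unfolding S_def by (rule sum.reindex_bij_betw[symmetric])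
  also have "\<dots> = \<theta> (P s) * T"
    unfolding F shift additive_char_add[OF \<theta>(1), of "P s"] by (simp add: T_def sum_distrib_left)
  finally have S: "S = \<theta> (P s) * T" .
  define u where "u = \<theta> (P s)"
  have u0: "u \<noteq> 0" by (simp add: u_def additive_char_nonzero[OF \<theta>(1)])
  have u5: "u ^ 5 = 1" using additive_char_power_CHAR[OF \<theta>(1)] five by (simp add: u_def)
  have "u ^ 2 * ((g / u) ^ 2 + T * (g / u) + ?q) = g ^ 2 + S * g + L_coeff \<chi> 2"
    using u0 by (simp add: S L2 u_def[symmetric] power2_eq_square field_simps)
  then have "(g / u) ^ 2 + T * (g / u) + ?q = 0" using g u0 by simp
  then have "(g / u) ^ 60 = ?q ^ 30" unfolding T_def by (rule cubic_sum_char_5[OF r five \<theta> c0])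
  moreover have "u ^ 60 = (u ^ 5) ^ 12" by (simp flip: power_mult)
  ultimately show ?thesis by (simp add: power_divide u5)
qed

subsection \<open>Periods for levels up to 3\<close>

lemma lessThan_2_3: "{..<2::nat} = {0, 1}" "{..<3::nat} = {0, 1, 2}"
  by auto

text \<open>The L-functions are constant, so there are no reciprocal roots at all.\<close>

lemma is_period_level_1: "is_period (normalized_error TYPE('a::{finite,field}) 1) 1"
proof (rule period_if_L_roots)
  fix \<chi> :: "'a poly \<Rightarrow> complex" and g
  assume "unit_char 1 \<chi>" "(\<Sum>j<1. L_coeff \<chi> j * g ^ (1 - 1 - j)) = 0"
  then have False using L_coeff_0[of 1 \<chi>] by simp
  then show "g ^ 1 = of_real (real CARD('a) powr (real 1 / 2))" ..
qed simp

lemma is_period_level_2: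
  assumes r: "CARD('a) = CHAR('a::{finite,field}) ^ r"
  shows "is_period (normalized_error TYPE('a) 2) (4 * CHAR('a))"
proof (rule period_if_L_roots)
  have p: "CHAR('a) > 0" using prime_CHAR_finite_field prime_gt_0_nat by blast
  then show "4 * CHAR('a) \<ge> 1" by simp
  fix \<chi> :: "'a poly \<Rightarrow> complex" and g
  assume *: "unit_char 2 \<chi>" "\<chi> \<noteq> principal_char" "g \<noteq> 0"
    "(\<Sum>j<2. L_coeff \<chi> j * g ^ (2 - 1 - j)) = 0"
  interpret level_3_char \<chi> by standard (use unit_char_mono[OF *(1)] in simp)
  have \<psi>1: "\<psi> c = 1" for c
  proof -
    have "\<chi> [:1, 0, 0, c:] = \<chi> 1"
      by (rule unit_char_cong[OF *(1)]) (auto simp: tcong_iff le_Suc_eq numeral_eq_Suc one_pCons)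
    then show ?thesis by (simp add: \<psi>_def unit_char_1[OF *(1)])
  qed
  have "g + S = 0" using *(4) unfolding lessThan_2_3
    by (simp add: L_coeff_0[OF *(1)] L_coeff_1_eq[simplified])
  then have g: "g = - S" by (simp add: eq_neg_iff_add_eq_0)
  then have "S \<noteq> 0" using *(3) by auto
  then have "S ^ (4 * CHAR('a)) = of_nat CARD('a) ^ (2 * CHAR('a))"
    by (rule sum_F_level_2[OF r \<psi>1 *(2)])
  then have "g ^ (4 * CHAR('a)) = of_nat CARD('a) ^ (2 * CHAR('a))"
    unfolding g by simp
  also have "\<dots> = of_real (real CARD('a) powr (real (4 * CHAR('a)) / 2))"
    using powr_realpow[of "real CARD('a)" "2 * CHAR('a)"] by simp
  finally show "g ^ (4 * CHAR('a)) = of_real (real CARD('a) powr (real (4 * CHAR('a)) / 2))" .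
qed

text \<open>The exponent 12p is 24 for p = 2 and 60 for p = 5, as found for nontrivial
  \<open>\<psi>\<close>; it is also a multiple of the exponent 4p of level 2.\<close>

lemma is_period_level_3:
  assumes r: "CARD('a) = CHAR('a::{finite,field}) ^ r" and p: "CHAR('a) \<in> {2, 5}"
  shows "is_period (normalized_error TYPE('a) 3) (12 * CHAR('a))"
proof (rule period_if_L_roots)
  show "12 * CHAR('a) \<ge> 1" using p by auto
  let ?q = "of_nat CARD('a) :: complex"
  fix \<chi> :: "'a poly \<Rightarrow> complex" and g
  assume *: "unit_char 3 \<chi>" "\<chi> \<noteq> principal_char" "g \<noteq> 0"
    "(\<Sum>j<3. L_coeff \<chi> j * g ^ (3 - 1 - j)) = 0"
  interpret level_3_char \<chi> by standard fact
  have eq: "g ^ 2 + S * g + L_coeff \<chi> 2 = 0" using *(4) unfolding lessThan_2_3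
    by (simp add: L_coeff_0[OF *(1)] L_coeff_1_eq[simplified] add.assoc)
  have "g ^ (12 * CHAR('a)) = ?q ^ (6 * CHAR('a))"
  proof (cases "\<forall>c. \<psi> c = 1")
    case True
    then have "L_coeff \<chi> 2 = 0" using L_coeff_eq_0[OF unit_char_2 *(2), of 2] by simp
    then have "g * (g + S) = 0" using eq by (simp add: power2_eq_square distrib_left mult.commute)
    then have g: "g = - S" using *(3) by (simp add: eq_neg_iff_add_eq_0)
    then have "S \<noteq> 0" using *(3) by auto
    then have "S ^ (4 * CHAR('a)) = ?q ^ (2 * CHAR('a))"
      using sum_F_level_2[OF r _ *(2)] True by blast
    then have "(S ^ (4 * CHAR('a))) ^ 3 = (?q ^ (2 * CHAR('a))) ^ 3" by (rule arg_cong)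
    then show ?thesis unfolding g by (simp add: mult.commute mult.left_commute flip: power_mult)
  next
    case False
    then obtain x where x: "\<psi> x \<noteq> 1" by blast
    show ?thesis
    proof (cases "CHAR('a) = 2")
      case True
      then show ?thesis using cubic_roots_char_2[OF r True x eq] by simp
    next
      case False
      then have "CHAR('a) = 5" using p by simp
      then show ?thesis using cubic_roots_char_5[OF r _ x eq] by simp
    qed
  qed
  also have "\<dots> = of_real (real CARD('a) powr (real (12 * CHAR('a)) / 2))"
    using powr_realpow[of "real CARD('a)" "6 * CHAR('a)"] by simp
  finally show "g ^ (12 * CHAR('a)) = of_real (real CARD('a) powr (real (12 * CHAR('a)) / 2))" .
qed

subsection \<open>Base change\<close>

lemma map_poly_mult_hom:
  fixes h :: "'a::comm_ring_1 \<Rightarrow> 'b::comm_ring_1"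
  assumes "h 0 = 0" "\<And>x y. h (x + y) = h x + h y" "\<And>x y. h (x * y) = h x * h y"
  shows "map_poly h (f * g) = map_poly h f * map_poly h g"
proof (rule poly_eqI)
  have sum: "h (sum u A) = (\<Sum>x\<in>A. h (u x))" for u and A :: "nat set"
    by (induction A rule: infinite_finite_induct) (auto simp: assms)
  fix n show "coeff (map_poly h (f * g)) n = coeff (map_poly h f * map_poly h g) n"
    by (simp add: coeff_map_poly assms coeff_mult sum)
qed

lemma map_poly_prod_hom:
  fixes h :: "'a::comm_ring_1 \<Rightarrow> 'b::comm_ring_1"
  assumes "h 0 = 0" "h 1 = 1" "\<And>x y. h (x + y) = h x + h y" "\<And>x y. h (x * y) = h x * h y"
  shows "map_poly h (prod f A) = (\<Prod>x\<in>A. map_poly h (f x))"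
  by (induction A rule: infinite_finite_induct) (auto simp: assms map_poly_mult_hom)

lemma map_poly_power_hom:
  fixes h :: "'a::comm_ring_1 \<Rightarrow> 'b::comm_ring_1"
  assumes "h 0 = 0" "h 1 = 1" "\<And>x y. h (x + y) = h x + h y" "\<And>x y. h (x * y) = h x * h y"
  shows "map_poly h (f ^ n) = map_poly h f ^ n"
  by (induction n) (auto simp: assms map_poly_mult_hom)

lemma poly_map_poly_hom:
  fixes h :: "'a::comm_ring_1 \<Rightarrow> 'b::comm_ring_1"
  assumes "h 0 = 0" "\<And>x y. h (x + y) = h x + h y" "\<And>x y. h (x * y) = h x * h y"
  shows "poly (map_poly h f) (h x) = h (poly f x)"
  by (induction f) (auto simp: assms map_poly_pCons)

lemma map_poly_reflect_hom:
  assumes "\<And>x. h x = 0 \<longleftrightarrow> x = 0"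
  shows "map_poly h (reflect_poly f) = reflect_poly (map_poly h f)"
proof (rule poly_eqI)
  have "h 0 = 0" using assms by simp
  moreover have "degree (map_poly h f) = degree f"
    by (rule degree_map_poly) (use assms in simp)
  ultimately show "coeff (map_poly h (reflect_poly f)) n = coeff (reflect_poly (map_poly h f)) n" for n
    by (simp add: coeff_map_poly coeff_reflect_poly)
qed

lemma prod_lessThan_add:
  "(\<Prod>i<m + n. f i) = (\<Prod>i<m. f i) * (\<Prod>i<n. f (m + i :: nat))"
  by (induction n) (simp_all add: mult.assoc)

text \<open>\<open>base_change\<close> uses this locale for the given field and for its prime
  subfield inside the same algebraic closure, so that both prime power sums become sums over one set
  of elements.\<close>

locale finite_field_closure =
  fixes \<iota> :: "'k::{finite,field} \<Rightarrow> 'b::alg_closed_field" and p r q :: nat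
  assumes hom: "\<iota> 0 = 0" "\<iota> 1 = 1" "\<iota> (x + y) = \<iota> x + \<iota> y" "\<iota> (x * y) = \<iota> x * \<iota> y"
    and card_q: "CARD('k) = q" and card: "q = p ^ r" and prime: "prime p"
begin

lemma \<iota>_eq_0 [simp]: "\<iota> x = 0 \<longleftrightarrow> x = 0"
proof
  assume "\<iota> x = 0"
  then show "x = 0" using hom(4)[of x "inverse x"] hom(2) by (cases "x = 0") auto
qed (simp add: hom)

lemma \<iota>_minus: "\<iota> (- x) = - \<iota> x"
  using hom(3)[of x "- x"] by (simp add: hom(1) eq_neg_iff_add_eq_0 add.commute)

lemma \<iota>_inj: "inj \<iota>"
proof (rule injI)
  fix x y assume "\<iota> x = \<iota> y"
  then have "\<iota> (x + - y) = 0" by (simp only: hom \<iota>_minus) simp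
  then show "x = y" by simp
qed

lemma \<iota>_eq_iff [simp]: "\<iota> x = \<iota> y \<longleftrightarrow> x = y"
  using \<iota>_inj by (auto dest: injD)

lemma \<iota>_power: "\<iota> (x ^ n) = \<iota> x ^ n"
  by (induction n) (auto simp: hom)

lemma CHAR_b: "CHAR('b) = p"
proof -
  have \<iota>n: "\<iota> (of_nat n) = of_nat n" for n by (induction n) (auto simp: hom)
  have "of_nat n = (0::'b) \<longleftrightarrow> of_nat n = (0::'k)" for n using \<iota>_eq_0[of "of_nat n"] by (simp add: \<iota>n)
  then have "CHAR('b) = CHAR('k)" by (intro CHAR_eqI) (auto simp: of_nat_eq_0_iff_char_dvd)
  then show ?thesis using CHAR_eq_of_CARD[OF _ prime] card_q card by simp
qed

lemma frob_add: "(x + y) ^ (q ^ n) = x ^ (q ^ n) + y ^ (q ^ n)" for x y :: 'b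
  by (rule freshmans_dream'[of _ "r * n"]) (use CHAR_b card prime in \<open>auto simp: power_mult\<close>)

lemma q_gt_1: "q > 1"
  using card_mono[of UNIV "{0, 1::'k}"] by (simp add: card_q)

lemma frob_0: "(0::'b) ^ (q ^ n) = 0"
  using q_gt_1 by (simp add: power_0_left)

lemma frob_minus: "(- x) ^ (q ^ n) = - (x ^ (q ^ n))" for x :: 'b
  using frob_add[of x "- x" n] frob_0[of n] by (simp add: eq_neg_iff_add_eq_0 add.commute)

lemma frob_inj: "x ^ (q ^ n) = y ^ (q ^ n) \<Longrightarrow> x = y" for x y :: 'b
proof -
  assume "x ^ (q ^ n) = y ^ (q ^ n)"
  then have "(x + - y) ^ (q ^ n) = 0" by (simp only: frob_add frob_minus) simp
  then show "x = y" by simp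
qed

lemma frob_frob: "(x ^ (q ^ m)) ^ (q ^ n) = x ^ (q ^ (m + n))" for x :: 'b
  by (simp add: power_add flip: power_mult)

lemma range_\<iota>: "x ^ q = x \<longleftrightarrow> x \<in> range \<iota>"
proof -
  define f where "f = monom (1::'b) q - monom 1 1"
  note q1 = q_gt_1
  have "coeff f q = 1" using q1 by (simp add: f_def)
  then have f0: "f \<noteq> 0" by auto
  have "degree f \<le> q" unfolding f_def
    by (intro degree_diff_le order.trans[OF degree_monom_le]) (use q1 in auto)
  then have "card {x. poly f x = 0} \<le> q" using card_poly_roots_bound[OF f0] by simp
  moreover have "range \<iota> \<subseteq> {x. poly f x = 0}"
    by (auto simp: f_def poly_monom power_CARD_eq_same[where 'a = 'k, unfolded card_q] simp flip: \<iota>_power)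
  moreover have "card (range \<iota>) = q" using card_image[OF \<iota>_inj] by (simp add: card_q)
  ultimately have "range \<iota> = {x. poly f x = 0}"
    using poly_roots_finite[OF f0] by (intro card_seteq) auto
  then show ?thesis by (auto simp: f_def poly_monom)
qed

lemma \<iota>_frob: "\<iota> x ^ (q ^ n) = \<iota> x"
proof (induction n)
  case (Suc n)
  have "\<iota> x ^ q ^ Suc n = (\<iota> x ^ q) ^ q ^ n" by (simp flip: power_mult)
  then show ?case using Suc range_\<iota>[of "\<iota> x"] by simp
qed simp

definition lift :: "'k poly \<Rightarrow> 'b poly" where "lift = map_poly \<iota>"

lemma lift_mult: "lift (f * g) = lift f * lift g"
  unfolding lift_def by (rule map_poly_mult_hom) (simp_all add: hom)

lemma lift_power: "lift (f ^ n) = lift f ^ n"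
  unfolding lift_def by (rule map_poly_power_hom) (simp_all add: hom)

lemma coeff_lift: "coeff (lift f) i = \<iota> (coeff f i)"
  by (simp add: lift_def coeff_map_poly hom)

lemma degree_lift: "degree (lift f) = degree f"
  unfolding lift_def by (rule degree_map_poly) simp

lemma lift_inj: "lift f = lift g \<Longrightarrow> f = g"
  by (auto simp: poly_eq_iff coeff_lift)

lemma lift_eq_0: "lift f = 0 \<longleftrightarrow> f = 0"
  by (auto simp: poly_eq_iff coeff_lift)

lemma frob_poly_lift: "poly (lift f) (x ^ (q ^ n)) = poly (lift f) x ^ (q ^ n)"
proof -
  have "map_poly (\<lambda>x. x ^ (q ^ n)) (lift f) = lift f"
    by (rule poly_eqI) (simp add: coeff_map_poly frob_0 coeff_lift \<iota>_frob)
  moreover have "poly (map_poly (\<lambda>x. x ^ (q ^ n)) (lift f)) (x ^ (q ^ n)) = poly (lift f) x ^ (q ^ n)"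
    by (rule poly_map_poly_hom[of "\<lambda>x. x ^ (q ^ n)"]) (simp_all add: frob_0 frob_add power_mult_distrib)
  ultimately show ?thesis by simp
qed

text \<open>The characteristic polynomial of x as an element of the extension of degree n:
  conjugates under the q-Frobenius, counted with repetition.\<close>

definition charpoly :: "nat \<Rightarrow> 'b \<Rightarrow> 'b poly" where
  "charpoly n x = (\<Prod>i<n. [:- (x ^ (q ^ i)), 1:])"

lemma degree_charpoly: "degree (charpoly n x) = n"
  and lead_coeff_charpoly: "lead_coeff (charpoly n x) = 1"
proof -
  have nz: "charpoly n x \<noteq> 0" by (simp add: charpoly_def)
  show "degree (charpoly n x) = n"
    unfolding charpoly_def by (subst degree_prod_eq_sum_degree) auto
  show "lead_coeff (charpoly n x) = 1"
    unfolding charpoly_def lead_coeff_prod by simp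
qed

lemma poly_charpoly_eq_0: "poly (charpoly n x) y = 0 \<longleftrightarrow> (\<exists>i<n. y = x ^ (q ^ i))"
  by (auto simp: charpoly_def poly_prod)

text \<open>The q-Frobenius permutes the factors cyclically, so it fixes the coefficients, and its
  fixed points are the image of \<iota>.\<close>

lemma charpoly_descends:
  assumes "x ^ (q ^ n) = x"
  obtains f where "f \<in> monic_polys n" "lift f = charpoly n x"
proof -
  have "map_poly (\<lambda>x. x ^ q) (charpoly n x) = (\<Prod>i<n. map_poly (\<lambda>x. x ^ q) [:- (x ^ (q ^ i)), 1:])"
    unfolding charpoly_def
    by (rule map_poly_prod_hom[of "\<lambda>x. x ^ q"])
       (use frob_add[of _ _ 1] frob_0[of 1] in \<open>simp_all add: power_mult_distrib\<close>)
  also have "\<dots> = (\<Prod>i<n. [:- (x ^ (q ^ Suc i)), 1:])"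
    using frob_minus[of _ 1] frob_0[of 1] by (simp add: map_poly_pCons mult.commute flip: power_mult)
  also have "\<dots> = charpoly n x"
  proof (cases n)
    case (Suc m)
    have "(\<Prod>i<Suc m. [:- (x ^ (q ^ Suc i)), 1:]) = (\<Prod>i<m. [:- (x ^ (q ^ Suc i)), 1:]) * [:- (x ^ q ^ Suc m), 1:]"
      by (rule prod.lessThan_Suc)
    also have "[:- (x ^ q ^ Suc m), 1:] = [:- (x ^ q ^ 0), 1:]" using assms by (simp add: Suc)
    finally show ?thesis unfolding charpoly_def Suc prod.lessThan_Suc_shift by (simp only: mult.commute)
  qed (simp add: charpoly_def)
  finally have fixed: "map_poly (\<lambda>x. x ^ q) (charpoly n x) = charpoly n x" .
  have "coeff (charpoly n x) i \<in> range \<iota>" for i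
  proof -
    have "coeff (charpoly n x) i ^ q = coeff (charpoly n x) i"
      using arg_cong[OF fixed, of "\<lambda>f. coeff f i"] frob_0[of 1] by (simp add: coeff_map_poly)
    then show ?thesis by (simp add: range_\<iota>)
  qed
  then have inv: "\<iota> (inv_into UNIV \<iota> (coeff (charpoly n x) i)) = coeff (charpoly n x) i" for i
    by (rule f_inv_into_f)
  define f where "f = map_poly (inv_into UNIV \<iota>) (charpoly n x)"
  have "inv_into UNIV \<iota> 0 = 0" using inv_into_f_f[OF \<iota>_inj UNIV_I, of 0] by (simp add: hom)
  then have f: "lift f = charpoly n x"
    by (intro poly_eqI) (simp add: coeff_lift f_def coeff_map_poly inv)
  have "degree f = n" using degree_lift[of f] degree_charpoly f by simp
  moreover have "\<iota> (lead_coeff f) = \<iota> 1"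
    using lead_coeff_charpoly[of n x] unfolding f[symmetric] degree_lift coeff_lift by (simp add: hom)
  then have "lead_coeff f = 1" by (simp only: \<iota>_eq_iff)
  ultimately have "f \<in> monic_polys n" by (simp add: monic_polys_def)
  then show ?thesis using that f by blast
qed

lemma frob_multiple: "x ^ (q ^ m) = x \<Longrightarrow> x ^ (q ^ (m * k)) = x" for x :: 'b
  by (induction k) (simp_all add: frob_frob[symmetric])

text \<open>The degree of x over the field with q elements, as the length of its Frobenius
  orbit.\<close>

definition period :: "'b \<Rightarrow> nat" where
  "period x = (LEAST m. m \<ge> 1 \<and> x ^ (q ^ m) = x)"

context
  fixes x :: 'b and n :: nat
  assumes n: "n \<ge> 1" and xn: "x ^ (q ^ n) = x"
begin

lemma period: "period x \<ge> 1" "x ^ (q ^ period x) = x"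
  using LeastI[of "\<lambda>m. m \<ge> 1 \<and> x ^ (q ^ m) = x", OF conjI[OF n xn]] by (auto simp: period_def)

lemma period_le: "m \<ge> 1 \<Longrightarrow> x ^ (q ^ m) = x \<Longrightarrow> period x \<le> m"
  unfolding period_def by (rule Least_le) simp

lemma period_dvd: "period x dvd n"
proof (rule ccontr)
  assume "\<not> period x dvd n"
  then have 1: "n mod period x \<ge> 1" by (simp add: dvd_eq_mod_eq_0 Suc_le_eq)
  have "x ^ (q ^ n) = (x ^ (q ^ (period x * (n div period x)))) ^ (q ^ (n mod period x))"
    by (simp only: frob_frob mult_div_mod_eq)
  then have "x ^ (q ^ (n mod period x)) = x" using xn frob_multiple[OF period(2)] by simp
  then have "period x \<le> n mod period x" using 1 by (intro period_le)
  then show False using period(1) mod_less_divisor[of "period x" n] by linarith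
qed

lemma conjugates_distinct: "inj_on (\<lambda>i. x ^ (q ^ i)) {..<period x}"
proof (rule linorder_inj_onI)
  fix i j assume ij: "i < j" "j \<in> {..<period x}"
  show "x ^ q ^ i \<noteq> x ^ q ^ j"
  proof
    assume "x ^ q ^ i = x ^ q ^ j"
    also have "\<dots> = (x ^ q ^ (j - i)) ^ q ^ i" using ij by (simp only: frob_frob) simp
    finally have "x ^ q ^ (j - i) = x" using frob_inj by metis
    then have "period x \<le> j - i" using ij by (intro period_le) auto
    then show False using ij by simp
  qed
qed auto

lemma degree_ge_period:
  assumes "f \<noteq> 0" "poly (lift f) x = 0"
  shows "degree f \<ge> period x"
proof -
  have "(\<lambda>i. x ^ (q ^ i)) ` {..<period x} \<subseteq> {y. poly (lift f) y = 0}"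
    using assms(2) by (auto simp: frob_poly_lift frob_0)
  moreover have f0: "lift f \<noteq> 0" using assms(1) by (simp add: lift_eq_0)
  ultimately have "card ((\<lambda>i. x ^ (q ^ i)) ` {..<period x}) \<le> degree (lift f)"
    using card_mono[OF poly_roots_finite[OF f0]] card_poly_roots_bound[OF f0] order.trans by blast
  then show ?thesis by (simp add: card_image[OF conjugates_distinct] degree_lift)
qed

lemma minimal_polynomial:
  obtains M where "lead_coeff M = 1" "irreducible M" "lift M = charpoly (period x) x"
    "degree M = period x"
proof -
  obtain M where M: "M \<in> monic_polys (period x)" "lift M = charpoly (period x) x"
    using charpoly_descends[OF period(2)] by blast
  have deg: "degree M = period x" "lead_coeff M = 1" using M by (auto simp: monic_polys_def)
  have M0: "M \<noteq> 0" using deg(2) by auto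
  have root: "poly (lift M) x = 0"
    unfolding M(2) poly_charpoly_eq_0 using period(1) by (intro exI[of _ 0]) auto
  have "irreducible M"
  proof (rule irreducibleI)
    show "M \<noteq> 0" by fact
    show "\<not> is_unit M" using deg period(1) M0 by (simp add: is_unit_iff_degree)
    fix A B assume AB: "M = A * B"
    then have nz: "A \<noteq> 0" "B \<noteq> 0" using M0 by auto
    have d: "degree A + degree B = period x" using AB nz deg by (simp add: degree_mult_eq)
    have "poly (lift A) x = 0 \<or> poly (lift B) x = 0" using root by (simp add: AB lift_mult)
    then show "is_unit A \<or> is_unit B"
      using degree_ge_period[OF nz(1)] degree_ge_period[OF nz(2)] d nz
      by (auto simp: is_unit_iff_degree)
  qed
  then show ?thesis using that M deg by blast
qed

end

lemma charpoly_multiple: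
  assumes "x ^ (q ^ m) = x"
  shows "charpoly (m * k) x = charpoly m x ^ k"
proof (induction k)
  case (Suc k)
  have "charpoly (m * Suc k) x = charpoly (m * k) x * (\<Prod>i<m. [:- (x ^ (q ^ (m * k + i))), 1:])"
    unfolding charpoly_def by (simp add: add.commute[of m] prod_lessThan_add)
  also have "(\<Prod>i<m. [:- (x ^ (q ^ (m * k + i))), 1:]) = charpoly m x"
    unfolding charpoly_def frob_frob[symmetric] using frob_multiple[OF assms] by simp
  finally show ?case using Suc by (simp add: mult.commute)
qed (simp add: charpoly_def)

lemma irreducible_root:
  assumes P: "lead_coeff P = 1" "irreducible P" and x: "poly (lift P) x = 0"
  shows "x ^ (q ^ degree P) = x" "lift P = charpoly (degree P) x" "degree P = period x"
proof -
  have P0: "P \<noteq> 0" using P by auto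
  have f0: "lift P \<noteq> 0" using P0 by (simp add: lift_eq_0)
  \<comment> \<open>The orbit of x lies in the finite set of roots, so it repeats; since Frobenius
    is injective, it returns to x itself.\<close>
  have "(\<lambda>i. x ^ (q ^ i)) ` UNIV \<subseteq> {y. poly (lift P) y = 0}"
    using x by (auto simp: frob_poly_lift frob_0)
  then have "finite ((\<lambda>i::nat. x ^ (q ^ i)) ` UNIV)"
    using poly_roots_finite[OF f0] finite_subset by blast
  then have "\<not> inj (\<lambda>i::nat. x ^ (q ^ i))" using finite_imageD infinite_UNIV_nat by blast
  then obtain i j :: nat where "i < j" and ij: "x ^ (q ^ i) = x ^ (q ^ j)"
    unfolding inj_def by (metis nat_neq_iff)
  have "x ^ q ^ j = (x ^ q ^ (j - i)) ^ q ^ i" using \<open>i < j\<close> by (simp only: frob_frob) simp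
  then have "x ^ q ^ (j - i) = x" using frob_inj ij by metis
  moreover have "j - i \<ge> 1" using \<open>i < j\<close> by simp
  ultimately have n: "j - i \<ge> 1" "x ^ q ^ (j - i) = x" by auto
  obtain M where M: "lead_coeff M = 1" "irreducible M" "lift M = charpoly (period x) x"
    "degree M = period x"
    using minimal_polynomial[OF n] by blast
  have "P mod M = 0"
  proof (rule ccontr)
    assume nz: "P mod M \<noteq> 0"
    have M0: "M \<noteq> 0" using M by auto
    have root: "poly (lift M) x = 0"
      unfolding M(3) poly_charpoly_eq_0 using period(1)[OF n] by (intro exI[of _ 0]) auto
    have add: "lift (f + g) = lift f + lift g" for f g
      by (rule poly_eqI) (simp add: coeff_lift hom)
    have "lift P = lift (P div M) * lift M + lift (P mod M)"
      by (simp only: add[symmetric] lift_mult[symmetric] div_mult_mod_eq)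
    then have "poly (lift (P mod M)) x = 0" using x root by simp
    then have "degree (P mod M) \<ge> degree M" using degree_ge_period[OF n nz] M(4) by simp
    then show False using degree_mod_less[OF M0, of P] nz by simp
  qed
  then have "M dvd P" by (simp add: mod_eq_0_iff_dvd)
  then have "M = P" using monic_dvd_monic_irreducible M P by blast
  then show "x ^ (q ^ degree P) = x" "lift P = charpoly (degree P) x" "degree P = period x"
    using M period(2)[OF n] by auto
qed

text \<open>The characteristic polynomial of x is a power of its minimal polynomial. So for f = P ^
  k the elements counted are the deg P distinct roots of P, and for other f there are none.\<close>

lemma poly_mangoldt_eq_card:
  assumes n: "n \<ge> 1" and f: "f \<in> monic_polys n"
  shows "poly_mangoldt f = card {x. x ^ (q ^ n) = x \<and> charpoly n x = lift f}"
proof (cases "\<exists>P k. lead_coeff P = 1 \<and> irreducible P \<and> k \<ge> 1 \<and> f = P ^ k")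
  case True
  then obtain P k where P: "lead_coeff P = 1" "irreducible P" "k \<ge> 1" "f = P ^ k" by blast
  have P0: "P \<noteq> 0" using P by auto
  have deg: "n = degree P * k"
    using f by (auto simp: monic_polys_def P(4) degree_power_eq[OF P0] mult.commute)
  have dP: "degree P > 0" using n deg by (cases "degree P") auto
  have iff: "x ^ (q ^ n) = x \<and> charpoly n x = lift f \<longleftrightarrow> poly (lift P) x = 0" for x
  proof
    assume "poly (lift P) x = 0"
    note R = irreducible_root[OF P(1,2) this]
    show "x ^ (q ^ n) = x \<and> charpoly n x = lift f"
      unfolding deg P(4) lift_power R(2) using frob_multiple[OF R(1)] charpoly_multiple[OF R(1)] by simp
  next
    assume "x ^ (q ^ n) = x \<and> charpoly n x = lift f"
    then have "poly (lift f) x = 0"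
      using n poly_charpoly_eq_0[of n x x] by (metis One_nat_def Suc_le_eq power_0 power_one_right)
    then show "poly (lift P) x = 0" using P(3) by (simp add: P(4) lift_power)
  qed
  obtain x where x: "poly (lift P) x = 0"
    using alg_closed_imp_poly_has_root[of "lift P"] dP by (auto simp: degree_lift)
  note R = irreducible_root[OF P(1,2) x]
  have "{x. x ^ (q ^ n) = x \<and> charpoly n x = lift f} = (\<lambda>i. x ^ (q ^ i)) ` {..<degree P}"
    unfolding iff R(2) poly_charpoly_eq_0 by auto
  also have "card \<dots> = degree P"
    using conjugates_distinct[of "degree P" x] dP R by (simp add: card_image Suc_le_eq)
  finally show ?thesis using poly_mangoldt_power[OF P(1-3)] P(4) by simp
next
  case False
  have "\<not> (x ^ (q ^ n) = x \<and> charpoly n x = lift f)" for x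
  proof
    assume *: "x ^ (q ^ n) = x \<and> charpoly n x = lift f"
    then have xn: "x ^ (q ^ n) = x" by simp
    obtain M where M: "lead_coeff M = 1" "irreducible M" "lift M = charpoly (period x) x"
      using minimal_polynomial[OF n xn] by blast
    obtain k where k: "n = period x * k" using period_dvd[OF n xn] by blast
    have "lift f = lift (M ^ k)"
      using * charpoly_multiple[OF period(2)[OF n xn], of k] by (simp add: k[symmetric] lift_power M(3))
    then have "f = M ^ k" by (rule lift_inj)
    moreover have "k \<ge> 1" using k n by (cases k) auto
    ultimately show False using False M by blast
  qed
  then have empty: "{x. x ^ (q ^ n) = x \<and> charpoly n x = lift f} = {}" by blast
  show ?thesis unfolding empty using poly_mangoldt_eq_0[OF False] by simp
qed

text \<open>Replaces the sum over prime powers by a sum over an extension field, which the two base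
  fields of \<open>base_change\<close> share. The \<open>THE\<close> denotes the descended
  characteristic polynomial.\<close>

lemma mangoldt_sum_eq_sum_elements:
  assumes n: "n \<ge> 1"
  shows "mangoldt_sum h n = (\<Sum>x | x ^ (q ^ n) = x. h (THE f. lift f = charpoly n x))"
proof -
  have fin: "finite {x::'b. x ^ (q ^ n) = x}"
  proof -
    define f where "f = monom (1::'b) (q ^ n) - monom 1 1"
    have "q ^ n > 1" using q_gt_1 n by (intro one_less_power) auto
    then have "coeff f (q ^ n) = 1" by (simp add: f_def)
    then have "f \<noteq> 0" by auto
    from poly_roots_finite[OF this] show ?thesis by (simp add: f_def poly_monom)
  qed
  have the: "(THE g. lift g = lift f) = f" for f using lift_inj by blast
  have "(\<Sum>x | x ^ (q ^ n) = x. h (THE f. lift f = charpoly n x)) =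
    (\<Sum>f\<in>monic_polys n. \<Sum>x | x ^ (q ^ n) = x \<and> (THE f. lift f = charpoly n x) = f.
        h (THE f. lift f = charpoly n x))"
  proof (subst sum.group[symmetric])
    show "(\<lambda>x. THE f. lift f = charpoly n x) ` {x. x ^ (q ^ n) = x} \<subseteq> monic_polys n"
    proof (rule image_subsetI)
      fix x :: 'b assume "x \<in> {x. x ^ (q ^ n) = x}"
      then obtain f where "f \<in> monic_polys n" "lift f = charpoly n x" using charpoly_descends by blast
      then show "(THE f. lift f = charpoly n x) \<in> monic_polys n" using the[of f] by simp
    qed
  qed (use fin finite_monic_polys in simp_all)
  also have "\<dots> = (\<Sum>f\<in>monic_polys n. \<Sum>x | x ^ (q ^ n) = x \<and> charpoly n x = lift f. h f)"
  proof (rule sum.cong[OF refl], rule sum.cong)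
    fix f :: "'k poly"
    show "{x. x ^ q ^ n = x \<and> (THE f. lift f = charpoly n x) = f} = {x. x ^ q ^ n = x \<and> charpoly n x = lift f}"
    proof (intro Collect_cong conj_cong refl)
      fix x :: 'b assume "x ^ q ^ n = x"
      then obtain g where "lift g = charpoly n x" using charpoly_descends by blast
      then show "((THE f. lift f = charpoly n x) = f) = (charpoly n x = lift f)"
        using the[of g] lift_inj[of g f] by auto
    qed
  qed (auto simp: the)
  also have "\<dots> = (\<Sum>f\<in>monic_polys n. of_nat (poly_mangoldt f) * h f)"
    by (rule sum.cong) (simp_all add: poly_mangoldt_eq_card[OF n])
  finally show ?thesis by (simp add: mangoldt_sum_def)
qed

end

text \<open>The prime field has to be a type of its own for characters of its polynomials to fall
  under the general definitions.\<close>

typedef (overloaded) 'a prime_subfield = "{x :: 'a::{finite,field}. x ^ CHAR('a) = x}"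
  using prime_CHAR_finite_field prime_gt_0_nat by (intro exI[of _ 0]) (auto simp: power_0_left)

setup_lifting type_definition_prime_subfield

instantiation prime_subfield :: ("{finite,field}") field
begin

lift_definition zero_prime_subfield :: "'a prime_subfield" is 0
  using prime_CHAR_finite_field[where 'a = 'a] prime_gt_0_nat by (auto simp: power_0_left)

lift_definition one_prime_subfield :: "'a prime_subfield" is 1
  by simp

lift_definition plus_prime_subfield :: "'a prime_subfield \<Rightarrow> 'a prime_subfield \<Rightarrow> 'a prime_subfield" is "(+)"
  by (simp add: freshmans_dream[OF prime_CHAR_finite_field refl])

lift_definition uminus_prime_subfield :: "'a prime_subfield \<Rightarrow> 'a prime_subfield" is uminus
proof -
  fix x :: 'a assume x: "x ^ CHAR('a) = x"
  have "(x + - x) ^ CHAR('a) = x + (- x) ^ CHAR('a)"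
    by (simp only: freshmans_dream[OF prime_CHAR_finite_field refl] x)
  moreover have "(0::'a) ^ CHAR('a) = 0"
    using prime_CHAR_finite_field[where 'a = 'a] prime_gt_0_nat by (auto simp: power_0_left)
  ultimately show "(- x) ^ CHAR('a) = - x" by (simp add: eq_neg_iff_add_eq_0 add.commute)
qed

lift_definition minus_prime_subfield :: "'a prime_subfield \<Rightarrow> 'a prime_subfield \<Rightarrow> 'a prime_subfield" is "\<lambda>x y. x + - y"
proof -
  fix x y :: 'a assume x: "x ^ CHAR('a) = x" "y ^ CHAR('a) = y"
  have "(y + - y) ^ CHAR('a) = y + (- y) ^ CHAR('a)"
    by (simp only: freshmans_dream[OF prime_CHAR_finite_field refl] x)
  moreover have "(0::'a) ^ CHAR('a) = 0"
    using prime_CHAR_finite_field[where 'a = 'a] prime_gt_0_nat by (auto simp: power_0_left)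
  ultimately have "(- y) ^ CHAR('a) = - y" by (simp add: eq_neg_iff_add_eq_0 add.commute)
  then show "(x + - y) ^ CHAR('a) = x + - y"
    by (simp only: freshmans_dream[OF prime_CHAR_finite_field refl] x)
qed

lift_definition times_prime_subfield :: "'a prime_subfield \<Rightarrow> 'a prime_subfield \<Rightarrow> 'a prime_subfield" is "(*)"
  by (simp add: power_mult_distrib)

lift_definition inverse_prime_subfield :: "'a prime_subfield \<Rightarrow> 'a prime_subfield" is inverse
  by (simp add: power_inverse)

lift_definition divide_prime_subfield :: "'a prime_subfield \<Rightarrow> 'a prime_subfield \<Rightarrow> 'a prime_subfield" is "(/)"
  by (simp add: power_divide)

instance
  by standard (transfer; simp add: algebra_simps divide_inverse)+

end

instance prime_subfield :: ("{finite,field}") finite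
proof
  have "inj (Rep_prime_subfield :: 'a prime_subfield \<Rightarrow> 'a)"
    by (simp add: inj_on_def Rep_prime_subfield_inject)
  then show "finite (UNIV :: 'a prime_subfield set)" by (rule finite_imageD[rotated]) simp
qed

lemma CARD_prime_subfield: "CARD('a::{finite,field} prime_subfield) = CHAR('a)"
proof -
  let ?p = "CHAR('a)"
  have p: "?p > 0" using prime_CHAR_finite_field prime_gt_0_nat by blast
  have inj: "inj (Rep_prime_subfield :: 'a prime_subfield \<Rightarrow> 'a)"
    by (simp add: inj_on_def Rep_prime_subfield_inject)
  have r: "range (Rep_prime_subfield :: 'a prime_subfield \<Rightarrow> 'a) = {x. x ^ ?p = x}"
    by (rule type_definition.Rep_range[OF type_definition_prime_subfield])
  have mod: "(of_nat n :: 'a) = of_nat (n mod ?p)" for n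
    by (simp add: of_nat_eq_iff_cong_CHAR cong_def)
  have "{x :: 'a. x ^ ?p = x} = of_nat ` {..<?p}"
  proof (intro equalityI subsetI)
    fix x :: 'a assume "x \<in> {x. x ^ ?p = x}"
    then obtain k where "x = of_nat k" using fixed_by_Frobenius_imp_of_nat[of x] by auto
    then have "x = of_nat (k mod ?p)" using mod by metis
    then show "x \<in> of_nat ` {..<?p}" using p by auto
  next
    fix x :: 'a assume "x \<in> of_nat ` {..<?p}"
    then obtain n where x: "x = of_nat n" by auto
    have "(of_nat n :: 'a) ^ ?p = of_nat n"
      by (induction n) (use p in \<open>simp_all add: freshmans_dream[OF prime_CHAR_finite_field refl] power_0_left\<close>)
    then show "x \<in> {x. x ^ ?p = x}" by (simp add: x)
  qed
  moreover have "inj_on (of_nat :: nat \<Rightarrow> 'a) {..<?p}"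
    by (auto simp: inj_on_def of_nat_eq_iff_cong_CHAR cong_def)
  ultimately have "card {x :: 'a. x ^ ?p = x} = ?p" by (simp add: card_image)
  then show ?thesis using card_image[OF inj] by (simp add: r)
qed

lemma prod_lessThan_mult:
  "(\<Prod>k<r * n. F k) = (\<Prod>i<n. \<Prod>j<r. F (r * i + j :: nat))"
proof (induction n)
  case (Suc n)
  have "(\<Prod>k<r * Suc n. F k) = (\<Prod>k<r * n + r. F k)" by (simp add: add.commute)
  then show ?case using Suc by (simp only: prod_lessThan_add prod.lessThan_Suc)
qed simp

text \<open>Composing with the norm turns characters over the prime field into characters over the
  given field, and the reciprocal roots of the L-function get replaced by their \<open>r\<close>-th powers.\<close>

lemma base_change:
  fixes \<chi>0 :: "'a::{finite,field} prime_subfield poly \<Rightarrow> complex"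
  assumes card: "CARD('a) = p ^ r" and prime: "prime p" and r: "r \<ge> 1" and c0: "unit_char l \<chi>0"
  obtains \<chi> :: "'a poly \<Rightarrow> complex" where "unit_char l \<chi>"
    "\<And>n. n \<ge> 1 \<Longrightarrow> prime_power_sum \<chi> n = prime_power_sum \<chi>0 (r * n)"
proof -
  have char: "CHAR('a) = p" by (rule CHAR_eq_of_CARD[OF card prime])
  let ?R = "Rep_prime_subfield :: 'a prime_subfield \<Rightarrow> 'a"
  have R: "?R 0 = 0" "?R 1 = 1" "?R (x + y) = ?R x + ?R y" "?R (x * y) = ?R x * ?R y" for x y
    by (transfer; simp)+
  have R_range: "x ^ p = x \<longleftrightarrow> x \<in> range ?R" for x
    using type_definition.Rep_range[OF type_definition_prime_subfield] char by blast
  have R_inj: "inj ?R" by (simp add: inj_on_def Rep_prime_subfield_inject)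
  interpret A: finite_field_closure "to_ac :: 'a \<Rightarrow> 'a alg_closure" p r "p ^ r"
    by standard (simp_all add: card prime)
  interpret B: finite_field_closure "\<lambda>x. to_ac (?R x)" p 1 p
    by standard (simp_all add: R prime CARD_prime_subfield char)
  have frob: "(x + y) ^ (p ^ j) = x ^ (p ^ j) + y ^ (p ^ j)" for x y :: 'a and j
    by (rule freshmans_dream'[of _ j]) (simp_all add: char prime)
  have p0: "p > 0" using prime prime_gt_0_nat by blast
  have frob0: "(0::'a) ^ (p ^ j) = 0" for j using p0 by (simp add: power_0_left)
  define \<Phi> where "\<Phi> = (\<lambda>j. map_poly (\<lambda>x::'a. x ^ (p ^ j)))"
  have \<Phi>_mult: "\<Phi> j (f * g) = \<Phi> j f * \<Phi> j g" for j f g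
    unfolding \<Phi>_def by (rule map_poly_mult_hom) (simp_all add: frob frob0 power_mult_distrib)
  have \<Phi>_prod: "\<Phi> k (\<Prod>j\<in>J. u j) = (\<Prod>j\<in>J. \<Phi> k (u j))" for k u and J :: "nat set"
    unfolding \<Phi>_def
    by (rule map_poly_prod_hom) (simp_all add: frob frob0 power_mult_distrib)
  have coeff_\<Phi>: "coeff (\<Phi> j f) i = coeff f i ^ (p ^ j)" for j f i
    by (simp add: \<Phi>_def coeff_map_poly frob0)
  have \<Phi>\<Phi>: "\<Phi> 1 (\<Phi> j f) = \<Phi> (Suc j) f" for j f
    by (rule poly_eqI) (simp add: coeff_\<Phi> mult.commute flip: power_mult)
  have \<Phi>r: "\<Phi> r f = \<Phi> 0 f" for f
    by (rule poly_eqI) (simp add: coeff_\<Phi> power_CARD_eq_same[where 'a = 'a, unfolded card])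
  \<comment> \<open>The product of the coefficientwise Frobenius conjugates: the norm of polynomials
    to the prime field.\<close>
  define norm where "norm = (\<lambda>f. \<Prod>j<r. \<Phi> j f)"
  have norm_mult: "norm (f * g) = norm f * norm g" for f g
    by (simp add: norm_def \<Phi>_mult prod.distrib)
  have norm_fixed: "\<Phi> 1 (norm f) = norm f" for f
  proof -
    obtain m where m: "r = Suc m" using r by (cases r) auto
    have "\<Phi> 1 (norm f) = (\<Prod>j<r. \<Phi> 1 (\<Phi> j f))"
      unfolding norm_def by (rule \<Phi>_prod)
    also have "\<dots> = (\<Prod>j<Suc m. \<Phi> (Suc j) f)" by (simp only: \<Phi>\<Phi> m)
    also have "\<dots> = (\<Prod>j<m. \<Phi> (Suc j) f) * \<Phi> r f" by (simp only: prod.lessThan_Suc m)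
    also have "\<dots> = norm f"
      unfolding \<Phi>r norm_def unfolding m prod.lessThan_Suc_shift by (rule mult.commute)
    finally show ?thesis .
  qed
  define emb where "emb = map_poly ?R"
  have coeff_emb: "coeff (emb g) i = ?R (coeff g i)" for g i by (simp add: emb_def coeff_map_poly R)
  have emb_inj: "emb f = emb g \<Longrightarrow> f = g" for f g
    by (auto simp: poly_eq_iff coeff_emb Rep_prime_subfield_inject)
  have emb_mult: "emb (f * g) = emb f * emb g" for f g
    unfolding emb_def by (rule map_poly_mult_hom) (simp_all add: R)
  have "\<exists>g. emb g = norm f" for f
  proof -
    have "coeff (norm f) i \<in> range ?R" for i
      using arg_cong[OF norm_fixed[of f], of "\<lambda>f. coeff f i"] by (simp add: coeff_\<Phi> R_range)
    then have "?R (inv_into UNIV ?R (coeff (norm f) i)) = coeff (norm f) i" for i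
      by (rule f_inv_into_f)
    moreover have "inv_into UNIV ?R 0 = 0" using inv_into_f_f[OF R_inj UNIV_I, of 0] by (simp add: R)
    ultimately show ?thesis
      by (intro exI[of _ "map_poly (inv_into UNIV ?R) (norm f)"] poly_eqI)
         (simp add: coeff_emb coeff_map_poly)
  qed
  then obtain des where des: "\<And>f. emb (des f) = norm f" by metis
  have desI: "emb g = norm f \<Longrightarrow> des f = g" for f g using des[of f] emb_inj by metis
  have norm_1: "coeff (norm f) 0 = 1" if "coeff f 0 = 1" for f
    using that by (simp add: norm_def coeff_0_prod coeff_\<Phi>)
  have R1: "?R x = 1 \<longleftrightarrow> x = 1" for x using Rep_prime_subfield_inject[of x 1] R(2) by simp
  have des_1: "coeff (des f) 0 = 1" if "coeff f 0 = 1" for f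
    using norm_1[OF that] unfolding des[symmetric] coeff_emb R1 .
  define \<chi> where "\<chi> = (\<lambda>f. if coeff f 0 = 1 then \<chi>0 (des f) else 0)"
  have "unit_char l \<chi>"
  proof (rule unit_charI)
    have "des 1 = 1"
      by (rule desI) (auto simp: emb_def norm_def \<Phi>_def R)
    then show "\<chi> 1 = 1" by (simp add: \<chi>_def unit_char_1[OF c0])
    fix f g :: "'a poly" assume fg: "coeff f 0 = 1" "coeff g 0 = 1"
    have "des (f * g) = des f * des g" by (rule desI) (simp add: emb_mult des norm_mult)
    then show "\<chi> (f * g) = \<chi> f * \<chi> g"
      using fg by (simp add: \<chi>_def coeff_mult_0 unit_char_mult[OF c0] des_1)
    assume "tcong l f g"
    then have "tcong l (\<Phi> j f) (\<Phi> j g)" for j by (simp add: tcong_iff coeff_\<Phi>)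
    then have "tcong l (norm f) (norm g)" unfolding norm_def by (intro tcong_prod)
    then have "tcong l (des f) (des g)"
      unfolding des[symmetric] by (simp add: tcong_iff coeff_emb Rep_prime_subfield_inject)
    then show "\<chi> f = \<chi> g" using fg by (simp add: \<chi>_def unit_char_cong[OF c0] des_1)
  qed (simp add: \<chi>_def)
  moreover have "prime_power_sum \<chi> n = prime_power_sum \<chi>0 (r * n)" if n: "n \<ge> 1" for n
  proof -
    have rn: "r * n \<ge> 1" using r n by simp
    have eq: "(p ^ r) ^ n = p ^ (r * n)" by (simp add: power_mult)
    have "\<chi> (reflect_poly (THE f. A.lift f = A.charpoly n x)) =
          \<chi>0 (reflect_poly (THE g. B.lift g = B.charpoly (r * n) x))"
      if x: "x ^ (p ^ (r * n)) = x" for x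
    proof -
      obtain f where f: "f \<in> monic_polys n" "A.lift f = A.charpoly n x"
        using A.charpoly_descends[of x n] x by (auto simp: eq)
      obtain g where g: "g \<in> monic_polys (r * n)" "B.lift g = B.charpoly (r * n) x"
        using B.charpoly_descends[of x "r * n"] x by blast
      have theA: "(THE f. A.lift f = A.charpoly n x) = f"
        using f A.lift_inj by (intro the_equality) metis+
      have theB: "(THE g. B.lift g = B.charpoly (r * n) x) = g"
        using g B.lift_inj by (intro the_equality) metis+
      have lift_emb: "A.lift (emb h) = B.lift h" for h
        by (rule poly_eqI) (simp add: A.coeff_lift B.coeff_lift coeff_emb)
      have lift_\<Phi>: "A.lift (\<Phi> j h) = map_poly (\<lambda>x. x ^ (p ^ j)) (A.lift h)" for j h
        using p0 by (intro poly_eqI) (simp add: A.coeff_lift coeff_\<Phi> coeff_map_poly power_0_left)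
      have ac0: "(0::'a alg_closure) ^ (p ^ j) = 0" for j using p0 by (simp add: power_0_left)
      have A_prod: "A.lift (\<Prod>j\<in>J. u j) = (\<Prod>j\<in>J. A.lift (u j))" for u and J :: "nat set"
        unfolding A.lift_def by (rule map_poly_prod_hom) simp_all
      have "A.lift (norm (reflect_poly f)) =
          (\<Prod>j<r. map_poly (\<lambda>x. x ^ (p ^ j)) (A.lift (reflect_poly f)))"
        unfolding norm_def A_prod lift_\<Phi> ..
      also have "\<dots> = (\<Prod>j<r. reflect_poly (map_poly (\<lambda>x. x ^ (p ^ j)) (A.charpoly n x)))"
      proof (rule prod.cong[OF refl])
        fix j
        have "A.lift (reflect_poly f) = reflect_poly (A.charpoly n x)"
          unfolding A.lift_def f(2)[symmetric] by (rule map_poly_reflect_hom) simp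
        then show "map_poly (\<lambda>x. x ^ (p ^ j)) (A.lift (reflect_poly f)) =
            reflect_poly (map_poly (\<lambda>x. x ^ (p ^ j)) (A.charpoly n x))"
          using p0 by (simp add: map_poly_reflect_hom)
      qed
      \<comment> \<open>The exponents r i + j run through all numbers below r n, so the norm of the
        characteristic polynomial over the given field is the one over the prime field.\<close>
      also have "\<dots> = (\<Prod>j<r. reflect_poly (\<Prod>i<n. [:- (x ^ (p ^ (r * i + j))), 1:]))"
      proof (rule prod.cong[OF refl], rule arg_cong[where f = reflect_poly])
        fix j
        have "map_poly (\<lambda>x. x ^ (p ^ j)) (A.charpoly n x) =
            (\<Prod>i<n. map_poly (\<lambda>x. x ^ (p ^ j)) [:- (x ^ ((p ^ r) ^ i)), 1:])"
          unfolding A.charpoly_def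
          by (rule map_poly_prod_hom[of "\<lambda>x. x ^ (p ^ j)"])
             (simp_all add: ac0 power_mult_distrib B.frob_add)
        also have "\<dots> = (\<Prod>i<n. [:- (x ^ (p ^ (r * i + j))), 1:])"
          by (simp add: map_poly_pCons ac0 B.frob_minus power_add power_mult flip: power_mult)
        finally show "map_poly (\<lambda>x. x ^ (p ^ j)) (A.charpoly n x) =
            (\<Prod>i<n. [:- (x ^ (p ^ (r * i + j))), 1:])" .
      qed
      also have "\<dots> = reflect_poly (\<Prod>i<n. \<Prod>j<r. [:- (x ^ (p ^ (r * i + j))), 1:])"
        unfolding reflect_poly_prod[symmetric] by (subst prod.swap) (rule refl)
      also have "\<dots> = reflect_poly (B.charpoly (r * n) x)"
        unfolding B.charpoly_def prod_lessThan_mult ..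
      also have "\<dots> = B.lift (reflect_poly g)"
        unfolding B.lift_def g(2)[symmetric]
        by (rule map_poly_reflect_hom[symmetric]) (use B.\<iota>_eq_0 in simp)
      also have "\<dots> = A.lift (emb (reflect_poly g))" by (rule lift_emb[symmetric])
      finally have "emb (reflect_poly g) = norm (reflect_poly f)" using A.lift_inj by metis
      then have "des (reflect_poly f) = reflect_poly g" by (rule desI)
      moreover have "coeff (reflect_poly f) 0 = 1" using f(1) by (auto simp: monic_polys_def)
      ultimately show ?thesis unfolding theA theB by (simp add: \<chi>_def)
    qed
    then show ?thesis
      unfolding prime_power_sum_def A.mangoldt_sum_eq_sum_elements[OF n]
        B.mangoldt_sum_eq_sum_elements[OF rn] eq
      by (intro sum.cong) auto
  qed
  ultimately show ?thesis using that by blast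
qed

subsection \<open>Cyclotomic integers\<close>

text \<open>The ring of integer polynomials in \<omega>.\<close>

definition int_adjoin :: "complex \<Rightarrow> complex set" where
  "int_adjoin \<omega> = range (\<lambda>g. poly (map_poly of_int g) \<omega>)"

lemma map_poly_of_int_hom:
  "map_poly of_int (f + g) = (map_poly of_int f + map_poly of_int g :: 'a::comm_ring_1 poly)"
  "map_poly of_int (f * g) = (map_poly of_int f * map_poly of_int g :: 'a poly)"
  by (rule poly_eqI, simp add: coeff_map_poly coeff_mult)+

context
  fixes \<omega> :: complex
begin

lemma int_adjoin_add: "x \<in> int_adjoin \<omega> \<Longrightarrow> y \<in> int_adjoin \<omega> \<Longrightarrow> x + y \<in> int_adjoin \<omega>"
  unfolding int_adjoin_def by (auto simp: map_poly_of_int_hom(1)[symmetric] simp flip: poly_add)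

lemma int_adjoin_mult: "x \<in> int_adjoin \<omega> \<Longrightarrow> y \<in> int_adjoin \<omega> \<Longrightarrow> x * y \<in> int_adjoin \<omega>"
  unfolding int_adjoin_def by (auto simp: map_poly_of_int_hom(2)[symmetric] simp flip: poly_mult)

lemma int_adjoin_of_int: "of_int k \<in> int_adjoin \<omega>"
  unfolding int_adjoin_def by (rule range_eqI[of _ _ "[:k:]"]) (simp add: map_poly_pCons)

lemma int_adjoin_of_nat: "of_nat k \<in> int_adjoin \<omega>"
  using int_adjoin_of_int[of "int k"] by simp

lemma int_adjoin_0_1: "0 \<in> int_adjoin \<omega>" "1 \<in> int_adjoin \<omega>"
  using int_adjoin_of_int[of 0] int_adjoin_of_int[of 1] by simp_all

lemma int_adjoin_numeral: "numeral k \<in> int_adjoin \<omega>"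
  using int_adjoin_of_int[of "numeral k"] by simp

lemma int_adjoin_minus: "x \<in> int_adjoin \<omega> \<Longrightarrow> - x \<in> int_adjoin \<omega>"
  using int_adjoin_mult[OF int_adjoin_of_int[of "-1"]] by simp

lemma int_adjoin_diff: "x \<in> int_adjoin \<omega> \<Longrightarrow> y \<in> int_adjoin \<omega> \<Longrightarrow> x - y \<in> int_adjoin \<omega>"
  using int_adjoin_add[OF _ int_adjoin_minus, of x y] by simp

lemma int_adjoin_power: "x \<in> int_adjoin \<omega> \<Longrightarrow> x ^ n \<in> int_adjoin \<omega>"
  by (induction n) (auto intro: int_adjoin_0_1 int_adjoin_mult)

lemma int_adjoin_sum: "(\<And>i. i \<in> I \<Longrightarrow> f i \<in> int_adjoin \<omega>) \<Longrightarrow> sum f I \<in> int_adjoin \<omega>"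
  by (induction I rule: infinite_finite_induct) (auto intro: int_adjoin_0_1 int_adjoin_add)

lemma int_adjoin_self: "\<omega> \<in> int_adjoin \<omega>"
  unfolding int_adjoin_def by (rule range_eqI[of _ _ "[:0, 1:]"]) (simp add: map_poly_pCons)

lemmas int_adjoin_intros = int_adjoin_add int_adjoin_mult int_adjoin_of_int int_adjoin_of_nat
  int_adjoin_0_1 int_adjoin_numeral int_adjoin_minus int_adjoin_diff int_adjoin_power int_adjoin_sum

text \<open>With \<open>c\<close> the leading coefficient of an integer polynomial \<open>h\<close> of least degree annihilating
  \<open>\<omega>\<close>, multiplication by \<open>c ^ M\<close> brings every element of \<open>int_adjoin \<omega>\<close> into the span of the powers of
  \<open>\<omega>\<close> below \<open>degree h\<close>, which are linearly independent. So \<open>1 / p ^ k \<in> int_adjoin \<omega>\<close> implies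
  \<open>p ^ k dvd c ^ M\<close>.\<close>

lemma prime_not_unit_int_adjoin:
  assumes \<omega>: "\<omega> ^ M = 1" and M: "M \<ge> 1" and p: "p \<ge> 2" and z: "z \<in> int_adjoin \<omega>" "of_nat p * z = 1"
  shows False
proof -
  let ?ev = "\<lambda>g :: int poly. poly (map_poly of_int g) \<omega>"
  have ev_add: "?ev (f + g) = ?ev f + ?ev g" and ev_mult: "?ev (f * g) = ?ev f * ?ev g" for f g
    by (simp_all add: map_poly_of_int_hom)
  have ev_const: "?ev [:a:] = of_int a" for a by (simp add: map_poly_pCons)
  have ev_smult: "?ev (smult a f) = of_int a * ?ev f" for a f
    using ev_mult[of "[:a:]" f] by (simp add: ev_const)
  have ev_monom: "?ev (monom a n) = of_int a * \<omega> ^ n" for a n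
    by (simp add: map_poly_monom poly_monom)
  have "?ev (monom 1 M + [:-1:]) = 0" unfolding ev_add ev_monom ev_const using \<omega> by simp
  moreover have "coeff (monom 1 M + [:-1:]) M = (1::int)" using M by (cases M) auto
  then have "monom 1 M + [:-1::int:] \<noteq> 0" by (metis coeff_0 zero_neq_one)
  ultimately have "\<exists>h. h \<noteq> 0 \<and> ?ev h = 0 \<and> (\<forall>g. g \<noteq> 0 \<and> ?ev g = 0 \<longrightarrow> degree h \<le> degree g)"
    using ex_has_least_nat[of "\<lambda>h. h \<noteq> 0 \<and> ?ev h = 0" _ degree] by blast
  then obtain h where h: "h \<noteq> 0" "?ev h = 0"
    and min: "\<And>g. g \<noteq> 0 \<Longrightarrow> ?ev g = 0 \<Longrightarrow> degree h \<le> degree g" by blast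
  define d c where "d = degree h" and "c = lead_coeff h"
  have c0: "c \<noteq> 0" using h by (simp add: c_def)
  have d1: "d \<ge> 1"
  proof (rule ccontr)
    assume "\<not> d \<ge> 1"
    then have "degree h = 0" by (simp add: d_def)
    then obtain a where "h = [:a:]" by (elim degree_eq_zeroE)
    then show False using h by (simp add: ev_const)
  qed
  define V where "V = {r :: int poly. \<forall>j\<ge>d. coeff r j = 0}"
  have V_add: "f + g \<in> V" if "f \<in> V" "g \<in> V" for f g using that by (simp add: V_def)
  have V_smult: "smult a f \<in> V" if "f \<in> V" for a f using that by (simp add: V_def)
  have pow: "\<exists>r\<in>V. of_int (c ^ i) * \<omega> ^ i = ?ev r" for i
  proof (induction i)
    case 0
    have "1 \<in> V" using d1 by (auto simp: V_def coeff_1)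
    then show ?case by (intro bexI[of _ 1]) auto
  next
    case (Suc i)
    then obtain r where r: "r \<in> V" "of_int (c ^ i) * \<omega> ^ i = ?ev r" by blast
    \<comment> \<open>Multiplication by \<omega> may create a term of degree \<open>d\<close>; after
      scaling by \<open>c\<close> a multiple of \<open>h\<close> cancels it without changing the
      value at \<omega>.\<close>
    define r' where "r' = smult c (monom 1 1 * r) + smult (- coeff r (d - 1)) h"
    have "coeff r' j = 0" if "j \<ge> d" for j
    proof -
      have "coeff (monom 1 1 * r) j = coeff r (j - 1)" using that d1 by (simp add: coeff_monom_mult)
      then show ?thesis
        using that r(1) d1 coeff_eq_0[of h j] by (cases "j = d") (auto simp: r'_def V_def c_def d_def)
    qed
    then have "r' \<in> V" by (simp add: V_def)
    moreover have "?ev r' = of_int (c ^ Suc i) * \<omega> ^ Suc i"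
      unfolding r'_def ev_add ev_smult ev_mult ev_monom h(2) r(2)[symmetric] by simp
    ultimately show ?case by metis
  qed
  have powM: "\<exists>r\<in>V. of_int (c ^ M) * \<omega> ^ i = ?ev r" for i
  proof -
    have "\<omega> ^ i = (\<omega> ^ M) ^ (i div M) * \<omega> ^ (i mod M)"
      by (simp flip: power_mult power_add)
    then have i: "\<omega> ^ i = \<omega> ^ (i mod M)" using \<omega> by simp
    obtain r where r: "r \<in> V" "of_int (c ^ (i mod M)) * \<omega> ^ (i mod M) = ?ev r" using pow by blast
    have "i mod M \<le> M" using M by (simp add: mod_le_divisor)
    then have "c ^ M = c ^ (M - i mod M) * c ^ (i mod M)" by (simp flip: power_add)
    then have "of_int (c ^ M) * \<omega> ^ i = ?ev (smult (c ^ (M - i mod M)) r)"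
      unfolding ev_smult r(2)[symmetric] i by simp
    then show ?thesis using V_smult[OF r(1)] by blast
  qed
  have all: "\<exists>r\<in>V. of_int (c ^ M) * ?ev g = ?ev r" for g
  proof -
    obtain r where r: "\<And>i. r i \<in> V" "\<And>i. of_int (c ^ M) * \<omega> ^ i = ?ev (r i)" using powM by metis
    have "of_int (c ^ M) * ?ev g = (\<Sum>i\<le>degree g. of_int (coeff g i) * (of_int (c ^ M) * \<omega> ^ i))"
    proof -
      have "?ev g = (\<Sum>i\<le>degree g. of_int (coeff g i) * \<omega> ^ i)"
        using poly_altdef[of "map_poly of_int g" \<omega>] by (simp add: degree_map_poly coeff_map_poly)
      then show ?thesis by (simp add: sum_distrib_left mult_ac)
    qed
    also have "\<dots> = ?ev (\<Sum>i\<le>degree g. smult (coeff g i) (r i))"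
    proof -
      have "?ev (\<Sum>i\<in>I. u i) = (\<Sum>i\<in>I. ?ev (u i))" for u and I :: "nat set"
        by (induction I rule: infinite_finite_induct) (simp_all add: ev_add)
      then show ?thesis by (simp only: ev_smult r(2))
    qed
    finally have "of_int (c ^ M) * ?ev g = ?ev (\<Sum>i\<le>degree g. smult (coeff g i) (r i))" .
    moreover have "(\<Sum>i\<le>degree g. smult (coeff g i) (r i)) \<in> V"
      using r(1) by (auto simp: V_def coeff_sum)
    ultimately show ?thesis by blast
  qed
  have dvd: "int p ^ k dvd c ^ M" for k
  proof -
    have "z ^ k \<in> int_adjoin \<omega>" by (rule int_adjoin_power) fact
    then obtain g where g: "z ^ k = ?ev g" by (auto simp: int_adjoin_def)
    obtain r where r: "r \<in> V" "of_int (c ^ M) * ?ev g = ?ev r" using all by blast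
    have pz: "of_nat p ^ k * z ^ k = 1" using z(2) by (simp flip: power_mult_distrib)
    define f where "f = smult (int p ^ k) r + [:- (c ^ M):]"
    have "?ev f = of_nat p ^ k * z ^ k * of_int (c ^ M) - of_int (c ^ M)"
      unfolding f_def ev_add ev_smult ev_const r(2)[symmetric] g by simp
    then have "?ev f = 0" unfolding pz by simp
    moreover have "degree f < d"
    proof -
      have "coeff f j = 0" if "j \<ge> d" for j
        using that r(1) d1 by (cases j) (auto simp: f_def V_def)
      then have "degree f \<le> d - 1" using d1 by (intro degree_le) auto
      then show ?thesis using d1 by simp
    qed
    ultimately have "f = 0" using min d_def by force
    then have "coeff f 0 = 0" by simp
    then have "c ^ M = int p ^ k * coeff r 0" by (simp add: f_def)
    then show ?thesis by simp
  qed
  \<comment> \<open>Since p ^ k > k, this exponent contradicts p ^ k dividing the nonzero number c ^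
    M.\<close>
  define k where "k = nat \<bar>c ^ M\<bar>"
  have "\<bar>int p ^ k\<bar> \<le> \<bar>c ^ M\<bar>" using dvd_imp_le_int[OF _ dvd[of k]] c0 by simp
  moreover have "k < p ^ k"
    using power_gt_expt[of p k] p by simp
  then have "int k < int p ^ k" by (metis of_nat_less_iff of_nat_power)
  moreover have "int k = \<bar>c ^ M\<bar>" by (simp add: k_def)
  ultimately show False by simp
qed

end

lemma root_of_unity_in_int_adjoin:
  assumes "z ^ N = 1" "N dvd M" "M \<ge> 1"
  shows "z \<in> int_adjoin (cis (2 * pi / real M))"
proof -
  obtain k where "M = N * k" using assms(2) by blast
  then have "z ^ M = 1" using assms(1) by (simp add: power_mult)
  then have "z \<in> (\<lambda>k. cis (2 * pi * real k / real M)) ` {..<M}"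
    using bij_betw_roots_unity[of M] assms(3) by (simp add: bij_betw_def)
  then obtain j where "z = cis (2 * pi * real j / real M)" by blast
  then have "z = cis (2 * pi / real M) ^ j" by (simp add: DeMoivre mult_ac)
  then show ?thesis by (simp add: int_adjoin_power int_adjoin_self)
qed

text \<open>Here \<open>\<pi>\<close> is a uniformizer of a ring of cyclotomic integers at \<open>p\<close>, of ramification index
  \<open>\<phi>\<close>, and \<open>k\<close> is the valuation of \<open>T\<close>.\<close>

lemma valuation_contradiction:
  fixes \<pi> T :: complex and u :: int and p :: nat
  assumes \<omega>: "\<omega> ^ M = 1" "M \<ge> 1" and p: "prime p"
    and R: "\<pi> \<in> int_adjoin \<omega>" "w0 \<in> int_adjoin \<omega>" "w \<in> int_adjoin \<omega>" "v \<in> int_adjoin \<omega>"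
    and ram: "of_nat p * (1 + \<pi> * w0) = - (\<pi> ^ \<phi>)"
    and T: "T * (1 + \<pi> * w0) = \<pi> ^ k * (of_int u + \<pi> * w)"
    and u: "\<not> int p dvd u" and T2: "T ^ 2 = of_nat p * v" and k: "2 * k < \<phi>"
    and \<pi>0: "\<pi> \<noteq> 0"
  shows False
proof -
  note intros = int_adjoin_intros R
  obtain j where j: "\<phi> = 2 * k + Suc j" using k less_iff_Suc_add by auto
  \<comment> \<open>The factor 1 + \<pi> w0 is invertible modulo \<pi> but not necessarily in the
    ring, so equations are multiplied by it. The left side has valuation 2k, the right side at least
    \<phi>, and cancelling leaves u ^ 2 divisible by \<pi>.\<close>
  have "\<pi> ^ (2 * k) * (of_int u + \<pi> * w) ^ 2 = (T * (1 + \<pi> * w0)) ^ 2"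
    unfolding T by (simp add: power_mult_distrib mult.commute flip: power_mult)
  also have "\<dots> = v * (1 + \<pi> * w0) * (of_nat p * (1 + \<pi> * w0))"
    unfolding power_mult_distrib T2 by (simp add: power2_eq_square)
  also have "\<dots> = \<pi> ^ (2 * k) * (- (\<pi> * (\<pi> ^ j * v * (1 + \<pi> * w0))))"
    unfolding ram j by (simp add: power_add)
  finally have "(of_int u + \<pi> * w) ^ 2 = - (\<pi> * (\<pi> ^ j * v * (1 + \<pi> * w0)))"
    using \<pi>0 by (simp only: mult_cancel_left power_eq_0_iff) simp
  then have "of_int (u ^ 2) = \<pi> * (- (\<pi> ^ j * v * (1 + \<pi> * w0)) - 2 * of_int u * w - \<pi> * w ^ 2)"
    by (simp add: power2_eq_square algebra_simps)
  then obtain y where y: "y \<in> int_adjoin \<omega>" "of_int (u ^ 2) = \<pi> * y"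
    by (rule that[rotated]) (intro intros)
  have "of_nat p = \<pi> * (- (\<pi> ^ (\<phi> - 1)) - of_nat p * w0)"
    using ram k by (cases \<phi>) (simp_all add: algebra_simps eq_diff_eq)
  then obtain y' where y': "y' \<in> int_adjoin \<omega>" "of_nat p = \<pi> * y'"
    by (rule that[rotated]) (intro intros)
  \<comment> \<open>Now \<pi> divides the coprime integers u ^ 2 and p, so \<pi> is a unit; by
    \<open>ram\<close> then p is one as well.\<close>
  have "coprime u (int p)" using p u by (metis coprime_commute prime_imp_coprime prime_nat_int_transfer)
  then have "coprime (u ^ 2) (int p)" by simp
  then obtain a b where "a * u ^ 2 + b * int p = 1" by (metis bezout_int coprime_iff_gcd_eq_1)
  then have "of_int (a * u ^ 2 + b * int p) = (1::complex)" by simp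
  then have "\<pi> * (of_int a * y + of_int b * y') = 1"
    using y(2) y'(2) by (simp add: algebra_simps)
  then have "\<pi> ^ \<phi> * (of_int a * y + of_int b * y') ^ \<phi> = 1" by (simp flip: power_mult_distrib)
  moreover have "\<pi> ^ \<phi> = of_nat p * (- (1 + \<pi> * w0))"
    by (simp only: mult_minus_right ram minus_minus)
  ultimately have "of_nat p * (- (1 + \<pi> * w0) * (of_int a * y + of_int b * y') ^ \<phi>) = 1"
    by (simp add: mult.assoc)
  moreover have "- (1 + \<pi> * w0) * (of_int a * y + of_int b * y') ^ \<phi> \<in> int_adjoin \<omega>"
    by (intro intros y y')
  ultimately show False
    using prime_not_unit_int_adjoin[OF \<omega>, of p] p prime_ge_2_nat by blast
qed

text \<open>Expand \<zeta> ^ e in powers of \<pi> = \<zeta> - 1. The coefficients below k are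
  divisible by p, that is by \<pi> ^ \<phi> up to 1 + \<pi> w0, and \<phi> > k; the coefficient at k
  is prime to p. So the valuation is exactly k.\<close>

lemma exponential_sum_contradiction:
  fixes \<zeta> :: complex and e :: "nat \<Rightarrow> nat" and p :: nat
  assumes \<omega>: "\<omega> ^ M = 1" "M \<ge> 1" and p: "prime p"
    and R: "\<zeta> \<in> int_adjoin \<omega>" "w0 \<in> int_adjoin \<omega>" "v \<in> int_adjoin \<omega>"
    and ram: "of_nat p * (1 + (\<zeta> - 1) * w0) = - ((\<zeta> - 1) ^ \<phi>)"
    and T2: "(\<Sum>a<p. \<zeta> ^ e a) ^ 2 = of_nat p * v"
    and low: "\<And>j. j < k \<Longrightarrow> p dvd (\<Sum>a<p. e a choose j)" and high: "\<not> p dvd (\<Sum>a<p. e a choose k)"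
    and k: "2 * k < \<phi>" and \<zeta>1: "\<zeta> \<noteq> 1"
  shows False
proof -
  note intros = int_adjoin_intros R
  define \<pi> where "\<pi> = \<zeta> - 1"
  have \<pi>: "\<pi> \<in> int_adjoin \<omega>" unfolding \<pi>_def by (intro intros)
  define s where "s = (\<lambda>j. \<Sum>a<p. e a choose j)"
  \<comment> \<open>A common summation bound above k and all exponents.\<close>
  define n where "n = Suc (k + (\<Sum>a<p. e a))"
  have "\<zeta> ^ e a = (\<Sum>j<n. of_nat (e a choose j) * \<pi> ^ j)" if a: "a < p" for a
  proof -
    have "e a \<le> (\<Sum>a<p. e a)" using a by (intro member_le_sum) auto
    have "\<zeta> ^ e a = (\<pi> + 1) ^ e a" by (simp add: \<pi>_def)
    also have "\<dots> = (\<Sum>j\<le>e a. of_nat (e a choose j) * \<pi> ^ j)" by (simp add: binomial_ring)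
    also have "\<dots> = (\<Sum>j<n. of_nat (e a choose j) * \<pi> ^ j)"
      by (rule sum.mono_neutral_left) (use \<open>e a \<le> _\<close> in \<open>auto simp: n_def\<close>)
    finally show ?thesis .
  qed
  then have "(\<Sum>a<p. \<zeta> ^ e a) = (\<Sum>a<p. \<Sum>j<n. of_nat (e a choose j) * \<pi> ^ j)" by simp
  also have "\<dots> = (\<Sum>j<n. of_nat (s j) * \<pi> ^ j)"
    by (subst sum.swap) (simp add: s_def sum_distrib_right)
  also have "\<dots> = (\<Sum>j<k. of_nat (s j) * \<pi> ^ j) +
      (of_nat (s k) * \<pi> ^ k + \<pi> ^ Suc k * (\<Sum>j<n - Suc k. of_nat (s (Suc k + j)) * \<pi> ^ j))"
  proof -
    have n: "{..<n} = {..<k} \<union> {k..<n}" by (auto simp: n_def)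
    have "(\<Sum>j<n. of_nat (s j) * \<pi> ^ j) = (\<Sum>j<k. of_nat (s j) * \<pi> ^ j) + (\<Sum>j=k..<n. of_nat (s j) * \<pi> ^ j)"
      unfolding n by (rule sum.union_disjoint) auto
    also have "(\<Sum>j=k..<n. of_nat (s j) * \<pi> ^ j) = of_nat (s k) * \<pi> ^ k + (\<Sum>j=Suc k..<n. of_nat (s j) * \<pi> ^ j)"
      by (rule sum.atLeast_Suc_lessThan) (simp add: n_def)
    also have "(\<Sum>j=Suc k..<n. of_nat (s j) * \<pi> ^ j) = \<pi> ^ Suc k * (\<Sum>j<n - Suc k. of_nat (s (Suc k + j)) * \<pi> ^ j)"
    proof -
      have "(\<Sum>j=Suc k..<n. of_nat (s j) * \<pi> ^ j) = (\<Sum>j<n - Suc k. of_nat (s (Suc k + j)) * \<pi> ^ (Suc k + j))"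
        by (rule sum.reindex_bij_witness[of _ "\<lambda>j. Suc k + j" "\<lambda>j. j - Suc k"]) auto
      then show ?thesis by (simp add: sum_distrib_left power_add mult_ac)
    qed
    finally show ?thesis .
  qed
  finally have T: "(\<Sum>a<p. \<zeta> ^ e a) = (\<Sum>j<k. of_nat (s j) * \<pi> ^ j) +
      (of_nat (s k) * \<pi> ^ k + \<pi> ^ Suc k * (\<Sum>j<n - Suc k. of_nat (s (Suc k + j)) * \<pi> ^ j))" .
  define B where "B = (\<Sum>j<n - Suc k. of_nat (s (Suc k + j)) * \<pi> ^ j)"
  have B: "B \<in> int_adjoin \<omega>" unfolding B_def by (intro intros \<pi>)
  define A where "A = (\<Sum>j<k. of_nat (s j div p) * \<pi> ^ j)"
  have A: "A \<in> int_adjoin \<omega>" unfolding A_def by (intro intros \<pi>)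
  have "(\<Sum>j<k. of_nat (s j) * \<pi> ^ j) = of_nat p * A"
    unfolding A_def sum_distrib_left
  proof (rule sum.cong[OF refl])
    fix j assume "j \<in> {..<k}"
    then have "s j = p * (s j div p)" using low[of j] by (simp add: s_def)
    then have "(of_nat (s j) :: complex) = of_nat p * of_nat (s j div p)" by (metis of_nat_mult)
    then show "of_nat (s j) * \<pi> ^ j = of_nat p * (of_nat (s j div p) * \<pi> ^ j)" by simp
  qed
  then have T': "(\<Sum>a<p. \<zeta> ^ e a) = of_nat p * A + \<pi> ^ k * (of_nat (s k) + \<pi> * B)"
    unfolding T by (simp add: B_def algebra_simps)
  obtain j where j: "\<phi> = k + Suc j" using k less_iff_Suc_add[of k \<phi>] by auto
  have "(\<Sum>a<p. \<zeta> ^ e a) * (1 + \<pi> * w0) =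
     A * (of_nat p * (1 + \<pi> * w0)) + \<pi> ^ k * (of_nat (s k) + \<pi> * B) * (1 + \<pi> * w0)"
    unfolding T' by (simp add: algebra_simps)
  \<comment> \<open>The ramification equation trades the multiple of p for a multiple of \<pi> ^ (k
    + 1).\<close>
  also have "\<dots> = \<pi> ^ k * (of_int (int (s k)) +
      \<pi> * (- (A * \<pi> ^ j) + B * (1 + \<pi> * w0) + of_nat (s k) * w0))"
    unfolding ram[folded \<pi>_def] j by (simp add: algebra_simps power_add)
  finally have eq: "(\<Sum>a<p. \<zeta> ^ e a) * (1 + \<pi> * w0) = \<pi> ^ k * (of_int (int (s k)) +
      \<pi> * (- (A * \<pi> ^ j) + B * (1 + \<pi> * w0) + of_nat (s k) * w0))" .
  show False
  proof (rule valuation_contradiction[OF \<omega> p \<pi> R(2) _ R(3) ram[folded \<pi>_def] eq _ T2 k])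
    show "- (A * \<pi> ^ j) + B * (1 + \<pi> * w0) + of_nat (s k) * w0 \<in> int_adjoin \<omega>"
      by (intro intros A B \<pi>)
    show "\<not> int p dvd int (s k)" using high by (simp only: s_def int_dvd_int_iff) simp
    show "\<pi> \<noteq> 0" using \<zeta>1 by (simp add: \<pi>_def)
  qed
qed

lemma int_adjoin_mono:
  assumes "z \<in> int_adjoin \<omega>"
  shows "int_adjoin z \<subseteq> int_adjoin \<omega>"
proof
  fix x assume "x \<in> int_adjoin z"
  then obtain g where "x = poly (map_poly of_int g) z" by (auto simp: int_adjoin_def)
  also have "\<dots> \<in> int_adjoin \<omega>"
    by (induction g) (auto simp: map_poly_pCons intro: int_adjoin_intros assms)
  finally show "x \<in> int_adjoin \<omega>" .
qed

subsection \<open>Characters that are not supersingular\<close>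

text \<open>Every reciprocal root is \<surd>q times a root of unity. Roots enter through power sums,
  the form in which \<open>base_change\<close> transfers them.\<close>

definition supersingular :: "('k::{finite,field} poly \<Rightarrow> complex) \<Rightarrow> bool" where
  "supersingular \<chi> \<longleftrightarrow> (\<exists>A m. m \<ge> 1 \<and> (\<forall>n\<ge>1. prime_power_sum \<chi> n = - (\<Sum>g\<in>#A. g ^ n)) \<and>
     (\<forall>g\<in>#A. g ^ (2 * m) = of_nat CARD('k) ^ m))"

lemma bij_betw_of_nat_prime_field:
  assumes "CARD('k) = p" "prime p"
  shows "CHAR('k::{finite,field}) = p" "bij_betw of_nat {..<p} (UNIV :: 'k set)"
proof -
  show c: "CHAR('k) = p" using CHAR_eq_of_CARD[of p 1, where 'a = 'k] assms by simp
  have inj: "inj_on (of_nat :: nat \<Rightarrow> 'k) {..<p}"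
    by (auto simp: inj_on_def of_nat_eq_iff_cong_CHAR cong_def c)
  then have "(of_nat :: nat \<Rightarrow> 'k) ` {..<p} = UNIV"
    by (intro card_subset_eq) (simp_all add: card_image assms)
  with inj show "bij_betw of_nat {..<p} (UNIV :: 'k set)" by (simp add: bij_betw_def)
qed

text \<open>The linear coefficient is minus the sum of the roots. Its square is considered because
  products g h of two roots are p times a root of unity, whereas a single root involves
  \<surd>p.\<close>

lemma not_supersingularI:
  fixes \<chi> :: "'k::{finite,field} poly \<Rightarrow> complex" and \<zeta> :: complex
  assumes p: "CARD('k) = p" "prime p" and \<chi>: "unit_char l \<chi>"
    and \<zeta>: "\<zeta> ^ N = 1" "N \<ge> 1" "\<zeta> \<noteq> 1" and w0: "w \<in> int_adjoin \<zeta>"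
    and ram: "of_nat p * (1 + (\<zeta> - 1) * w) = - ((\<zeta> - 1) ^ \<phi>)"
    and e: "\<And>a. a < p \<Longrightarrow> \<chi> [:1, of_nat a:] = \<zeta> ^ e a"
    and low: "\<And>j. j < k \<Longrightarrow> p dvd (\<Sum>a<p. e a choose j)" and high: "\<not> p dvd (\<Sum>a<p. e a choose k)"
    and k: "2 * k < \<phi>"
  shows "\<not> supersingular \<chi>"
proof
  assume "supersingular \<chi>"
  then obtain A m where m: "m \<ge> 1" and A: "\<And>n. n \<ge> 1 \<Longrightarrow> prime_power_sum \<chi> n = - (\<Sum>g\<in>#A. g ^ n)"
    and roots: "\<And>g. g \<in># A \<Longrightarrow> g ^ (2 * m) = of_nat p ^ m"
    unfolding supersingular_def p(1) by blast
  \<comment> \<open>A multiple of the order of \<zeta> and of the orders of all quotients g h / p,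
    so that one cyclotomic ring contains them.\<close>
  define M where "M = 2 * m * N"
  have M: "M \<ge> 1" using m \<zeta>(2) by (simp add: M_def)
  define \<omega> where "\<omega> = cis (2 * pi / real M)"
  have \<omega>: "\<omega> ^ M = 1" unfolding \<omega>_def using M by (intro cis_root_of_unity_power) simp
  have \<zeta>R: "\<zeta> \<in> int_adjoin \<omega>"
    unfolding \<omega>_def by (rule root_of_unity_in_int_adjoin[OF \<zeta>(1) _ M]) (simp add: M_def)
  have p0: "of_nat p \<noteq> (0::complex)" using p(2) prime_gt_0_nat by simp
  have "L_coeff \<chi> 1 = prime_power_sum \<chi> 1"
    using L_coeff_recurrence[OF \<chi>, of 1] L_coeff_0[OF \<chi>] by simp
  also have "\<dots> = - (\<Sum>g\<in>#A. g)" using A[of 1] by simp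
  finally have L1: "L_coeff \<chi> 1 = - (\<Sum>g\<in>#A. g)" .
  have "L_coeff \<chi> 1 = (\<Sum>a<p. \<chi> [:1, of_nat a:])"
    unfolding L_coeff_1
    by (rule sum.reindex_bij_betw[OF bij_betw_of_nat_prime_field(2)[OF p], symmetric])
  also have "\<dots> = (\<Sum>a<p. \<zeta> ^ e a)" by (rule sum.cong) (simp_all add: e)
  finally have T: "(\<Sum>a<p. \<zeta> ^ e a) = - (\<Sum>g\<in>#A. g)" using L1 by simp
  have closed: "\<exists>v\<in>int_adjoin \<omega>. (\<Sum>g\<in>#B. f g) = of_nat p * v"
    if "\<And>g. g \<in># B \<Longrightarrow> \<exists>v\<in>int_adjoin \<omega>. f g = of_nat p * v" for f :: "complex \<Rightarrow> complex" and B
    using that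
  proof (induction B)
    case empty
    show ?case by (rule bexI[of _ 0]) (simp_all add: int_adjoin_0_1)
  next
    case (add g B)
    then obtain u v where "u \<in> int_adjoin \<omega>" "f g = of_nat p * u"
      "v \<in> int_adjoin \<omega>" "(\<Sum>g\<in>#B. f g) = of_nat p * v" by (metis insert_iff set_mset_add_mset_insert)
    then show ?case by (intro bexI[of _ "u + v"]) (auto simp: distrib_left intro: int_adjoin_add)
  qed
  have pair: "\<exists>v\<in>int_adjoin \<omega>. g * h = of_nat p * v" if "g \<in># A" "h \<in># A" for g h
  proof (rule bexI[of _ "g * h / of_nat p"])
    have "(g * h / of_nat p) ^ (2 * m) = 1"
      using roots[OF that(1)] roots[OF that(2)] p0
      by (simp add: power_divide power_mult_distrib flip: power_add mult_2)
    then show "g * h / of_nat p \<in> int_adjoin \<omega>"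
      unfolding \<omega>_def by (rule root_of_unity_in_int_adjoin[OF _ _ M]) (simp add: M_def)
  qed (use p0 in simp)
  have "\<exists>v\<in>int_adjoin \<omega>. (\<Sum>g\<in>#A. \<Sum>h\<in>#A. g * h) = of_nat p * v"
    by (intro closed pair)
  moreover have "(\<Sum>a<p. \<zeta> ^ e a) ^ 2 = (\<Sum>g\<in>#A. \<Sum>h\<in>#A. g * h)"
    using sum_mset_product[of "\<lambda>x. x" A "\<lambda>x. x" A] by (simp add: T power2_eq_square)
  ultimately obtain v where v: "v \<in> int_adjoin \<omega>" "(\<Sum>a<p. \<zeta> ^ e a) ^ 2 = of_nat p * v" by auto
  have "w \<in> int_adjoin \<omega>" using w0 int_adjoin_mono[OF \<zeta>R] by blast
  then show False
    using exponential_sum_contradiction[OF \<omega> M p(2) \<zeta>R _ v(1) ram v(2) low high k \<zeta>(3)] by blast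
qed

text \<open>Divide (1 + \<pi>) ^ p = 1 by \<pi>: apart from \<pi> ^ (p - 1), all binomial
  coefficients that remain are divisible by p.\<close>

lemma cyclotomic_ramification:
  fixes \<zeta> :: complex
  assumes p: "prime p" and \<zeta>: "\<zeta> ^ p = 1" "\<zeta> \<noteq> 1"
  shows "\<exists>w0\<in>int_adjoin \<zeta>. of_nat p * (1 + (\<zeta> - 1) * w0) = - ((\<zeta> - 1) ^ (p - 1))"
proof -
  define \<pi> where "\<pi> = \<zeta> - 1"
  have \<pi>: "\<pi> \<in> int_adjoin \<zeta>" "\<pi> \<noteq> 0"
    unfolding \<pi>_def using \<zeta>(2) by (auto intro: int_adjoin_intros int_adjoin_self)
  obtain n where n: "p = n + 2" using prime_ge_2_nat[OF p] le_Suc_ex by (metis add.commute)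
  define w0 where "w0 = (\<Sum>j<n. of_nat ((p choose (j + 2)) div p) * \<pi> ^ j)"
  have "w0 \<in> int_adjoin \<zeta>" unfolding w0_def by (intro int_adjoin_intros \<pi>)
  have "1 = (\<pi> + 1) ^ p" by (simp add: \<pi>_def \<zeta>)
  also have "\<dots> = (\<Sum>j\<le>p. of_nat (p choose j) * \<pi> ^ j)" by (simp add: binomial_ring)
  also have "{..p} = {..Suc (n + 1)}" by (simp add: n)
  also have "(\<Sum>j\<in>\<dots>. of_nat (p choose j) * \<pi> ^ j) = 1 + (\<Sum>j\<le>n + 1. of_nat (p choose Suc j) * \<pi> ^ Suc j)"
    using sum.atMost_Suc_shift[of "\<lambda>j. of_nat (p choose j) * \<pi> ^ j" "n + 1"] by simp
  also have "(\<Sum>j\<le>n + 1. of_nat (p choose Suc j) * \<pi> ^ Suc j) =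
      \<pi> * (\<Sum>j\<le>n + 1. of_nat (p choose Suc j) * \<pi> ^ j)"
    unfolding sum_distrib_left by (intro sum.cong) simp_all
  finally have "0 = \<pi> * (\<Sum>j\<le>n + 1. of_nat (p choose Suc j) * \<pi> ^ j)" by simp
  then have "0 = (\<Sum>j\<le>n + 1. of_nat (p choose Suc j) * \<pi> ^ j)" using \<pi>(2) by simp
  also have "\<dots> = of_nat p + (\<Sum>j\<le>n. of_nat (p choose (j + 2)) * \<pi> ^ Suc j)"
    using sum.atMost_Suc_shift[of "\<lambda>j. of_nat (p choose Suc j) * \<pi> ^ j" n] by simp
  also have "(\<Sum>j\<le>n. of_nat (p choose (j + 2)) * \<pi> ^ Suc j) =
      (\<Sum>j<n. of_nat (p choose (j + 2)) * \<pi> ^ Suc j) + \<pi> ^ Suc n"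
    unfolding lessThan_Suc_atMost[symmetric] sum.lessThan_Suc by (simp add: n)
  also have "(\<Sum>j<n. of_nat (p choose (j + 2)) * \<pi> ^ Suc j) = of_nat p * (\<pi> * w0)"
    unfolding w0_def sum_distrib_left
  proof (rule sum.cong[OF refl])
    fix j assume "j \<in> {..<n}"
    then have "p dvd (p choose (j + 2))" using p n by (intro dvd_choose_prime) auto
    then have "(of_nat (p choose (j + 2)) :: complex) = of_nat p * of_nat ((p choose (j + 2)) div p)"
      by (metis dvd_mult_div_cancel of_nat_mult)
    then show "of_nat (p choose (j + 2)) * \<pi> ^ Suc j =
        of_nat p * (\<pi> * (of_nat ((p choose (j + 2)) div p) * \<pi> ^ j))" by simp
  qed
  finally have "of_nat p * (1 + \<pi> * w0) = - (\<pi> ^ (p - 1))"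
    by (simp add: n algebra_simps eq_neg_iff_add_eq_0)
  then show ?thesis using \<open>w0 \<in> _\<close> unfolding \<pi>_def by blast
qed

text \<open>Modulo T ^ 5 the unit 1 + T has order 8, so a character with primitive 8th root of unity
  \<zeta> at 1 + T exists. Its linear coefficient 1 + \<zeta> has valuation 1, while \<phi> =
  4.\<close>

lemma exists_not_supersingular_2:
  assumes "CARD('k) = 2"
  shows "\<exists>\<chi> :: 'k::{finite,field} poly \<Rightarrow> complex.
    unit_char 4 \<chi> \<and> \<chi> \<noteq> principal_char \<and> \<not> supersingular \<chi>"
proof -
  have c: "CHAR('k) = 2" using bij_betw_of_nat_prime_field(1)[OF assms two_is_prime_nat] .
  have two: "(2::'k) = 0" using of_nat_CHAR[where 'a = 'k] c by simp
  define f :: "'k poly" where "f = [:1, 1:]"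
  have f4: "f ^ 4 = [:1, 0, 0, 0, 1:]"
  proof -
    have "[:1, 1:] ^ 4 = [:1, 4, 6, 4, 1::'k:]" by (simp add: eval_nat_numeral)
    moreover have "(4::'k) = 2 * 2" "(6::'k) = 2 * 3" by simp_all
    ultimately show ?thesis by (simp add: f_def two)
  qed
  have "\<not> tcong 4 (f ^ 4) 1"
    unfolding f4 by (auto simp: tcong_iff numeral_eq_Suc intro!: exI[of _ 4])
  then obtain \<chi> :: "'k poly \<Rightarrow> complex" where \<chi>: "unit_char 4 \<chi>" "\<chi> (f ^ 4) \<noteq> 1"
    using unit_char_separates[of "f ^ 4" 4] by (auto simp: coeff_0_power f_def)
  define \<zeta> where "\<zeta> = \<chi> f"
  have f0: "coeff f 0 = 1" by (simp add: f_def)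
  have \<zeta>4: "\<zeta> ^ 4 \<noteq> 1" using \<chi>(2) unit_char_power[OF \<chi>(1) f0] by (simp add: \<zeta>_def)
  have "\<chi> ((f ^ 4) ^ 2) = \<chi> 1"
  proof (rule unit_char_cong[OF \<chi>(1)])
    have "(f ^ 4) ^ 2 = [:1, 0, 0, 0, 2, 0, 0, 0, 1:]" unfolding f4 by (simp add: eval_nat_numeral)
    then show "tcong 4 ((f ^ 4) ^ 2) 1"
      by (auto simp: two tcong_iff le_Suc_eq numeral_eq_Suc)
  qed (simp_all add: coeff_0_power f0)
  then have "\<zeta> ^ 8 = 1"
    by (simp add: unit_char_power[OF \<chi>(1)] coeff_0_power f0 \<zeta>_def unit_char_1[OF \<chi>(1)] flip: power_mult)
  moreover have "\<zeta> ^ 8 - 1 = (\<zeta> ^ 4 - 1) * (\<zeta> ^ 4 + 1)" by (simp add: algebra_simps flip: power_add)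
  ultimately have z: "\<zeta> ^ 4 = - 1" using \<zeta>4 by (simp add: eq_neg_iff_add_eq_0)
  \<comment> \<open>\<open>w\<close> comes from \<zeta> ^ 4 + 1 = 2 (1 + \<pi> w) + \<pi> ^ 4 with
    \<zeta> = 1 + \<pi>.\<close>
  have "\<not> supersingular \<chi>"
  proof (rule not_supersingularI[OF assms two_is_prime_nat \<chi>(1) \<open>\<zeta> ^ 8 = 1\<close>,
        where w = "2 + 3 * (\<zeta> - 1) + 2 * (\<zeta> - 1) ^ 2" and \<phi> = 4 and e = "\<lambda>a. a" and k = 1])
    show "\<zeta> \<noteq> 1" using \<zeta>4 by auto
    show "2 + 3 * (\<zeta> - 1) + 2 * (\<zeta> - 1) ^ 2 \<in> int_adjoin \<zeta>"
      by (intro int_adjoin_intros int_adjoin_self)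
    have "of_nat 2 * (1 + (\<zeta> - 1) * (2 + 3 * (\<zeta> - 1) + 2 * (\<zeta> - 1)\<^sup>2)) + (\<zeta> - 1) ^ 4 = \<zeta> ^ 4 + 1"
      by (simp add: eval_nat_numeral algebra_simps)
    then show "of_nat 2 * (1 + (\<zeta> - 1) * (2 + 3 * (\<zeta> - 1) + 2 * (\<zeta> - 1)\<^sup>2)) = - ((\<zeta> - 1) ^ 4)"
      by (simp add: z eq_neg_iff_add_eq_0)
    fix a :: nat assume "a < 2"
    then have "a = 0 \<or> a = 1" by auto
    then show "\<chi> [:1, of_nat a:] = \<zeta> ^ a"
      using unit_char_1[OF \<chi>(1)] by (auto simp: \<zeta>_def f_def one_pCons)
  qed (simp_all add: lessThan_2_3)
  moreover have "\<chi> \<noteq> principal_char" using \<zeta>4 f0 by (auto simp: \<zeta>_def principal_char_def)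
  ultimately show ?thesis using \<chi>(1) by blast
qed

text \<open>Modulo T ^ 4 the unit 1 + T has order 9. A character with primitive 9th root of unity
  there has \<phi> = 6, and its linear coefficient has valuation 2.\<close>

lemma exists_not_supersingular_3:
  assumes "CARD('k) = 3"
  shows "\<exists>\<chi> :: 'k::{finite,field} poly \<Rightarrow> complex.
    unit_char 3 \<chi> \<and> \<chi> \<noteq> principal_char \<and> \<not> supersingular \<chi>"
proof -
  have pr: "prime (3::nat)" by simp
  have c: "CHAR('k) = 3" using bij_betw_of_nat_prime_field(1)[OF assms pr] .
  have three: "(3::'k) = 0" using of_nat_CHAR[where 'a = 'k] c by simp
  define f :: "'k poly" where "f = [:1, 1:]"
  have f3: "f ^ 3 = [:1, 0, 0, 1:]" by (simp add: f_def eval_nat_numeral three[unfolded eval_nat_numeral])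
  have "\<not> tcong 3 (f ^ 3) 1"
    unfolding f3 by (auto simp: tcong_iff numeral_eq_Suc intro!: exI[of _ 3])
  then obtain \<chi> :: "'k poly \<Rightarrow> complex" where \<chi>: "unit_char 3 \<chi>" "\<chi> (f ^ 3) \<noteq> 1"
    using unit_char_separates[of "f ^ 3" 3] by (auto simp: coeff_0_power f_def)
  define \<zeta> where "\<zeta> = \<chi> f"
  have f0: "coeff f 0 = 1" by (simp add: f_def)
  have \<zeta>3: "\<zeta> ^ 3 \<noteq> 1" using \<chi>(2) unit_char_power[OF \<chi>(1) f0] by (simp add: \<zeta>_def)
  have "\<chi> ((f ^ 3) ^ 3) = \<chi> 1"
  proof (rule unit_char_cong[OF \<chi>(1)])
    have "(f ^ 3) ^ 3 = [:1, 0, 0, 3, 0, 0, 3, 0, 0, 1:]" unfolding f3 by (simp add: eval_nat_numeral)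
    then show "tcong 3 ((f ^ 3) ^ 3) 1"
      by (auto simp: three tcong_iff le_Suc_eq numeral_eq_Suc)
  qed (simp_all add: coeff_0_power f0)
  then have \<zeta>9: "\<zeta> ^ 9 = 1"
    by (simp add: unit_char_power[OF \<chi>(1)] coeff_0_power f0 \<zeta>_def unit_char_1[OF \<chi>(1)] flip: power_mult)
  moreover have "\<zeta> ^ 9 - 1 = (\<zeta> ^ 3 - 1) * (\<zeta> ^ 6 + \<zeta> ^ 3 + 1)" by (simp add: algebra_simps flip: power_add)
  ultimately have z: "\<zeta> ^ 6 + \<zeta> ^ 3 + 1 = 0" using \<zeta>3 by simp
  have \<zeta>0: "\<zeta> \<noteq> 0" using \<zeta>9 by auto
  \<comment> \<open>The value at 1 + 2 T is known only up to a cube root of unity, because the cube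
    of 1 + 2 T is congruent to (1 + T) ^ 6. All three exponents 2, 5, 8 give the same residues
    modulo 3 in the binomial sums below.\<close>
  define y where "y = \<chi> [:1, 2:] / \<zeta> ^ 2"
  have "y ^ 3 = 1"
  proof -
    have "\<chi> ([:1, 2:] ^ 3) = \<chi> ((f ^ 3) ^ 2)"
    proof (rule unit_char_cong[OF \<chi>(1)])
      have "[:1, 2:] ^ 3 = [:1, 3 * 2, 3 * 4, 3 * 2 + 2 :: 'k:]" by (simp add: eval_nat_numeral)
      moreover have "(f ^ 3) ^ 2 = [:1, 0, 0, 2, 0, 0, 1:]" unfolding f3 by (simp add: eval_nat_numeral)
      ultimately show "tcong 3 ([:1, 2:] ^ 3) ((f ^ 3) ^ 2)"
        by (simp only: three mult_zero_left) (auto simp: tcong_iff le_Suc_eq numeral_eq_Suc)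
    qed (simp_all add: coeff_0_power f0)
    then have "\<chi> [:1, 2:] ^ 3 = \<zeta> ^ 6"
      by (simp add: unit_char_power[OF \<chi>(1)] coeff_0_power f0 \<zeta>_def flip: power_mult)
    then show ?thesis using \<zeta>0 by (simp add: y_def power_divide flip: power_mult)
  qed
  moreover have "(y - 1) * (y - \<zeta> ^ 3) * (y - \<zeta> ^ 6) = y ^ 3 - 1"
  proof -
    have "(y - 1) * (y - \<zeta> ^ 3) * (y - \<zeta> ^ 6) = y ^ 3 - (\<zeta> ^ 6 + \<zeta> ^ 3 + 1) * y ^ 2
        + (\<zeta> ^ 9 + \<zeta> ^ 6 + \<zeta> ^ 3) * y - \<zeta> ^ 9"
      by (simp add: algebra_simps power2_eq_square power3_eq_cube flip: power_add)
        (simp add: eval_nat_numeral algebra_simps)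
    moreover have "\<zeta> ^ 9 + \<zeta> ^ 6 + \<zeta> ^ 3 = 0" using z by (simp add: \<zeta>9 add_ac)
    ultimately show ?thesis by (simp add: z \<zeta>9)
  qed
  ultimately have "y = 1 \<or> y = \<zeta> ^ 3 \<or> y = \<zeta> ^ 6" by auto
  then have "\<chi> [:1, 2:] = \<zeta> ^ 2 \<or> \<chi> [:1, 2:] = \<zeta> ^ 5 \<or> \<chi> [:1, 2:] = \<zeta> ^ 8"
    using \<zeta>0 by (auto simp: y_def divide_eq_eq simp flip: power_add)
  then obtain i :: nat where i: "i \<in> {2, 5, 8}" "\<chi> [:1, 2:] = \<zeta> ^ i" by blast
  \<comment> \<open>\<open>w\<close> comes from the expansion \<open>3 (1 + \<pi> w) + \<pi> ^ 6\<close> of the ninth cyclotomic polynomial at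
    \<open>\<zeta> = 1 + \<pi>\<close>.\<close>
  have "\<not> supersingular \<chi>"
  proof (rule not_supersingularI[OF assms pr \<chi>(1) \<zeta>9, where \<phi> = 6 and k = 2
        and w = "3 + 6 * (\<zeta> - 1) + 7 * (\<zeta> - 1) ^ 2 + 5 * (\<zeta> - 1) ^ 3 + 2 * (\<zeta> - 1) ^ 4"
        and e = "\<lambda>a. if a = 2 then i else a"])
    let ?w = "3 + 6 * (\<zeta> - 1) + 7 * (\<zeta> - 1) ^ 2 + 5 * (\<zeta> - 1) ^ 3 + 2 * (\<zeta> - 1) ^ 4"
    show "\<zeta> \<noteq> 1" using \<zeta>3 by auto
    show "?w \<in> int_adjoin \<zeta>" by (intro int_adjoin_intros int_adjoin_self)
    have "of_nat 3 * (1 + (\<zeta> - 1) * ?w) + (\<zeta> - 1) ^ 6 = \<zeta> ^ 6 + \<zeta> ^ 3 + 1"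
      by (simp add: eval_nat_numeral algebra_simps)
    then show "of_nat 3 * (1 + (\<zeta> - 1) * ?w) = - ((\<zeta> - 1) ^ 6)"
      by (simp add: z eq_neg_iff_add_eq_0)
    have sum3: "(\<Sum>a<3. g a) = g 0 + g 1 + g 2" for g :: "nat \<Rightarrow> nat"
      unfolding lessThan_2_3 by simp
    show "3 dvd (\<Sum>a<3. (if a = 2 then i else a) choose j)" if "j < 2" for j :: nat
    proof -
      have "j = 0 \<or> j = 1" using that by auto
      then show ?thesis using i(1) by (auto simp: sum3 simp flip: numeral_3_eq_3)
    qed
    show "\<not> 3 dvd (\<Sum>a<3. (if a = 2 then i else a) choose 2)"
      using i(1) by (auto simp: sum3 choose_two)
    fix a :: nat assume "a < 3"
    then have "a = 0 \<or> a = 1 \<or> a = 2" by auto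
    then show "\<chi> [:1, of_nat a:] = \<zeta> ^ (if a = 2 then i else a)"
      using unit_char_1[OF \<chi>(1)] i(2) by (auto simp: \<zeta>_def f_def one_pCons)
  qed simp_all
  moreover have "\<chi> \<noteq> principal_char" using \<zeta>3 f0 by (auto simp: \<zeta>_def principal_char_def)
  ultimately show ?thesis using \<chi>(1) by blast
qed

lemma additive_char_prime_field:
  fixes p :: nat
  assumes "CARD('k::{finite,field}) = p" "prime p"
  obtains \<psi> :: "'k::{finite,field} \<Rightarrow> complex" and \<zeta> where "additive_char \<psi>" "\<zeta> ^ p = 1" "\<zeta> \<noteq> 1"
    "\<And>n. \<psi> (of_nat n) = \<zeta> ^ n"
proof -
  note c = bij_betw_of_nat_prime_field[OF assms]
  obtain \<psi> :: "'k \<Rightarrow> complex" and x where \<psi>: "additive_char \<psi>" "\<psi> x \<noteq> 1"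
    using Frobenius_invariant_additive_char[of 1, where 'a = 'k] assms c by (metis power_one_right)
  have n: "\<psi> (of_nat n) = \<psi> 1 ^ n" for n using additive_char_of_nat_mult[OF \<psi>(1), of n 1] by simp
  obtain k where "x = of_nat k" using c(2) by (auto simp: bij_betw_def)
  then have "\<psi> 1 \<noteq> 1" using \<psi>(2) n[of k] by auto
  moreover have "\<psi> 1 ^ p = 1" using additive_char_power_CHAR[OF \<psi>(1), of 1] c(1) by simp
  ultimately show ?thesis using that \<psi>(1) n by blast
qed

text \<open>The power sums of the reciprocal roots, expressed by Newton's formulas in the coefficients,
  are additive under multiplication.\<close>

definition power_sum_3 :: "'k::comm_ring_1 poly \<Rightarrow> 'k" where
  "power_sum_3 f = coeff f 1 ^ 3 - 3 * coeff f 1 * coeff f 2 + 3 * coeff f 3"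

definition power_sum_4 :: "'k::comm_ring_1 poly \<Rightarrow> 'k" where
  "power_sum_4 f = coeff f 1 ^ 4 - 4 * coeff f 1 ^ 2 * coeff f 2 + 2 * coeff f 2 ^ 2
     + 4 * coeff f 1 * coeff f 3 - 4 * coeff f 4"

lemma coeff_mult_unit:
  fixes f g :: "'k::comm_ring_1 poly"
  assumes "coeff f 0 = 1" "coeff g 0 = 1"
  shows "coeff (f * g) 1 = coeff f 1 + coeff g 1"
    "coeff (f * g) 2 = coeff f 2 + coeff f 1 * coeff g 1 + coeff g 2"
    "coeff (f * g) 3 = coeff f 3 + coeff f 2 * coeff g 1 + coeff f 1 * coeff g 2 + coeff g 3"
    "coeff (f * g) 4 = coeff f 4 + coeff f 3 * coeff g 1 + coeff f 2 * coeff g 2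
       + coeff f 1 * coeff g 3 + coeff g 4"
  using assms by (simp_all add: coeff_mult eval_nat_numeral add_ac)

lemma power_sum_3_mult:
  assumes "coeff f 0 = 1" "coeff g 0 = 1"
  shows "power_sum_3 (f * g) = power_sum_3 f + power_sum_3 g"
  unfolding power_sum_3_def coeff_mult_unit[OF assms] by (simp add: power3_eq_cube algebra_simps)

lemma power_sum_4_mult:
  assumes "coeff f 0 = 1" "coeff g 0 = 1"
  shows "power_sum_4 (f * g) = power_sum_4 f + power_sum_4 g"
  unfolding power_sum_4_def coeff_mult_unit[OF assms]
  by (simp add: power2_eq_square power4_eq_xxxx algebra_simps)

lemma unit_char_of_additive:
  fixes P :: "'k::{finite,field} poly \<Rightarrow> 'k"
  assumes \<psi>: "additive_char \<psi>"
    and mult: "\<And>f g. coeff f 0 = 1 \<Longrightarrow> coeff g 0 = 1 \<Longrightarrow> P (f * g) = P f + P g"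
    and cong: "\<And>f g. tcong l f g \<Longrightarrow> P f = P g"
  shows "unit_char l (\<lambda>f. if coeff f 0 = 1 then \<psi> (P f) else 0)"
proof (rule unit_charI)
  have "P (1 * 1) = P 1 + P 1" by (rule mult) simp_all
  then have "P 1 = 0" by (metis add_cancel_left_right mult_1)
  then show "(if coeff 1 0 = 1 then \<psi> (P 1) else 0) = 1" by (simp add: additive_char_0[OF \<psi>])
  fix f g :: "'k poly" assume fg: "coeff f 0 = 1" "coeff g 0 = 1"
  then show "(if coeff (f * g) 0 = 1 then \<psi> (P (f * g)) else 0) =
      (if coeff f 0 = 1 then \<psi> (P f) else 0) * (if coeff g 0 = 1 then \<psi> (P g) else 0)"
    by (simp add: coeff_mult_0 mult additive_char_add[OF \<psi>])
  show "(if coeff f 0 = 1 then \<psi> (P f) else 0) = (if coeff g 0 = 1 then \<psi> (P g) else 0)"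
    if "tcong l f g" using fg cong[OF that] by simp
qed simp

section \<open>Sums of polynomial values over a finite field\<close>

lemma sum_powers_eq_0:
  assumes m: "m \<ge> 1" "m < CARD('k::{finite,field}) - 1"
  shows "(\<Sum>x\<in>UNIV. (x::'k::{finite,field}) ^ m) = 0"
proof -
  define f where "f = monom (1::'k) m - 1"
  have "coeff f m = 1" using m by (simp add: f_def coeff_1)
  then have f0: "f \<noteq> 0" by auto
  have "degree f \<le> m" unfolding f_def by (intro degree_diff_le degree_monom_le) simp
  then have "card {x. poly f x = 0} < card (UNIV - {0::'k})"
    using card_poly_roots_bound[OF f0] m by (simp add: card_Diff_singleton)
  then obtain b where b: "b \<noteq> 0" "poly f b \<noteq> 0"
    by (metis (mono_tags, lifting) DiffE UNIV_I card_mono finite insertCI mem_Collect_eq not_le subsetI)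
  have "bij (\<lambda>x. b * x)" by (rule o_bij[of "\<lambda>x. x / b"]) (use b in auto)
  then have "(\<Sum>x\<in>UNIV. (b * x) ^ m) = (\<Sum>x\<in>UNIV. x ^ m)" by (rule sum.reindex_bij_betw)
  then have "b ^ m * (\<Sum>x\<in>UNIV. x ^ m) = (\<Sum>x\<in>UNIV. x ^ m)"
    by (simp add: power_mult_distrib sum_distrib_left)
  then show ?thesis using b by (simp add: f_def poly_monom)
qed

text \<open>Only positive exponents divisible by q - 1 contribute. For q \<ge> 4 the second of them,
  2 (q - 1), exceeds q + 1. The degree q + 1 occurs for the polynomials in
  \<open>exists_not_supersingular_ge_7\<close>.\<close>

lemma sum_poly_over_field:
  fixes f :: "'k::{finite,field} poly"
  assumes q: "CARD('k) \<ge> 4" and deg: "degree f \<le> CARD('k) + 1"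
  shows "(\<Sum>x\<in>UNIV. poly f x) = - coeff f (CARD('k) - 1)"
proof -
  let ?q = "CARD('k)"
  have pow: "(\<Sum>x\<in>UNIV. (x::'k) ^ i) = (if i = ?q - 1 then - 1 else 0)" if "i \<le> ?q + 1" for i
  proof -
    have "i = 0 \<or> i \<ge> 1 \<and> i < ?q - 1 \<or> i = ?q - 1 \<or> i = ?q \<or> i = ?q + 1" using that by arith
    then consider "i = 0" | "i \<ge> 1" "i < ?q - 1" | "i = ?q - 1" | "i = ?q" | "i = ?q + 1" by blast
    then show ?thesis
    proof cases
      case 1
      then show ?thesis using q of_nat_CARD_eq_0[where 'a = 'k] by simp
    next
      case 2
      then show ?thesis using sum_powers_eq_0[of i, where 'k = 'k] by simp
    next
      case 3
      have "x ^ (?q - 1) = (if x = 0 then 0 else 1)" for x :: 'k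
        using power_CARD_eq_same[of x] power_Suc[of x "?q - 1"] q by (auto simp: power_0_left)
      then have "(\<Sum>x\<in>UNIV. (x::'k) ^ (?q - 1)) = (\<Sum>x::'k\<in>UNIV. 1 - (if x = 0 then 1 else 0))"
        by (auto intro: sum.cong)
      also have "\<dots> = - 1" using of_nat_CARD_eq_0[where 'a = 'k] by (simp add: sum_subtractf)
      finally show ?thesis using 3 by simp
    next
      case 4
      then show ?thesis using sum_powers_eq_0[of 1, where 'k = 'k] q by (simp add: power_CARD_eq_same)
    next
      case 5
      have "x ^ (?q + 1) = x ^ 2" for x :: 'k by (simp add: power_CARD_eq_same power2_eq_square)
      then show ?thesis using 5 sum_powers_eq_0[of 2, where 'k = 'k] q by simp
    qed
  qed
  have "(\<Sum>x\<in>UNIV. poly f x) = (\<Sum>x\<in>UNIV. \<Sum>i\<le>?q + 1. coeff f i * x ^ i)"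

    unfolding poly_altdef
    by (intro sum.cong refl sum.mono_neutral_left) (use deg in \<open>auto intro: coeff_eq_0\<close>)
  also have "\<dots> = (\<Sum>i\<le>?q + 1. coeff f i * (\<Sum>x\<in>UNIV. x ^ i))"
    by (subst sum.swap) (simp add: sum_distrib_left)
  also have "\<dots> = (\<Sum>i\<le>?q + 1. if i = ?q - 1 then - coeff f i else 0)"
    by (rule sum.cong) (auto simp: pow)
  finally show ?thesis by simp
qed

lemma of_nat_fact_choose:
  "of_nat (fact k * (n choose k)) = (\<Prod>i<k. of_nat n - of_nat i :: 'a::comm_ring_1)"
proof (induction k)
  case (Suc k)
  have "(of_nat (fact (Suc k) * (n choose Suc k)) :: 'a) = of_nat (fact k * (n choose k)) * (of_nat n - of_nat k)"
  proof (cases "k \<le> n")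
    case True
    have "fact (Suc k) * (n choose Suc k) = fact k * (n choose k) * (n - k)"
      using binomial_absorb_comp[of n k] Suc_times_binomial_eq[of "n" k]
      by (metis binomial_absorption binomial_absorb_comp fact_Suc mult.assoc mult.commute of_nat_id)
    then show ?thesis using True by (metis of_nat_diff of_nat_mult)
  qed (simp add: binomial_eq_0)
  then show ?case using Suc by simp
qed simp

text \<open>The falling factorial of x ^ 3 + x, that is k! times the binomial coefficient of x ^ 3 +
  x over k.\<close>

definition falling_cubic :: "nat \<Rightarrow> 'k::comm_ring_1 poly" where
  "falling_cubic k = (\<Prod>i<k. monom 1 3 + monom 1 1 - [:of_nat i:])"

text \<open>Degree 3k - 2 arises by taking x from one factor and x ^ 3 from the others. The degree p
  - 1 needed later is 3k or 3k - 2, according to p modulo 3.\<close>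

lemma coeff_falling_cubic:
  "(\<forall>n>3 * k. coeff (falling_cubic k :: 'k::comm_ring_1 poly) n = 0)
    \<and> coeff (falling_cubic k :: 'k poly) (3 * k) = 1
    \<and> (k \<ge> 1 \<longrightarrow> coeff (falling_cubic k :: 'k poly) (3 * k - 1) = 0
           \<and> coeff (falling_cubic k :: 'k poly) (3 * k - 2) = of_nat k)"
proof (induction k)
  case 0
  show ?case by (simp add: falling_cubic_def coeff_1)
next
  case (Suc k)
  let ?F = "falling_cubic k :: 'k poly"
  have c: "coeff (falling_cubic (Suc k) :: 'k poly) (n + 3) =
      coeff ?F n + coeff ?F (n + 2) - of_nat k * coeff ?F (n + 3)" for n
  proof -
    have "(falling_cubic (Suc k) :: 'k poly) = monom 1 3 * ?F + monom 1 1 * ?F - smult (of_nat k) ?F"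
      by (simp add: falling_cubic_def algebra_simps)
    then show ?thesis by (simp add: coeff_monom_mult)
  qed
  show ?case
  proof (cases "k = 0")
    case True
    then show ?thesis
      by (auto simp: falling_cubic_def numeral_eq_Suc coeff_pCons split: nat.splits)
  next
    case False
    then have IH: "\<And>n. n > 3 * k \<Longrightarrow> coeff ?F n = 0" "coeff ?F (3 * k) = 1"
      "coeff ?F (3 * k - 1) = 0" "coeff ?F (3 * k - 2) = of_nat k" using Suc by auto
    obtain j where j: "k = Suc j" using False by (cases k) auto
    have "coeff (falling_cubic (Suc k) :: 'k poly) n = 0" if "n > 3 * Suc k" for n
      using c[of "n - 3"] that IH(1)[of "n - 3"] IH(1)[of "n - 3 + 2"] IH(1)[of n] by simp
    moreover have "coeff (falling_cubic (Suc k) :: 'k poly) (3 * Suc k) = 1"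
      using c[of "3 * k"] IH by (simp add: algebra_simps)
    moreover have "coeff (falling_cubic (Suc k) :: 'k poly) (3 * Suc k - 1) = 0"
      using c[of "3 * k - 1"] IH False by (simp add: j)
    moreover have "coeff (falling_cubic (Suc k) :: 'k poly) (3 * Suc k - 2) = of_nat (Suc k)"
      using c[of "3 * k - 2"] IH False by (simp add: j eval_nat_numeral)
    ultimately show ?thesis by simp
  qed
qed

text \<open>The character has the exponents a ^ 4, which are 1 modulo 5 for a prime to 5. Their sum
  is - 1 modulo 5, so the valuation is 1, below half of \<phi> = 4.\<close>

lemma exists_not_supersingular_5:
  assumes "CARD('k::{finite,field}) = 5"
  shows "\<exists>\<chi> :: 'k::{finite,field} poly \<Rightarrow> complex.
    unit_char 4 \<chi> \<and> \<chi> \<noteq> principal_char \<and> \<not> supersingular \<chi>"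
proof -
  have pr: "prime (5::nat)" by simp
  obtain \<psi> :: "'k \<Rightarrow> complex" and \<zeta> where \<psi>: "additive_char \<psi>" and \<zeta>: "\<zeta> ^ 5 = 1" "\<zeta> \<noteq> 1"
    and n: "\<And>n. \<psi> (of_nat n) = \<zeta> ^ n"
    using additive_char_prime_field[OF assms pr] by blast
  define \<chi> where "\<chi> = (\<lambda>f :: 'k poly. if coeff f 0 = 1 then \<psi> (power_sum_4 f) else 0)"
  have \<chi>: "unit_char 4 \<chi>"
    unfolding \<chi>_def
    by (rule unit_char_of_additive[OF \<psi> power_sum_4_mult]) (auto simp: tcong_iff power_sum_4_def)
  have val: "\<chi> [:1, of_nat a:] = \<zeta> ^ (a ^ 4)" for a
    using n[of "a ^ 4"] by (simp add: \<chi>_def power_sum_4_def numeral_eq_Suc)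
  obtain w where w: "w \<in> int_adjoin \<zeta>" "of_nat 5 * (1 + (\<zeta> - 1) * w) = - ((\<zeta> - 1) ^ (5 - 1))"
    using cyclotomic_ramification[OF pr \<zeta>] by blast
  have s5: "(\<Sum>a<5. g a) = g 0 + g 1 + g 2 + g 3 + g 4" for g :: "nat \<Rightarrow> nat"
    by (simp add: eval_nat_numeral)
  have "\<not> supersingular \<chi>"
    by (rule not_supersingularI[OF assms pr \<chi> \<zeta>(1) _ \<zeta>(2) w, where k = 1 and e = "\<lambda>a. a ^ 4"])
       (simp_all add: val s5)
  moreover have "\<chi> \<noteq> principal_char"
    using val[of 1] \<zeta> by (auto simp: principal_char_def dest!: fun_cong[of _ _ "[:1, 1:]"])
  ultimately show ?thesis using \<chi> by blast
qed

text \<open>The exponents a ^ 3 + a contain the linear term because for p = 2 modulo 3 cubing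
  permutes the field and the pure cubic sum would vanish.\<close>

lemma exists_not_supersingular_ge_7:
  fixes p :: nat
  assumes card: "CARD('k::{finite,field}) = p" and p: "prime p" "p \<ge> 7"
  shows "\<exists>\<chi> :: 'k::{finite,field} poly \<Rightarrow> complex.
    unit_char 3 \<chi> \<and> \<chi> \<noteq> principal_char \<and> \<not> supersingular \<chi>"
proof -
  note F = bij_betw_of_nat_prime_field[OF card p(1)]
  obtain \<psi> :: "'k \<Rightarrow> complex" and \<zeta> where \<psi>: "additive_char \<psi>" and \<zeta>: "\<zeta> ^ p = 1" "\<zeta> \<noteq> 1"
    and n: "\<And>n. \<psi> (of_nat n) = \<zeta> ^ n"
    using additive_char_prime_field[OF card p(1)] by blast
  define \<chi> where "\<chi> = (\<lambda>f :: 'k poly. if coeff f 0 = 1 then \<psi> (power_sum_3 f + coeff f 1) else 0)"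
  have \<chi>: "unit_char 3 \<chi>"
    unfolding \<chi>_def
  proof (rule unit_char_of_additive[OF \<psi>])
    fix f g :: "'k poly" assume "coeff f 0 = 1" "coeff g 0 = 1"
    then show "power_sum_3 (f * g) + coeff (f * g) 1 =
        power_sum_3 f + coeff f 1 + (power_sum_3 g + coeff g 1)"
      by (simp add: power_sum_3_mult coeff_mult_unit[simplified])
  qed (auto simp: tcong_iff power_sum_3_def)
  define e where "e = (\<lambda>a::nat. a ^ 3 + a)"
  have val: "\<chi> [:1, of_nat a:] = \<zeta> ^ e a" for a
    using n[of "e a"] by (simp add: \<chi>_def power_sum_3_def e_def numeral_eq_Suc)
  obtain w where w: "w \<in> int_adjoin \<zeta>" "of_nat p * (1 + (\<zeta> - 1) * w) = - ((\<zeta> - 1) ^ (p - 1))"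
    using cyclotomic_ramification[OF p(1) \<zeta>] by blast
  have zero_iff: "(of_nat m :: 'k) = 0 \<longleftrightarrow> p dvd m" for m
    using of_nat_eq_0_iff_char_dvd[of m, where 'a = 'k] F(1) by simp
  have ev: "poly (falling_cubic j) (of_nat a) = (of_nat (fact j * (e a choose j)) :: 'k)" for a j
    unfolding of_nat_fact_choose
    by (simp add: falling_cubic_def poly_prod poly_monom e_def)
  have sum: "of_nat (fact j * (\<Sum>a<p. e a choose j)) = - coeff (falling_cubic j :: 'k poly) (p - 1)"
    if "3 * j \<le> p + 1" for j
  proof -
    have "of_nat (fact j * (\<Sum>a<p. e a choose j)) = (\<Sum>a<p. poly (falling_cubic j :: 'k poly) (of_nat a))"
      unfolding ev sum_distrib_left by (rule of_nat_sum)
    also have "\<dots> = (\<Sum>x\<in>UNIV. poly (falling_cubic j :: 'k poly) x)"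
      by (rule sum.reindex_bij_betw[OF F(2)])
    also have "\<dots> = - coeff (falling_cubic j :: 'k poly) (p - 1)"
    proof (rule sum_poly_over_field[where 'k = 'k, unfolded card])
      show "p \<ge> 4" using p by simp
      have "degree (falling_cubic j :: 'k poly) \<le> 3 * j"
        using coeff_falling_cubic[of j, where 'k = 'k] by (intro degree_le) auto
      then show "degree (falling_cubic j :: 'k poly) \<le> p + 1" using that by simp
    qed
    finally show ?thesis .
  qed
  \<comment> \<open>The least k with 3k \<ge> p - 1: for smaller j the falling factorial has degree
    below p - 1, so its values sum to 0.\<close>
  define k where "k = (p + 1) div 3"
  have "p mod 3 \<noteq> 0"
  proof
    assume "p mod 3 = 0"
    then have "3 dvd p" by (simp add: dvd_eq_mod_eq_0)
    then have "3 = p" by (intro primes_dvd_imp_eq) (use p in auto)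
    then show False using p by simp
  qed
  then have "p = 3 * k + 1 \<or> p + 1 = 3 * k" unfolding k_def by presburger
  then consider (1) "p = 3 * k + 1" | (2) "p + 1 = 3 * k" by blast
  note k_cases = this
  have k1: "k \<ge> 1" "2 * k < p - 1" "3 * k \<le> p + 1"
    using p(2) by (auto simp: k_def)
  have low: "p dvd (\<Sum>a<p. e a choose j)" if j: "j < k" for j
  proof -
    have "3 * j < p - 1" using j by (cases rule: k_cases) auto
    then have "coeff (falling_cubic j :: 'k poly) (p - 1) = 0"
      using coeff_falling_cubic[of j, where 'k = 'k] by auto
    then have "of_nat (fact j * (\<Sum>a<p. e a choose j)) = (0::'k)" using sum[of j] \<open>3 * j < p - 1\<close> by simp
    then have "p dvd fact j * (\<Sum>a<p. e a choose j)" by (simp only: zero_iff)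
    moreover have "\<not> p dvd (fact j :: nat)" using prime_dvd_fact_iff[OF p(1)] j k1 by simp
    ultimately show ?thesis using p(1) prime_dvd_mult_iff by blast
  qed
  have "coeff (falling_cubic k :: 'k poly) (p - 1) \<noteq> 0"
  proof (cases rule: k_cases)
    case 1
    then show ?thesis using coeff_falling_cubic[of k, where 'k = 'k] by simp
  next
    case 2
    have "coeff (falling_cubic k :: 'k poly) (3 * k - 2) = of_nat k"
      using coeff_falling_cubic[of k, where 'k = 'k] k1 by simp
    moreover have "p - 1 = 3 * k - 2" using 2 by simp
    moreover have "\<not> p dvd k" using k1 by (auto dest!: dvd_imp_le)
    ultimately show ?thesis by (simp add: zero_iff)
  qed
  then have "of_nat (fact k * (\<Sum>a<p. e a choose k)) \<noteq> (0::'k)" using sum[OF k1(3)] by simp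
  then have high: "\<not> p dvd (\<Sum>a<p. e a choose k)" unfolding zero_iff by (metis dvd_mult)
  have "\<not> supersingular \<chi>"
    by (rule not_supersingularI[OF card p(1) \<chi> \<zeta>(1) _ \<zeta>(2) w val low high k1(2)]) (use p in simp_all)
  moreover have "\<chi> \<noteq> principal_char"
  proof
    assume eq: "\<chi> = principal_char"
    have "\<zeta> ^ 2 = 1" using val[of 1] by (simp add: eq principal_char_def e_def power2_eq_square)
    then have "\<zeta> ^ p = \<zeta>"
      using p prime_odd_nat[of p] by (auto elim!: oddE simp: power_mult)
    then show False using \<zeta> by simp
  qed
  ultimately show ?thesis using \<chi> by blast
qed

text \<open>The roots over the prime field are compared with those over the given field by equating
  power sums. The lifted character must be nonprincipal for the period to say anything about
  it.\<close>

lemma supersingular_of_is_period: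
  fixes \<chi>0 :: "'a::{finite,field} prime_subfield poly \<Rightarrow> complex"
  assumes card: "CARD('a) = p ^ r" and p: "prime p" and r: "r \<ge> 1"
    and per: "is_period (normalized_error TYPE('a) l) N"
    and c0: "unit_char l \<chi>0" "\<chi>0 \<noteq> principal_char"
  shows "supersingular \<chi>0"
proof -
  let ?q = "of_nat CARD('a) :: complex"
  have N: "N \<ge> 1" using per by (simp add: is_period_def)
  have cp: "CARD('a prime_subfield) = p"
    using CARD_prime_subfield[where 'a = 'a] CHAR_eq_of_CARD[OF card p] by simp
  obtain \<chi> :: "'a poly \<Rightarrow> complex" where \<chi>: "unit_char l \<chi>"
    and bc: "\<And>n. n \<ge> 1 \<Longrightarrow> prime_power_sum \<chi> n = prime_power_sum \<chi>0 (r * n)"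
    using base_change[OF card p r c0(1)] by blast
  obtain A where A: "0 \<notin># A" "\<And>n. n \<ge> 1 \<Longrightarrow> prime_power_sum \<chi>0 n = - (\<Sum>g\<in>#A. g ^ n)"
    using L_roots_exist[OF c0] by (auto simp: L_roots_def)
  define B where "B = image_mset (\<lambda>g. g ^ r) A"
  have B0: "0 \<notin># B" using A(1) by (auto simp: B_def)
  have B: "prime_power_sum \<chi> n = - (\<Sum>g\<in>#B. g ^ n)" if "n \<ge> 1" for n
    using that r by (simp add: bc A(2) B_def image_mset.compositionality comp_def power_mult)
  have "\<chi> \<noteq> principal_char"
  proof
    assume "\<chi> = principal_char"
    then have Z: "(\<Sum>g\<in>#add_mset ?q B. g ^ n) = 0" if "n \<ge> 1" for n
      using B[OF that] prime_power_sum_principal[OF that, where 'a = 'a] by simp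
    \<comment> \<open>With factor 0 and shift 1: a power sum vanishing for all n \<ge> 1 would force
      its nonzero base q to be 0.\<close>
    have "?q ^ 1 = 0"
    proof (rule power_sum_periodic_imp[of "add_mset ?q B"])
      fix n :: nat assume "n \<ge> 1"
      then show "(\<Sum>g\<in>#add_mset ?q B. g ^ (n + 1)) = 0 * (\<Sum>g\<in>#add_mset ?q B. g ^ n)"
        using Z[of "n + 1"] by simp
    qed (use B0 in auto)
    then show False by simp
  qed
  from period_imp_L_roots[OF per \<chi> this] obtain C where
    C: "\<And>n. n \<ge> 1 \<Longrightarrow> prime_power_sum \<chi> n = - (\<Sum>g\<in>#C. g ^ n)"
      "\<And>g. g \<in># C \<Longrightarrow> g ^ (2 * N) = of_nat (CARD('a) ^ N)"
    by (auto simp: L_roots_def)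
  have "(\<Sum>g\<in>#B. g ^ (n + 2 * N)) = of_nat (CARD('a) ^ N) * (\<Sum>g\<in>#B. g ^ n)" if n: "n \<ge> 1" for n
  proof -
    have "(\<Sum>g\<in>#B. g ^ (n + 2 * N)) = (\<Sum>g\<in>#C. g ^ (n + 2 * N))"
      using B[of "n + 2 * N"] C(1)[of "n + 2 * N"] n by simp
    also have "\<dots> = (\<Sum>g\<in>#C. of_nat (CARD('a) ^ N) * g ^ n)"
      by (intro arg_cong[of _ _ sum_mset] image_mset_cong) (simp add: power_add C(2))
    also have "\<dots> = of_nat (CARD('a) ^ N) * (\<Sum>g\<in>#C. g ^ n)" by (simp add: sum_mset_distrib_left)
    also have "(\<Sum>g\<in>#C. g ^ n) = (\<Sum>g\<in>#B. g ^ n)" using B[OF n] C(1)[OF n] by simp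
    finally show ?thesis .
  qed
  then have "x ^ (2 * N) = of_nat (CARD('a) ^ N)" if "x \<in># B" for x
    by (rule power_sum_periodic_imp[OF B0 _ that])
  then have "(g ^ r) ^ (2 * N) = of_nat (CARD('a) ^ N)" if "g \<in># A" for g
    using that by (simp add: B_def)
  then have "g ^ (2 * (r * N)) = of_nat p ^ (r * N)" if "g \<in># A" for g
    using that by (simp add: card ac_simps flip: power_mult)
  moreover have "r * N \<ge> 1" using r N by simp
  ultimately show ?thesis unfolding supersingular_def cp using A(2) by blast
qed

theorem corollary1p4:
  fixes l p r :: nat
  assumes "l \<ge> 1" and "prime p" and "r \<ge> 1"
    and "CARD('a::{finite,field}) = p ^ r"
  shows "(periodic (normalized_error TYPE('a) l) \<longleftrightarrow> l = 1 \<or> l = 2 \<or> (l = 3 \<and> p \<in> {2, 5}))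
    \<and> (l = 1 \<longrightarrow> least_period (normalized_error TYPE('a) l) = 1)
    \<and> (l = 2 \<longrightarrow> least_period (normalized_error TYPE('a) l) dvd 4 * p)
    \<and> (l = 3 \<and> p \<in> {2, 5} \<longrightarrow> least_period (normalized_error TYPE('a) l) dvd 12 * p)"
proof -
  let ?f = "normalized_error TYPE('a) l"
  have char: "CHAR('a) = p" by (rule CHAR_eq_of_CARD[OF assms(4,2)])
  have cp: "CARD('a prime_subfield) = p" using CARD_prime_subfield[where 'a = 'a] char by simp
  have 1: "is_period ?f 1" if "l = 1" using is_period_level_1[where 'a = 'a] that by simp
  have 2: "is_period ?f (4 * p)" if "l = 2"
    using is_period_level_2[where 'a = 'a] assms(4) char that by simp
  have 3: "is_period ?f (12 * p)" if "l = 3" "p \<in> {2, 5}"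
    using is_period_level_3[where 'a = 'a] assms(4) char that by simp
  have "l = 1 \<or> l = 2 \<or> l = 3 \<and> p \<in> {2, 5}" if "is_period ?f N" for N
  proof (rule ccontr)
    assume not: "\<not> ?thesis"
    have contra: False if "m \<le> l" and "\<exists>\<chi> :: 'a prime_subfield poly \<Rightarrow> complex.
        unit_char m \<chi> \<and> \<chi> \<noteq> principal_char \<and> \<not> supersingular \<chi>" for m
      using that supersingular_of_is_period[OF assms(4,2,3) \<open>is_period ?f N\<close>] unit_char_mono by blast
    have "p \<in> {2, 3, 5} \<or> p \<ge> 7"
    proof -
      have "p \<noteq> 4" "p \<noteq> 6" using prime_odd_nat[OF assms(2)] by auto
      then show ?thesis using prime_ge_2_nat[OF assms(2)] by auto
    qed
    then consider "p = 2" "l \<ge> 4" | "p = 3" "l \<ge> 3" | "p = 5" "l \<ge> 4" | "p \<ge> 7" "l \<ge> 3"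
      using not assms(1) by fastforce
    then show False
    proof cases
      case 1
      then show False using contra[OF _ exists_not_supersingular_2] cp by simp
    next
      case 2
      then show False using contra[OF _ exists_not_supersingular_3] cp by simp
    next
      case 3
      then show False using contra[OF _ exists_not_supersingular_5] cp by simp
    next
      case 4
      then show False using contra[OF _ exists_not_supersingular_ge_7[OF cp assms(2)]] by simp
    qed
  qed
  then show ?thesis using 1 2 3 least_period_dvd[of ?f] unfolding periodic_def
    by (metis dvd_1_iff_1 nat_dvd_1_iff_1)
qed

end
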